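(* Let $k$ be a field, $\mathcal{T}$ a Krull-Schmidt, $k$-linear, Hom-finite triangulated category, and let $T,U$ be basic silting objects of $\mathcal{T}$ with $T\geq U$. If there exist only finitely many basic silting objects $P$ of $\mathcal{T}$ (up to isomorphism) satisfying $T\geq P\geq U$, then $U$ is left-connected to $T$, i.e. $U$ can be obtained from $T$ (up to isomorphism) by iterated irreducible left mutation.
   Context: Hom-finite means $\dim_k\operatorname{Hom}_{\mathcal{T}}(X,Y)<\infty$ for all objects $X,Y$. For an object $M$, $\operatorname{add} M$ is the smallest full subcategory of $\mathcal{T}$ containing $M$ closed under finite direct sums, direct summands and isomorphisms; $\operatorname{thick} M$ is the smallest thick subcategory containing $M$. An object is basic if its endomorphism algebra is basic. An object $T$ of $\mathcal{T}$ is silting if $\operatorname{Hom}_{\mathcal{T}}(T,T[i])=0$ for all $i>0$ and $\mathcal{T}=\operatorname{thick} T$. For objects $M,N$, $M\geq N$ means $\operatorname{Hom}_{\mathcal{T}}(M,N[i])=0$ for all $i>0$ (this is a partial order on isomorphism classes of basic silting objects). Left mutation: let $T=X\oplus M$ be a basic silting object. Take a triangle $X\xrightarrow{f}M'\to Y\to X[1]$ with $f$ a minimal left $\operatorname{add} M$-approximation of $X$ (i.e. $M'\in\operatorname{add}M$, $\operatorname{Hom}_{\mathcal{T}}(f,N)$ is surjective for every $N\in\operatorname{add}M$, and any $g:M'\to M'$ with $gf=f$ is an isomorphism). Then $\mu_X^+(T):=Y\oplus M$ is again a basic silting object, called the left mutation of $T$ with respect to $X$; it is irreducible if $X$ is indecomposable.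 *)

theory Defs
  imports Complex_Main "HOL-Algebra.QuotRing" "HOL-Algebra.Chinese_Remainder"
begin

section \<open>Rings\<close>

text \<open>The ring notions below are needed for endomorphism rings, which are not commutative.\<close>

definition division_ring :: "('a, 'b) ring_scheme \<Rightarrow> bool" where
  "division_ring D \<longleftrightarrow> ring D \<and> \<one>\<^bsub>D\<^esub> \<noteq> \<zero>\<^bsub>D\<^esub> \<and> Units D = carrier D - {\<zero>\<^bsub>D\<^esub>}"

definition noncomm_local_ring :: "('a, 'b) ring_scheme \<Rightarrow> bool" where
  "noncomm_local_ring R \<longleftrightarrow> ring R \<and> \<one>\<^bsub>R\<^esub> \<noteq> \<zero>\<^bsub>R\<^esub> \<and>
     (\<forall>a \<in> carrier R - Units R. \<forall>b \<in> carrier R - Units R. a \<oplus>\<^bsub>R\<^esub> b \<notin> Units R)"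

definition right_ideal :: "'a set \<Rightarrow> ('a, 'b) ring_scheme \<Rightarrow> bool" where
  "right_ideal I R \<longleftrightarrow> additive_subgroup I R \<and>
     (\<forall>a \<in> I. \<forall>r \<in> carrier R. a \<otimes>\<^bsub>R\<^esub> r \<in> I)"

definition maximal_right_ideal :: "'a set \<Rightarrow> ('a, 'b) ring_scheme \<Rightarrow> bool" where
  "maximal_right_ideal I R \<longleftrightarrow> right_ideal I R \<and> I \<noteq> carrier R \<and>
     (\<forall>J. right_ideal J R \<and> I \<subseteq> J \<longrightarrow> J = I \<or> J = carrier R)"

definition jacobson_radical :: "('a, 'b) ring_scheme \<Rightarrow> 'a set" where
  "jacobson_radical R = {a \<in> carrier R. \<forall>I. maximal_right_ideal I R \<longrightarrow> a \<in> I}"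

text \<open>
  A finite-dimensional algebra \<open>A\<close> is basic if \<open>A / rad A\<close> is a finite product of division
  rings. Each factor is isomorphic to an ideal of the quotient, so it is no restriction
  that the factors range over rings on the element type of the quotient.
\<close>
definition basic_algebra :: "('a, 'b) ring_scheme \<Rightarrow> bool" where
  "basic_algebra A \<longleftrightarrow> (\<exists>Ds :: 'a set ring list.
     (\<forall>D \<in> set Ds. division_ring D) \<and> A Quot (jacobson_radical A) \<simeq> RDirProd_list Ds)"


section \<open>Linear and triangulated categories\<close>

text \<open>
  The objects of the category are all elements of the type \<open>'o\<close>. Every morphism is an element
  of \<open>'m\<close>, and \<open>Hom C X Y\<close> is the set of morphisms from \<open>X\<close> to \<open>Y\<close>. The Hom spaces are
  subspaces of one vector space \<open>'m\<close>; for an arbitrary linear category one can take for \<open>'m\<close>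
  the direct sum of all Hom spaces, with composition extended bilinearly by zero and the
  shift extended linearly. Since a morphism need not determine its source and target
  (zero morphisms never do), these are always supplied by membership in \<open>Hom C X Y\<close>,
  and triangles carry their objects.
  \<open>g \<star> f\<close> is the composite of \<open>f\<close> followed by \<open>g\<close>; \<open>ShO\<close> and \<open>ShM\<close> are the shift \<open>[1]\<close> on
  objects and on morphisms; \<open>Dist C X Y Z f g h\<close> says that
  \<open>X \<rightarrow> Y \<rightarrow> Z \<rightarrow> X[1]\<close>, with maps \<open>f\<close>, \<open>g\<close>, \<open>h\<close>, is a distinguished triangle.
\<close>
record ('k, 'o, 'm) shift_category =
  Scale :: "'k \<Rightarrow> 'm \<Rightarrow> 'm"
  Hom :: "'o \<Rightarrow> 'o \<Rightarrow> 'm set"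
  Comp :: "'m \<Rightarrow> 'm \<Rightarrow> 'm" (infixr \<open>\<star>\<index>\<close> 75)
  Ident :: "'o \<Rightarrow> 'm"
  ShO :: "'o \<Rightarrow> 'o"
  ShM :: "'m \<Rightarrow> 'm"
  Dist :: "'o \<Rightarrow> 'o \<Rightarrow> 'o \<Rightarrow> 'm \<Rightarrow> 'm \<Rightarrow> 'm \<Rightarrow> bool"

locale linear_category = vector_space "Scale C"
  for C :: "('k::field, 'o, 'm::ab_group_add) shift_category" (structure) +
  assumes Hom_subspace: "subspace (Hom C X Y)"
    and Ident_in_Hom: "Ident C X \<in> Hom C X X"
    and Comp_in_Hom: "\<lbrakk>f \<in> Hom C X Y; g \<in> Hom C Y Z\<rbrakk> \<Longrightarrow> g \<star> f \<in> Hom C X Z"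
    and Comp_assoc: "\<lbrakk>f \<in> Hom C W X; g \<in> Hom C X Y; h \<in> Hom C Y Z\<rbrakk>
          \<Longrightarrow> (h \<star> g) \<star> f = h \<star> (g \<star> f)"
    and Ident_left: "f \<in> Hom C X Y \<Longrightarrow> Ident C Y \<star> f = f"
    and Ident_right: "f \<in> Hom C X Y \<Longrightarrow> f \<star> Ident C X = f"
    and Comp_add_left: "\<lbrakk>f \<in> Hom C X Y; g \<in> Hom C Y Z; g' \<in> Hom C Y Z\<rbrakk>
          \<Longrightarrow> (g + g') \<star> f = g \<star> f + g' \<star> f"
    and Comp_add_right: "\<lbrakk>f \<in> Hom C X Y; f' \<in> Hom C X Y; g \<in> Hom C Y Z\<rbrakk>
          \<Longrightarrow> g \<star> (f + f') = g \<star> f + g \<star> f'"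
    and Comp_scale_left: "\<lbrakk>f \<in> Hom C X Y; g \<in> Hom C Y Z\<rbrakk>
          \<Longrightarrow> Scale C r g \<star> f = Scale C r (g \<star> f)"
    and Comp_scale_right: "\<lbrakk>f \<in> Hom C X Y; g \<in> Hom C Y Z\<rbrakk>
          \<Longrightarrow> g \<star> Scale C r f = Scale C r (g \<star> f)"

definition End_ring :: "('k, 'o, 'm::ab_group_add) shift_category \<Rightarrow> 'o \<Rightarrow> 'm ring" where
  "End_ring C X = \<lparr>carrier = Hom C X X, mult = Comp C, one = Ident C X, zero = 0, add = (+)\<rparr>"

definition iso_mor :: "('k, 'o, 'm) shift_category \<Rightarrow> 'o \<Rightarrow> 'o \<Rightarrow> 'm \<Rightarrow> bool" where
  "iso_mor C X Y f \<longleftrightarrow> f \<in> Hom C X Y \<and>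
     (\<exists>g \<in> Hom C Y X. Comp C g f = Ident C X \<and> Comp C f g = Ident C Y)"

definition iso_obj :: "('k, 'o, 'm) shift_category \<Rightarrow> 'o \<Rightarrow> 'o \<Rightarrow> bool" where
  "iso_obj C X Y \<longleftrightarrow> (\<exists>f. iso_mor C X Y f)"

definition zero_obj :: "('k, 'o, 'm::zero) shift_category \<Rightarrow> 'o \<Rightarrow> bool" where
  "zero_obj C Z \<longleftrightarrow> (\<forall>X. Hom C X Z = {0} \<and> Hom C Z X = {0})"

text \<open>\<open>direct_sum C X Y W\<close>: \<open>W\<close> is a direct sum (biproduct) of \<open>X\<close> and \<open>Y\<close>.\<close>
definition direct_sum :: "('k, 'o, 'm::ab_group_add) shift_category \<Rightarrow> 'o \<Rightarrow> 'o \<Rightarrow> 'o \<Rightarrow> bool"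
  where
  "direct_sum C X Y W \<longleftrightarrow>
     (\<exists>i \<in> Hom C X W. \<exists>j \<in> Hom C Y W. \<exists>p \<in> Hom C W X. \<exists>q \<in> Hom C W Y.
        Comp C p i = Ident C X \<and> Comp C q j = Ident C Y \<and>
        Comp C q i = 0 \<and> Comp C p j = 0 \<and>
        Comp C i p + Comp C j q = Ident C W)"

primrec direct_sum_list :: "('k, 'o, 'm::ab_group_add) shift_category \<Rightarrow> 'o list \<Rightarrow> 'o \<Rightarrow> bool"
  where
  "direct_sum_list C [] W \<longleftrightarrow> zero_obj C W"
| "direct_sum_list C (X # Xs) W \<longleftrightarrow> (\<exists>V. direct_sum_list C Xs V \<and> direct_sum C X V W)"

locale triangulated_category = linear_category C
  for C :: "('k::field, 'o, 'm::ab_group_add) shift_category" (structure) +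
  assumes zero_obj_exists: "\<exists>Z. zero_obj C Z"
    and direct_sum_exists: "\<exists>W. direct_sum C X Y W"
    \<comment> \<open>the shift is a linear auto-equivalence\<close>
    and ShM_in_Hom: "f \<in> Hom C X Y \<Longrightarrow> ShM C f \<in> Hom C (ShO C X) (ShO C Y)"
    and ShM_Ident: "ShM C (Ident C X) = Ident C (ShO C X)"
    and ShM_Comp: "\<lbrakk>f \<in> Hom C X Y; g \<in> Hom C Y Z\<rbrakk> \<Longrightarrow> ShM C (g \<star> f) = ShM C g \<star> ShM C f"
    and ShM_add: "\<lbrakk>f \<in> Hom C X Y; g \<in> Hom C X Y\<rbrakk> \<Longrightarrow> ShM C (f + g) = ShM C f + ShM C g"
    and ShM_scale: "f \<in> Hom C X Y \<Longrightarrow> ShM C (Scale C r f) = Scale C r (ShM C f)"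
    and ShM_bij: "bij_betw (ShM C) (Hom C X Y) (Hom C (ShO C X) (ShO C Y))"
    and ShO_ess_surj: "\<exists>X. iso_obj C (ShO C X) Y"
    \<comment> \<open>distinguished triangles\<close>
    and Dist_in_Hom: "Dist C X Y Z f g h
          \<Longrightarrow> f \<in> Hom C X Y \<and> g \<in> Hom C Y Z \<and> h \<in> Hom C Z (ShO C X)"
    and Dist_iso: "\<lbrakk>Dist C X Y Z f g h;
          f' \<in> Hom C X' Y'; g' \<in> Hom C Y' Z'; h' \<in> Hom C Z' (ShO C X');
          iso_mor C X X' a; iso_mor C Y Y' b; iso_mor C Z Z' c;
          b \<star> f = f' \<star> a; c \<star> g = g' \<star> b; ShM C a \<star> h = h' \<star> c\<rbrakk>
          \<Longrightarrow> Dist C X' Y' Z' f' g' h'"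
    and Dist_Ident: "zero_obj C Z \<Longrightarrow> Dist C X X Z (Ident C X) 0 0"
    and Dist_cone: "f \<in> Hom C X Y \<Longrightarrow> \<exists>Z g h. Dist C X Y Z f g h"
    and Dist_rotate: "\<lbrakk>f \<in> Hom C X Y; g \<in> Hom C Y Z; h \<in> Hom C Z (ShO C X)\<rbrakk>
          \<Longrightarrow> Dist C X Y Z f g h \<longleftrightarrow> Dist C Y Z (ShO C X) g h (- ShM C f)"
    and Dist_morphism: "\<lbrakk>Dist C X Y Z f g h; Dist C X' Y' Z' f' g' h';
          a \<in> Hom C X X'; b \<in> Hom C Y Y'; b \<star> f = f' \<star> a\<rbrakk>
          \<Longrightarrow> \<exists>c \<in> Hom C Z Z'. c \<star> g = g' \<star> b \<and> ShM C a \<star> h = h' \<star> c"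
    \<comment> \<open>the octahedral axiom\<close>
    and Dist_octahedron: "\<lbrakk>Dist C X Y Z' f u u'; Dist C Y Z X' g v v'; Dist C X Z Y' (g \<star> f) w w'\<rbrakk>
          \<Longrightarrow> \<exists>a b. Dist C Z' Y' X' a b (ShM C u \<star> v') \<and>
                a \<star> u = w \<star> g \<and> w' \<star> a = u' \<and> b \<star> w = v \<and> v' \<star> b = ShM C f \<star> w'"

locale hom_finite_triangulated_category = triangulated_category C
  for C :: "('k::field, 'o, 'm::ab_group_add) shift_category" (structure) +
  assumes Hom_finite_dim: "\<exists>B. finite B \<and> span B = Hom C X Y"

locale krull_schmidt_triangulated_category = hom_finite_triangulated_category C
  for C :: "('k::field, 'o, 'm::ab_group_add) shift_category" (structure) +
  assumes krull_schmidt: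
    "\<exists>Xs. direct_sum_list C Xs X \<and> (\<forall>Y \<in> set Xs. noncomm_local_ring (End_ring C Y))"


section \<open>Silting objects and mutation\<close>

text \<open>Full subcategories are represented by their sets of objects.\<close>

inductive_set add_subcat :: "('k, 'o, 'm::ab_group_add) shift_category \<Rightarrow> 'o \<Rightarrow> 'o set"
  for C M where
  self: "M \<in> add_subcat C M"
| zero: "zero_obj C Z \<Longrightarrow> Z \<in> add_subcat C M"
| sum: "\<lbrakk>X \<in> add_subcat C M; Y \<in> add_subcat C M; direct_sum C X Y W\<rbrakk> \<Longrightarrow> W \<in> add_subcat C M"
| summand: "\<lbrakk>W \<in> add_subcat C M; direct_sum C X Y W\<rbrakk> \<Longrightarrow> X \<in> add_subcat C M"
| iso: "\<lbrakk>X \<in> add_subcat C M; iso_obj C X Y\<rbrakk> \<Longrightarrow> Y \<in> add_subcat C M"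

text \<open>
  Closure under \<open>[-1]\<close> is expressed by \<open>unshift\<close>, as \<open>[-1]\<close> is only defined up to isomorphism.
\<close>
inductive_set thick :: "('k, 'o, 'm::ab_group_add) shift_category \<Rightarrow> 'o \<Rightarrow> 'o set"
  for C M where
  self: "M \<in> thick C M"
| shift: "X \<in> thick C M \<Longrightarrow> ShO C X \<in> thick C M"
| unshift: "ShO C X \<in> thick C M \<Longrightarrow> X \<in> thick C M"
| cone: "\<lbrakk>X \<in> thick C M; Y \<in> thick C M; Dist C X Y Z f g h\<rbrakk> \<Longrightarrow> Z \<in> thick C M"
| summand: "\<lbrakk>W \<in> thick C M; direct_sum C X Y W\<rbrakk> \<Longrightarrow> X \<in> thick C M"
| iso: "\<lbrakk>X \<in> thick C M; iso_obj C X Y\<rbrakk> \<Longrightarrow> Y \<in> thick C M"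

definition silting_ge :: "('k, 'o, 'm::ab_group_add) shift_category \<Rightarrow> 'o \<Rightarrow> 'o \<Rightarrow> bool" where
  "silting_ge C M N \<longleftrightarrow> (\<forall>i::nat. i > 0 \<longrightarrow> Hom C M ((ShO C ^^ i) N) = {0})"

definition silting :: "('k, 'o, 'm::ab_group_add) shift_category \<Rightarrow> 'o \<Rightarrow> bool" where
  "silting C T \<longleftrightarrow> (\<forall>i::nat. i > 0 \<longrightarrow> Hom C T ((ShO C ^^ i) T) = {0}) \<and> thick C T = UNIV"

definition basic_obj :: "('k, 'o, 'm::ab_group_add) shift_category \<Rightarrow> 'o \<Rightarrow> bool" where
  "basic_obj C X \<longleftrightarrow> basic_algebra (End_ring C X)"

definition basic_silting :: "('k, 'o, 'm::ab_group_add) shift_category \<Rightarrow> 'o \<Rightarrow> bool" where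
  "basic_silting C T \<longleftrightarrow> basic_obj C T \<and> silting C T"

definition indecomposable :: "('k, 'o, 'm::ab_group_add) shift_category \<Rightarrow> 'o \<Rightarrow> bool" where
  "indecomposable C X \<longleftrightarrow> \<not> zero_obj C X \<and>
     (\<forall>A B. direct_sum C A B X \<longrightarrow> zero_obj C A \<or> zero_obj C B)"

definition left_add_approximation ::
  "('k, 'o, 'm::ab_group_add) shift_category \<Rightarrow> 'o \<Rightarrow> 'o \<Rightarrow> 'o \<Rightarrow> 'm \<Rightarrow> bool" where
  "left_add_approximation C M X M' f \<longleftrightarrow> M' \<in> add_subcat C M \<and> f \<in> Hom C X M' \<and>
     (\<forall>N \<in> add_subcat C M. \<forall>h \<in> Hom C X N. \<exists>h' \<in> Hom C M' N. Comp C h' f = h)"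

definition left_minimal :: "('k, 'o, 'm) shift_category \<Rightarrow> 'o \<Rightarrow> 'm \<Rightarrow> bool" where
  "left_minimal C M' f \<longleftrightarrow> (\<forall>g \<in> Hom C M' M'. Comp C g f = f \<longrightarrow> iso_mor C M' M' g)"

text \<open>
  \<open>left_mutation C X M T V\<close>: \<open>T = X \<oplus> M\<close> is a basic silting object and
  \<open>V\<close> is (isomorphic to) its left mutation \<open>Y \<oplus> M\<close> with respect to \<open>X\<close>.
\<close>
definition left_mutation ::
  "('k, 'o, 'm::ab_group_add) shift_category \<Rightarrow> 'o \<Rightarrow> 'o \<Rightarrow> 'o \<Rightarrow> 'o \<Rightarrow> bool" where
  "left_mutation C X M T V \<longleftrightarrow> basic_silting C T \<and> direct_sum C X M T \<and>
     (\<exists>M' Y f g h. left_add_approximation C M X M' f \<and> left_minimal C M' f \<and>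
        Dist C X M' Y f g h \<and> direct_sum C Y M V)"

definition irreducible_left_mutation ::
  "('k, 'o, 'm::ab_group_add) shift_category \<Rightarrow> 'o \<Rightarrow> 'o \<Rightarrow> bool" where
  "irreducible_left_mutation C T V \<longleftrightarrow> (\<exists>X M. indecomposable C X \<and> left_mutation C X M T V)"

text \<open>\<open>U\<close> is left-connected to \<open>T\<close>.\<close>
definition left_connected :: "('k, 'o, 'm::ab_group_add) shift_category \<Rightarrow> 'o \<Rightarrow> 'o \<Rightarrow> bool" where
  "left_connected C U T \<longleftrightarrow>
     (\<exists>V. (irreducible_left_mutation C)\<^sup>*\<^sup>* T V \<and> iso_obj C V U)"

definition iso_rel :: "('k, 'o, 'm) shift_category \<Rightarrow> ('o \<times> 'o) set" where
  "iso_rel C = {(X, Y). iso_obj C X Y}"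

end

theory Submission
  imports Defs
begin

text \<open>
  Left mutation lowers a silting object in the order \<open>silting_ge\<close>. If \<open>T \<ge> U\<close> and also \<open>U \<ge> T\<close>,
  then \<open>T\<close> and \<open>U\<close> are isomorphic (\<open>silting_ge_antisym\<close>). Otherwise there is an irreducible left
  mutation \<open>V\<close> of \<open>T\<close> with \<open>T \<ge> V \<ge> U\<close> and not \<open>V \<ge> T\<close> (\<open>left_mutation_step\<close>). By transitivity
  (\<open>silting_ge_trans\<close>) every object between \<open>V\<close> and \<open>U\<close> lies between \<open>T\<close> and \<open>U\<close>, and the
  isomorphism class of \<open>T\<close> is lost, so a finite interval is exhausted after finitely many mutations.

  The point is to choose the summand \<open>X\<close> of \<open>T = X \<oplus> M\<close>. For the triangle \<open>X \<rightarrow> M' \<rightarrow> Y \<rightarrow> X[1]\<close>,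
  the vanishing of \<open>Hom(Y, U[1])\<close> says that every map \<open>X \<rightarrow> U\<close> factors through \<open>M'\<close>; all the other
  vanishing conditions behind \<open>Y \<oplus> M \<ge> U\<close> are inherited from \<open>T\<close>. Let \<open>l\<close> be the largest degree with
  \<open>Hom(U, T[l]) \<noteq> 0\<close>, which is positive when \<open>U \<ge> T\<close> fails, and let \<open>G: U \<rightarrow> Q\<close> be a minimal left
  approximation in \<open>add T[l]\<close>. Any \<open>X\<close> such that \<open>X[l]\<close> is a local summand of \<open>Q\<close> will do
  (\<open>mutable_summand_exists\<close>). Indeed, for \<open>h: X \<rightarrow> U\<close> the composite \<open>U \<rightarrow> Q \<rightarrow> X[l] \<rightarrow> U[l]\<close> vanishes since
  \<open>U\<close> is silting, so \<open>Q \<rightarrow> X[l] \<rightarrow> U[l]\<close> factors through the cone \<open>Z\<close> of \<open>G\<close>. By the choice of \<open>l\<close> there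
  are no maps from \<open>Z\<close> to \<open>T[j]\<close> for \<open>j > l\<close>, and therefore \<open>Z \<rightarrow> U[l]\<close> lifts along a right \<open>add T\<close>
  approximation \<open>T0[l] \<rightarrow> U[l]\<close>. Thus \<open>h\<close> factors as \<open>X \<rightarrow> T0 \<rightarrow> U\<close>, and minimality of \<open>G\<close> forces the
  first map into the radical. So \<open>Hom(X, U)\<close> is generated, modulo the maps through \<open>M\<close>, by
  \<open>Hom(X, U)\<close> times the radical of the local ring \<open>End(X)\<close>, and Nakayama's lemma (\<open>local_nakayama\<close>)
  shows that all maps \<open>X \<rightarrow> U\<close> factor through \<open>M\<close>.

  The lifting step rests on \<open>silting_vanishing\<close>: if \<open>Hom(Z, T[i]) = 0\<close> for all \<open>i \<ge> n\<close>, the same holds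
  with \<open>T\<close> replaced by any \<open>Y\<close> with \<open>T \<ge> Y\<close>. Right approximations embed \<open>Hom(Z, Y[j])\<close> into
  \<open>Hom(Z, Y'[j+1])\<close> with \<open>T \<ge> Y'\<close> again, and since \<open>Z\<close> is in \<open>thick T\<close> these groups vanish in all
  large degrees, uniformly in \<open>Y'\<close> (\<open>thick_bounded\<close>). The same statement gives transitivity of \<open>silting_ge\<close>
  and, in degree one, its antisymmetry.

  It remains to see that \<open>V = Y \<oplus> M\<close> is basic silting. The silting conditions are long exact sequences.
  Basic objects are recognised by pairwise non-isomorphic local summands (\<open>basic_nonsplit\<close>,
  \<open>basic_if_pairwise_non_isomorphic\<close>); here \<open>Y\<close> is local because its endomorphisms lift to
  endomorphisms of the triangle (\<open>cone_local\<close>), and it is no summand of \<open>M\<close> because the map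
  \<open>Y \<rightarrow> X[1]\<close> is nonzero while \<open>Hom(M, X[1]) = 0\<close> (\<open>cone_not_summand\<close>).
\<close>

section \<open>Linear categories\<close>

context linear_category
begin

lemma zero_in_Hom: "0 \<in> Hom C X Y"
  by (rule subspace_0[OF Hom_subspace])

lemma add_in_Hom: "\<lbrakk>f \<in> Hom C X Y; g \<in> Hom C X Y\<rbrakk> \<Longrightarrow> f + g \<in> Hom C X Y"
  by (rule subspace_add[OF Hom_subspace])

lemma diff_in_Hom: "\<lbrakk>f \<in> Hom C X Y; g \<in> Hom C X Y\<rbrakk> \<Longrightarrow> f - g \<in> Hom C X Y"
  by (rule subspace_diff[OF Hom_subspace])

lemma uminus_in_Hom: "f \<in> Hom C X Y \<Longrightarrow> - f \<in> Hom C X Y"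
  by (rule subspace_neg[OF Hom_subspace])

lemma scale_in_Hom: "f \<in> Hom C X Y \<Longrightarrow> Scale C r f \<in> Hom C X Y"
  by (rule subspace_scale[OF Hom_subspace])

lemma sum_in_Hom: "(\<And>i. i \<in> I \<Longrightarrow> f i \<in> Hom C X Y) \<Longrightarrow> (\<Sum>i\<in>I. f i) \<in> Hom C X Y"
  by (rule subspace_sum[OF Hom_subspace])

lemma Comp_zero_left: "f \<in> Hom C X Y \<Longrightarrow> 0 \<star> f = 0"
  using Comp_add_left[of f X Y 0 Y 0] by (simp add: zero_in_Hom)

lemma Comp_zero_right: "g \<in> Hom C Y Z \<Longrightarrow> g \<star> 0 = 0"
  using Comp_add_right[of 0 Y Y 0 g Z] by (simp add: zero_in_Hom)

lemma Comp_uminus_left: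
  assumes "f \<in> Hom C X Y" "g \<in> Hom C Y Z"
  shows "(- g) \<star> f = - (g \<star> f)"
proof -
  have "(- g + g) \<star> f = (- g) \<star> f + g \<star> f"
    by (rule Comp_add_left[OF assms(1) uminus_in_Hom[OF assms(2)] assms(2)])
  thus ?thesis using Comp_zero_left[OF assms(1)] by (simp add: eq_neg_iff_add_eq_0)
qed

lemma Comp_uminus_right:
  assumes "f \<in> Hom C X Y" "g \<in> Hom C Y Z"
  shows "g \<star> (- f) = - (g \<star> f)"
proof -
  have "g \<star> (- f + f) = g \<star> (- f) + g \<star> f"
    by (rule Comp_add_right[OF uminus_in_Hom[OF assms(1)] assms(1) assms(2)])
  thus ?thesis using Comp_zero_right[OF assms(2)] by (simp add: eq_neg_iff_add_eq_0)
qed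

lemma Comp_diff_left:
  assumes "f \<in> Hom C X Y" "g \<in> Hom C Y Z" "g' \<in> Hom C Y Z"
  shows "(g - g') \<star> f = g \<star> f - g' \<star> f"
  using Comp_add_left[OF assms(1,2) uminus_in_Hom[OF assms(3)]] Comp_uminus_left[OF assms(1,3)]
  by simp

lemma Comp_diff_right:
  assumes "f \<in> Hom C X Y" "f' \<in> Hom C X Y" "g \<in> Hom C Y Z"
  shows "g \<star> (f - f') = g \<star> f - g \<star> f'"
  using Comp_add_right[OF assms(1) uminus_in_Hom[OF assms(2)] assms(3)]
    Comp_uminus_right[OF assms(2,3)] by simp

lemma Comp_sum_left:
  assumes "f \<in> Hom C X Y" "\<And>i. i \<in> I \<Longrightarrow> g i \<in> Hom C Y Z"
  shows "(\<Sum>i\<in>I. g i) \<star> f = (\<Sum>i\<in>I. g i \<star> f)"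
  using assms(2)
proof (induction I rule: infinite_finite_induct)
  case (insert i I)
  have "(g i + (\<Sum>i\<in>I. g i)) \<star> f = g i \<star> f + (\<Sum>i\<in>I. g i) \<star> f"
    using insert.prems by (intro Comp_add_left[OF assms(1)] sum_in_Hom) auto
  then show ?case using insert by simp
qed (use Comp_zero_left[OF assms(1)] in auto)

lemma Comp_sum_right:
  assumes "g \<in> Hom C Y Z" "\<And>i. i \<in> I \<Longrightarrow> f i \<in> Hom C X Y"
  shows "g \<star> (\<Sum>i\<in>I. f i) = (\<Sum>i\<in>I. g \<star> f i)"
  using assms(2)
proof (induction I rule: infinite_finite_induct)
  case (insert i I)
  have "g \<star> (f i + (\<Sum>i\<in>I. f i)) = g \<star> f i + g \<star> (\<Sum>i\<in>I. f i)"
    using insert.prems by (intro Comp_add_right[OF _ _ assms(1)] sum_in_Hom) auto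
  then show ?case using insert by simp
qed (use Comp_zero_right[OF assms(1)] in auto)

lemma zero_obj_iff: "zero_obj C Z \<longleftrightarrow> Ident C Z = 0"
proof
  assume "zero_obj C Z"
  then show "Ident C Z = 0" using Ident_in_Hom[of Z] by (auto simp: zero_obj_def)
next
  assume Z: "Ident C Z = 0"
  have "f = 0" if "f \<in> Hom C X Z" for f X
    using Ident_left[OF that] Comp_zero_left[OF that] Z by simp
  moreover have "f = 0" if "f \<in> Hom C Z X" for f X
    using Ident_right[OF that] Comp_zero_right[OF that] Z by simp
  ultimately show "zero_obj C Z"
    unfolding zero_obj_def using zero_in_Hom by blast
qed

subsection \<open>Isomorphisms\<close>

lemma iso_morI:
  "\<lbrakk>f \<in> Hom C X Y; g \<in> Hom C Y X; g \<star> f = Ident C X; f \<star> g = Ident C Y\<rbrakk> \<Longrightarrow> iso_mor C X Y f"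
  unfolding iso_mor_def by blast

lemma iso_mor_in_Hom: "iso_mor C X Y f \<Longrightarrow> f \<in> Hom C X Y"
  unfolding iso_mor_def by blast

lemma iso_mor_Ident: "iso_mor C X X (Ident C X)"
  by (rule iso_morI[of _ _ _ "Ident C X"]) (simp_all add: Ident_in_Hom Ident_left[OF Ident_in_Hom])

lemma iso_morE:
  assumes "iso_mor C X Y f"
  obtains g where "g \<in> Hom C Y X" "g \<star> f = Ident C X" "f \<star> g = Ident C Y" "iso_mor C Y X g"
  using assms unfolding iso_mor_def by blast

lemma iso_mor_if_inverses:
  assumes "f \<in> Hom C X Y" "a \<in> Hom C Y X" "b \<in> Hom C Y X" "a \<star> f = Ident C X" "f \<star> b = Ident C Y"
  shows "iso_mor C X Y f"
proof -
  have "a = a \<star> (f \<star> b)" using Ident_right[OF assms(2)] assms(5) by simp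
  also have "\<dots> = (a \<star> f) \<star> b" using Comp_assoc[OF assms(3,1,2)] by simp
  also have "\<dots> = b" using Ident_left[OF assms(3)] assms(4) by simp
  finally show ?thesis using assms by (auto intro: iso_morI)
qed

lemma iso_mor_Comp:
  assumes "iso_mor C X Y f" "iso_mor C Y Z g"
  shows "iso_mor C X Z (g \<star> f)"
proof -
  obtain f' where f': "f' \<in> Hom C Y X" "f' \<star> f = Ident C X" "f \<star> f' = Ident C Y"
    using assms(1) by (rule iso_morE)
  obtain g' where g': "g' \<in> Hom C Z Y" "g' \<star> g = Ident C Y" "g \<star> g' = Ident C Z"
    using assms(2) by (rule iso_morE)
  note f = iso_mor_in_Hom[OF assms(1)] and g = iso_mor_in_Hom[OF assms(2)]
  have 1: "(f' \<star> g') \<star> (g \<star> f) = Ident C X"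
  proof -
    have "(f' \<star> g') \<star> (g \<star> f) = f' \<star> ((g' \<star> g) \<star> f)"
      using f g f'(1) g'(1)
      by (simp add: Comp_assoc[OF Comp_in_Hom[OF f g] g'(1) f'(1)] Comp_assoc[OF f g g'(1)])
    then show ?thesis using f' g' f by (simp add: Ident_left)
  qed
  have 2: "(g \<star> f) \<star> (f' \<star> g') = Ident C Z"
  proof -
    have "(g \<star> f) \<star> (f' \<star> g') = g \<star> ((f \<star> f') \<star> g')"
      by (simp add: Comp_assoc[OF Comp_in_Hom[OF g'(1) f'(1)] f g] Comp_assoc[OF g'(1) f'(1) f])
    then show ?thesis using f' g' by (simp add: Ident_left)
  qed
  show ?thesis
    by (rule iso_morI[OF Comp_in_Hom[OF f g] Comp_in_Hom[OF g'(1) f'(1)] 1 2])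
qed

lemma iso_obj_refl: "iso_obj C X X"
  unfolding iso_obj_def using iso_mor_Ident by blast

lemma iso_obj_sym: "iso_obj C X Y \<Longrightarrow> iso_obj C Y X"
  unfolding iso_obj_def by (meson iso_morE)

lemma iso_obj_trans: "iso_obj C X Y \<Longrightarrow> iso_obj C Y Z \<Longrightarrow> iso_obj C X Z"
  unfolding iso_obj_def by (meson iso_mor_Comp)

lemma iso_mor_if_both_composites:
  assumes f: "f \<in> Hom C X Y" and g: "g \<in> Hom C Y X"
    and gf: "iso_mor C X X (g \<star> f)" and fg: "iso_mor C Y Y (f \<star> g)"
  shows "iso_mor C X Y f"
proof -
  obtain u where u: "u \<in> Hom C X X" "u \<star> (g \<star> f) = Ident C X" using gf by (rule iso_morE)
  obtain v where v: "v \<in> Hom C Y Y" "(f \<star> g) \<star> v = Ident C Y" using fg by (rule iso_morE)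
  show ?thesis
  proof (rule iso_mor_if_inverses[OF f])
    show "u \<star> g \<in> Hom C Y X" "g \<star> v \<in> Hom C Y X" using u v g by (auto intro: Comp_in_Hom)
    show "(u \<star> g) \<star> f = Ident C X" using u Comp_assoc[OF f g u(1)] by simp
    show "f \<star> (g \<star> v) = Ident C Y" using v Comp_assoc[OF v(1) g f] by simp
  qed
qed

lemma iso_mor_idempotent:
  assumes "iso_mor C X X e" "e \<star> e = e"
  shows "e = Ident C X"
proof -
  obtain u where u: "u \<in> Hom C X X" "u \<star> e = Ident C X" using assms(1) by (rule iso_morE)
  note e = iso_mor_in_Hom[OF assms(1)]
  have "e = (u \<star> e) \<star> e" using u e by (simp add: Ident_left)
  also have "\<dots> = u \<star> e" using Comp_assoc[OF e e u(1)] assms(2) by simp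
  finally show ?thesis using u by simp
qed

text \<open>
  If \<open>u\<close> inverts \<open>1 - g f\<close>, then \<open>1 + f u g\<close> inverts \<open>1 - f g\<close>.
\<close>
lemma iso_mor_Ident_minus_swap:
  assumes f: "f \<in> Hom C X Y" and g: "g \<in> Hom C Y X"
    and iso: "iso_mor C X X (Ident C X - g \<star> f)"
  shows "iso_mor C Y Y (Ident C Y - f \<star> g)"
proof -
  obtain u where u: "u \<in> Hom C X X" and u1: "u \<star> (Ident C X - g \<star> f) = Ident C X"
    and u2: "(Ident C X - g \<star> f) \<star> u = Ident C X" using iso by (rule iso_morE)
  have gf: "g \<star> f \<in> Hom C X X" and fg: "f \<star> g \<in> Hom C Y Y" and ug: "u \<star> g \<in> Hom C Y X"
    and fug: "f \<star> (u \<star> g) \<in> Hom C Y Y"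
    using f g u by (auto intro!: Comp_in_Hom)
  have gfu: "(g \<star> f) \<star> u = u - Ident C X" 
    using u2 by (simp add: Comp_diff_left[OF u Ident_in_Hom gf] Ident_left[OF u] algebra_simps)
  have ugf: "u \<star> (g \<star> f) = u - Ident C X" 
    using u1 by (simp add: Comp_diff_right[OF Ident_in_Hom gf u] Ident_right[OF u] algebra_simps)
  have 1: "(f \<star> g) \<star> (f \<star> (u \<star> g)) = f \<star> (u \<star> g) - f \<star> g"
  proof -
    have "(f \<star> g) \<star> (f \<star> (u \<star> g)) = f \<star> (((g \<star> f) \<star> u) \<star> g)"
      by (simp add: Comp_assoc[OF fug g f] Comp_assoc[OF g u gf] Comp_assoc[OF ug f g])
    also have "\<dots> = f \<star> (u \<star> g) - f \<star> g"
      by (simp add: gfu Comp_diff_left[OF g u Ident_in_Hom] Ident_left[OF g] Comp_diff_right[OF ug g f])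
    finally show ?thesis .
  qed
  have 2: "(f \<star> (u \<star> g)) \<star> (f \<star> g) = f \<star> (u \<star> g) - f \<star> g"
  proof -
    have "(f \<star> (u \<star> g)) \<star> (f \<star> g) = f \<star> ((u \<star> (g \<star> f)) \<star> g)"
      by (simp add: Comp_assoc[OF fg ug f] Comp_assoc[OF fg g u] Comp_assoc[OF g gf u]
        Comp_assoc[OF g f g])
    also have "\<dots> = f \<star> (u \<star> g) - f \<star> g"
      by (simp add: ugf Comp_diff_left[OF g u Ident_in_Hom] Ident_left[OF g] Comp_diff_right[OF ug g f])
    finally show ?thesis .
  qed
  let ?v = "Ident C Y + f \<star> (u \<star> g)"
  have v: "?v \<in> Hom C Y Y" using fug by (intro add_in_Hom Ident_in_Hom)
  have "(Ident C Y - f \<star> g) \<star> ?v = Ident C Y"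
    by (simp add: Comp_diff_left[OF v Ident_in_Hom fg] Ident_left[OF v]
        Comp_add_right[OF Ident_in_Hom fug fg] Ident_right[OF fg] 1)
  moreover have "?v \<star> (Ident C Y - f \<star> g) = Ident C Y"
    by (simp add: Comp_diff_right[OF Ident_in_Hom fg v] Ident_right[OF v]
        Comp_add_left[OF fg Ident_in_Hom fug] Ident_left[OF fg] 2)
  ultimately show ?thesis
    using v fg by (intro iso_morI[of _ _ _ ?v]) (auto intro: diff_in_Hom Ident_in_Hom)
qed

end

section \<open>Ideals of a linear category, and local objects\<close>

definition cat_ideal ::
  "('k, 'o, 'm::ab_group_add) shift_category \<Rightarrow> ('o \<Rightarrow> 'o \<Rightarrow> 'm set) \<Rightarrow> bool" where
  "cat_ideal C R \<longleftrightarrow>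
     (\<forall>X Y. R X Y \<subseteq> Hom C X Y \<and> 0 \<in> R X Y \<and> (\<forall>f\<in>R X Y. \<forall>g\<in>R X Y. f + g \<in> R X Y)) \<and>
     (\<forall>X Y Z. \<forall>f\<in>R X Y. \<forall>g\<in>Hom C Y Z. Comp C g f \<in> R X Z) \<and>
     (\<forall>W X Y. \<forall>f\<in>R X Y. \<forall>g\<in>Hom C W X. Comp C f g \<in> R W Y)"

text \<open>The Jacobson radical of a category; on endomorphism rings it is the usual one.\<close>
definition cat_radical ::
  "('k, 'o, 'm::ab_group_add) shift_category \<Rightarrow> 'o \<Rightarrow> 'o \<Rightarrow> 'm set" where
  "cat_radical C X Y = {f \<in> Hom C X Y. \<forall>g\<in>Hom C Y X. iso_mor C X X (Ident C X - Comp C g f)}"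

abbreviation local_obj :: "('k, 'o, 'm::ab_group_add) shift_category \<Rightarrow> 'o \<Rightarrow> bool" where
  "local_obj C X \<equiv> noncomm_local_ring (End_ring C X)"

context linear_category
begin

lemma ring_End_ring: "ring (End_ring C X)"
proof (rule ringI)
  show "abelian_group (End_ring C X)"
  proof (rule abelian_groupI)
    fix x assume "x \<in> carrier (End_ring C X)"
    then show "\<exists>y\<in>carrier (End_ring C X). y \<oplus>\<^bsub>End_ring C X\<^esub> x = \<zero>\<^bsub>End_ring C X\<^esub>"
      by (auto simp: End_ring_def intro!: bexI[of _ "- x"] uminus_in_Hom)
  qed (auto simp: End_ring_def add_in_Hom zero_in_Hom algebra_simps)
  show "Group.monoid (End_ring C X)"
    by (rule monoidI)
      (auto simp: End_ring_def Ident_in_Hom Comp_assoc[of _ X X _ X _ X] Ident_left Ident_right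
        intro: Comp_in_Hom)
qed (auto simp: End_ring_def Comp_add_left[of _ X X _ X] Comp_add_right[of _ X X _ _ X])

lemma End_ring_simps:
  "carrier (End_ring C X) = Hom C X X" "a \<otimes>\<^bsub>End_ring C X\<^esub> b = a \<star> b"
  "a \<oplus>\<^bsub>End_ring C X\<^esub> b = a + b" "\<one>\<^bsub>End_ring C X\<^esub> = Ident C X" "\<zero>\<^bsub>End_ring C X\<^esub> = 0"
  by (simp_all add: End_ring_def)

lemma Units_End_ring: "Units (End_ring C X) = {f. iso_mor C X X f}"
  by (auto simp: Units_def End_ring_def iso_mor_def)

lemma local_obj_iff:
  "local_obj C X \<longleftrightarrow> Ident C X \<noteq> 0 \<and>
     (\<forall>f\<in>Hom C X X. \<forall>g\<in>Hom C X X. iso_mor C X X (f + g) \<longrightarrow> iso_mor C X X f \<or> iso_mor C X X g)"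
  by (auto simp: noncomm_local_ring_def ring_End_ring End_ring_simps Units_End_ring)

lemma local_objD:
  "\<lbrakk>local_obj C X; f \<in> Hom C X X; g \<in> Hom C X X; iso_mor C X X (f + g)\<rbrakk>
    \<Longrightarrow> iso_mor C X X f \<or> iso_mor C X X g"
  by (simp add: local_obj_iff)

lemma local_not_iso_zero:
  assumes "local_obj C X" shows "\<not> iso_mor C X X 0"
proof
  assume "iso_mor C X X 0"
  then obtain g where "g \<in> Hom C X X" "g \<star> 0 = Ident C X" by (rule iso_morE)
  then show False using assms Comp_zero_right by (simp add: local_obj_iff)
qed

lemma local_obj_complement:
  "\<lbrakk>local_obj C X; f \<in> Hom C X X; \<not> iso_mor C X X f\<rbrakk> \<Longrightarrow> iso_mor C X X (Ident C X - f)"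
  using local_objD[of X f "Ident C X - f"] iso_mor_Ident[of X] by (simp add: diff_in_Hom Ident_in_Hom)

text \<open>
  If a sum \<open>f + g\<close> of endomorphisms is invertible, dividing by it turns the pair \<open>f\<close>, \<open>g\<close> into a pair
  of the form \<open>f\<close>, \<open>1 - f\<close>. So it is enough to test such pairs.
\<close>
lemma local_objI:
  assumes "Ident C X \<noteq> 0"
    and "\<And>f. f \<in> Hom C X X \<Longrightarrow> iso_mor C X X f \<or> iso_mor C X X (Ident C X - f)"
  shows "local_obj C X"
  unfolding local_obj_iff
proof (intro conjI ballI impI)
  fix f g assume f: "f \<in> Hom C X X" and g: "g \<in> Hom C X X" and fg: "iso_mor C X X (f + g)"
  obtain u where u: "u \<in> Hom C X X" "u \<star> (f + g) = Ident C X" "(f + g) \<star> u = Ident C X"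
    "iso_mor C X X u"
    using fg by (rule iso_morE)
  have cancel: "iso_mor C X X h" if "h \<in> Hom C X X" "iso_mor C X X (u \<star> h)" for h
  proof -
    have "h = (f + g) \<star> (u \<star> h)"
      using that u(3) Comp_assoc[OF that(1) u(1) add_in_Hom[OF f g]] by (simp add: Ident_left)
    then show ?thesis using iso_mor_Comp[OF that(2) fg] by simp
  qed
  have "u \<star> g = Ident C X - u \<star> f"
    using u(2) Comp_add_right[OF f g u(1)] by (simp add: algebra_simps)
  then show "iso_mor C X X f \<or> iso_mor C X X g"
    using assms(2)[OF Comp_in_Hom[OF f u(1)]] cancel[OF f] cancel[OF g] by auto
qed (rule assms(1))

lemma local_obj_sumD:
  assumes X: "local_obj C X" and "finite J" and "\<And>j. j \<in> J \<Longrightarrow> f j \<in> Hom C X X"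
    and "iso_mor C X X (\<Sum>j\<in>J. f j)"
  shows "\<exists>j\<in>J. iso_mor C X X (f j)"
  using assms(2-)
proof (induction J rule: finite_induct)
  case empty
  then show ?case using local_not_iso_zero[OF X] by simp
next
  case (insert j J)
  have "iso_mor C X X (f j) \<or> iso_mor C X X (\<Sum>j\<in>J. f j)"
    using insert by (intro local_objD[OF X]) (auto intro: sum_in_Hom)
  then show ?case using insert by auto
qed

text \<open>
  A left inverse \<open>g'\<close> of \<open>f\<close> yields the idempotent \<open>f g'\<close> of \<open>End(Y)\<close>. In a local ring it is \<open>0\<close> or \<open>1\<close>,
  and it is not \<open>0\<close> because \<open>X\<close> is not.
\<close>
lemma local_obj_iso_mor:
  assumes Y: "local_obj C Y" and X: "Ident C X \<noteq> 0" and f: "f \<in> Hom C X Y" and g: "g \<in> Hom C Y X"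
    and gf: "iso_mor C X X (g \<star> f)"
  shows "iso_mor C X Y f"
proof -
  obtain u where u: "u \<in> Hom C X X" "u \<star> (g \<star> f) = Ident C X" using gf by (rule iso_morE)
  let ?g = "u \<star> g"
  have g': "?g \<in> Hom C Y X" using u g by (auto intro: Comp_in_Hom)
  have g'f: "?g \<star> f = Ident C X" using u Comp_assoc[OF f g u(1)] by simp
  have fg': "f \<star> ?g \<in> Hom C Y Y" using f g' by (rule Comp_in_Hom[rotated])
  have idem: "(f \<star> ?g) \<star> (f \<star> ?g) = f \<star> ?g"
    using Comp_assoc[OF fg' g' f] Comp_assoc[OF g' f g'] g'f g' by (simp add: Ident_left)
  have "iso_mor C Y Y (f \<star> ?g)"
  proof (rule ccontr)
    assume "\<not> ?thesis"
    then have 1: "iso_mor C Y Y (Ident C Y - f \<star> ?g)" by (rule local_obj_complement[OF Y fg'])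
    have "(Ident C Y - f \<star> ?g) \<star> (Ident C Y - f \<star> ?g) = Ident C Y - f \<star> ?g"
      using fg' idem
      by (simp add: Comp_diff_left[OF diff_in_Hom[OF Ident_in_Hom fg'] Ident_in_Hom fg']
          Ident_left[OF diff_in_Hom[OF Ident_in_Hom fg']] Comp_diff_right[OF Ident_in_Hom fg' fg']
          Ident_right)
    then have "Ident C Y - f \<star> ?g = Ident C Y" by (rule iso_mor_idempotent[OF 1])
    then have 0: "f \<star> ?g = 0" by simp
    have "f = f \<star> (?g \<star> f)" using g'f f by (simp add: Ident_right)
    also have "\<dots> = 0" using Comp_assoc[OF f g' f] 0 Comp_zero_left[OF f] by simp
    finally have "Ident C X = 0" using g'f Comp_zero_right[OF g'] by simp
    then show False using X by simp
  qed
  moreover have "iso_mor C X X (?g \<star> f)" using g'f iso_mor_Ident by simp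
  ultimately show ?thesis by (rule iso_mor_if_both_composites[OF f g', rotated])
qed

lemma cat_idealI:
  assumes "\<And>X Y. R X Y \<subseteq> Hom C X Y" "\<And>X Y. 0 \<in> R X Y"
    and "\<And>X Y f g. \<lbrakk>f \<in> R X Y; g \<in> R X Y\<rbrakk> \<Longrightarrow> f + g \<in> R X Y"
    and "\<And>X Y Z f g. \<lbrakk>f \<in> R X Y; g \<in> Hom C Y Z\<rbrakk> \<Longrightarrow> g \<star> f \<in> R X Z"
    and "\<And>W X Y f g. \<lbrakk>f \<in> R X Y; g \<in> Hom C W X\<rbrakk> \<Longrightarrow> f \<star> g \<in> R W Y"
  shows "cat_ideal C R"
  using assms unfolding cat_ideal_def by blast

lemma
  assumes "cat_ideal C R"
  shows cat_ideal_Hom: "f \<in> R X Y \<Longrightarrow> f \<in> Hom C X Y"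
    and cat_ideal_zero: "0 \<in> R X Y"
    and cat_ideal_add: "\<lbrakk>f \<in> R X Y; g \<in> R X Y\<rbrakk> \<Longrightarrow> f + g \<in> R X Y"
    and cat_ideal_post: "\<lbrakk>f \<in> R X Y; g \<in> Hom C Y Z\<rbrakk> \<Longrightarrow> g \<star> f \<in> R X Z"
    and cat_ideal_pre: "\<lbrakk>f \<in> R X Y; g \<in> Hom C W X\<rbrakk> \<Longrightarrow> f \<star> g \<in> R W Y"
  using assms unfolding cat_ideal_def by blast+

lemma cat_ideal_sum:
  assumes "cat_ideal C R" "\<And>i. i \<in> I \<Longrightarrow> f i \<in> R X Y"
  shows "(\<Sum>i\<in>I. f i) \<in> R X Y"
  using assms(2)
  by (induction I rule: infinite_finite_induct)
    (auto intro: cat_ideal_add[OF assms(1)] cat_ideal_zero[OF assms(1)])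

text \<open>
  If \<open>v\<close> inverts \<open>1 - g f\<close>, then \<open>1 - g (f + f') = (1 - g f) (1 - v g f')\<close>, which gives closure under sums.
  Composition on the right is reduced to composition on the left by exchanging the factors in \<open>1 - a b\<close>.
\<close>
lemma cat_ideal_radical: "cat_ideal C (cat_radical C)"
proof (rule cat_idealI)
  fix X Y
  show "cat_radical C X Y \<subseteq> Hom C X Y" by (auto simp: cat_radical_def)
  show "0 \<in> cat_radical C X Y"
    by (auto simp: cat_radical_def zero_in_Hom Comp_zero_right iso_mor_Ident)
next
  fix X Y f f' assume f: "f \<in> cat_radical C X Y" and f': "f' \<in> cat_radical C X Y"
  show "f + f' \<in> cat_radical C X Y"
    unfolding cat_radical_def
  proof (intro CollectI conjI ballI)
    have h: "f \<in> Hom C X Y" "f' \<in> Hom C X Y" using f f' by (auto simp: cat_radical_def)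
    then show "f + f' \<in> Hom C X Y" by (rule add_in_Hom)
    fix g assume g: "g \<in> Hom C Y X"
    let ?u = "Ident C X - g \<star> f"
    have u: "iso_mor C X X ?u" using f g by (auto simp: cat_radical_def)
    then obtain v where v: "v \<in> Hom C X X" "?u \<star> v = Ident C X" by (rule iso_morE)
    note gf' = Comp_in_Hom[OF h(2) g]
    have "iso_mor C X X (Ident C X - (v \<star> g) \<star> f')"
      using f' v g by (auto simp: cat_radical_def Comp_in_Hom)
    then have "iso_mor C X X (?u \<star> (Ident C X - (v \<star> g) \<star> f'))" using u by (rule iso_mor_Comp)
    also have "?u \<star> (Ident C X - (v \<star> g) \<star> f') = Ident C X - g \<star> (f + f')"
      using v(2) h Comp_assoc[OF gf' v(1) iso_mor_in_Hom[OF u]]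
      by (simp add: Comp_assoc[OF h(2) g v(1)]
          Comp_diff_right[OF Ident_in_Hom Comp_in_Hom[OF gf' v(1)] iso_mor_in_Hom[OF u]]
          Ident_right[OF iso_mor_in_Hom[OF u]] Ident_left[OF gf'] Comp_add_right[OF h g])
    finally show "iso_mor C X X (Ident C X - g \<star> (f + f'))" .
  qed
next
  fix X Y Z f h assume f: "f \<in> cat_radical C X Y" and h: "h \<in> Hom C Y Z"
  show "h \<star> f \<in> cat_radical C X Z"
    unfolding cat_radical_def
  proof (intro CollectI conjI ballI)
    have f0: "f \<in> Hom C X Y" using f by (auto simp: cat_radical_def)
    then show "h \<star> f \<in> Hom C X Z" using h by (rule Comp_in_Hom)
    fix g assume g: "g \<in> Hom C Z X"
    show "iso_mor C X X (Ident C X - g \<star> (h \<star> f))"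
      using f Comp_in_Hom[OF h g] Comp_assoc[OF f0 h g] by (auto simp: cat_radical_def)
  qed
next
  fix W X Y f h assume f: "f \<in> cat_radical C X Y" and h: "h \<in> Hom C W X"
  show "f \<star> h \<in> cat_radical C W Y"
    unfolding cat_radical_def
  proof (intro CollectI conjI ballI)
    have f0: "f \<in> Hom C X Y" using f by (auto simp: cat_radical_def)
    then show "f \<star> h \<in> Hom C W Y" using Comp_in_Hom[OF h] by blast
    fix g assume g: "g \<in> Hom C Y W"
    have "iso_mor C X X (Ident C X - h \<star> (g \<star> f))"
      using f Comp_in_Hom[OF g h] Comp_assoc[OF f0 g h] by (auto simp: cat_radical_def)
    from iso_mor_Ident_minus_swap[OF Comp_in_Hom[OF f0 g] h this]
    show "iso_mor C W W (Ident C W - g \<star> (f \<star> h))"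
      using Comp_assoc[OF h f0 g] by simp
  qed
qed

lemma radical_not_iso:
  assumes X: "Ident C X \<noteq> 0" and r: "r \<in> cat_radical C X X"
  shows "\<not> iso_mor C X X r"
proof
  assume "iso_mor C X X r"
  then obtain u where "u \<in> Hom C X X" "u \<star> r = Ident C X" by (rule iso_morE)
  then have "iso_mor C X X 0" using r by (auto simp: cat_radical_def)
  then obtain z where "z \<in> Hom C X X" "z \<star> 0 = Ident C X" by (rule iso_morE)
  then show False using X Comp_zero_right by fastforce
qed

lemma local_split_mono:
  assumes X: "local_obj C X" and f: "f \<in> Hom C X Y" "f \<notin> cat_radical C X Y"
  shows "\<exists>g\<in>Hom C Y X. g \<star> f = Ident C X"
proof -
  obtain g where g: "g \<in> Hom C Y X" "\<not> iso_mor C X X (Ident C X - g \<star> f)"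
    using f by (auto simp: cat_radical_def)
  then have "iso_mor C X X (g \<star> f)"
    using local_obj_complement[OF X] Comp_in_Hom[OF f(1) g(1)] by blast
  then obtain u where u: "u \<in> Hom C X X" "u \<star> (g \<star> f) = Ident C X" by (rule iso_morE)
  then show ?thesis
    using Comp_assoc[OF f(1) g(1) u(1)] Comp_in_Hom[OF g(1) u(1)] by auto
qed

lemma local_iso_if_not_radical:
  assumes X: "local_obj C X" and Y: "local_obj C Y" and f: "f \<in> Hom C X Y" "f \<notin> cat_radical C X Y"
  shows "iso_mor C X Y f"
proof -
  obtain g where g: "g \<in> Hom C Y X" "g \<star> f = Ident C X" using local_split_mono[OF X f] by blast
  show ?thesis
    using local_obj_iso_mor[OF Y _ f(1) g(1)] X g(2) iso_mor_Ident by (simp add: local_obj_iff)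
qed

text \<open>
  For a local \<open>X\<close> this is an ideal of the category, and it contains the identity of \<open>A\<close> precisely when
  \<open>X\<close> does not split off from \<open>A\<close>. Whether \<open>X\<close> splits off can therefore be tested on additive closures.
\<close>
definition avoiding_ideal :: "'o \<Rightarrow> 'o \<Rightarrow> 'o \<Rightarrow> 'm set" where
  "avoiding_ideal X A B =
     {f \<in> Hom C A B. \<forall>a\<in>Hom C X A. \<forall>b\<in>Hom C B X. \<not> iso_mor C X X (b \<star> (f \<star> a))}"

lemma cat_ideal_avoiding:
  assumes X: "local_obj C X"
  shows "cat_ideal C (avoiding_ideal X)"
proof (rule cat_idealI)
  fix A B
  show "avoiding_ideal X A B \<subseteq> Hom C A B" by (auto simp: avoiding_ideal_def)
  show "0 \<in> avoiding_ideal X A B"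
    using local_not_iso_zero[OF X]
    by (auto simp: avoiding_ideal_def zero_in_Hom Comp_zero_left Comp_zero_right)
next
  fix A B f f' assume f: "f \<in> avoiding_ideal X A B" "f' \<in> avoiding_ideal X A B"
  then have h: "f \<in> Hom C A B" "f' \<in> Hom C A B" by (auto simp: avoiding_ideal_def)
  show "f + f' \<in> avoiding_ideal X A B"
    unfolding avoiding_ideal_def
  proof (intro CollectI conjI ballI notI)
    show "f + f' \<in> Hom C A B" using h by (rule add_in_Hom)
    fix a b assume a: "a \<in> Hom C X A" and b: "b \<in> Hom C B X"
      and iso: "iso_mor C X X (b \<star> ((f + f') \<star> a))"
    note fa = Comp_in_Hom[OF a h(1)] Comp_in_Hom[OF a h(2)]
    have "b \<star> ((f + f') \<star> a) = b \<star> (f \<star> a) + b \<star> (f' \<star> a)"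
      by (simp add: Comp_add_left[OF a h] Comp_add_right[OF fa b])
    then show False
      using local_objD[OF X Comp_in_Hom[OF fa(1) b] Comp_in_Hom[OF fa(2) b]] iso f a b
      by (auto simp: avoiding_ideal_def)
  qed
next
  fix A B D f g assume f: "f \<in> avoiding_ideal X A B" and g: "g \<in> Hom C B D"
  then have h: "f \<in> Hom C A B" by (auto simp: avoiding_ideal_def)
  have "b \<star> ((g \<star> f) \<star> a) = (b \<star> g) \<star> (f \<star> a)" if "a \<in> Hom C X A" "b \<in> Hom C D X" for a b
    using Comp_assoc[OF that(1) h g] Comp_assoc[OF Comp_in_Hom[OF that(1) h] g that(2)] by simp
  then show "g \<star> f \<in> avoiding_ideal X A D"
    using f g h by (auto simp: avoiding_ideal_def Comp_in_Hom[OF _ g] Comp_in_Hom[OF g])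
next
  fix A B D f g assume f: "f \<in> avoiding_ideal X B D" and g: "g \<in> Hom C A B"
  then have h: "f \<in> Hom C B D" by (auto simp: avoiding_ideal_def)
  have "b \<star> ((f \<star> g) \<star> a) = b \<star> (f \<star> (g \<star> a))" if "a \<in> Hom C X A" for a b
    using Comp_assoc[OF that(1) g h] by simp
  then show "f \<star> g \<in> avoiding_ideal X A D"
    using f g h by (auto simp: avoiding_ideal_def Comp_in_Hom[OF _ g] Comp_in_Hom[OF g])
qed

text \<open>
  The identity of an object of \<open>add M\<close> is a sum of maps that factor through \<open>M\<close>. This transfers
  properties from \<open>M\<close> to \<open>add M\<close> without decomposing any object.
\<close>
lemma add_subcat_ideal:
  assumes Z: "Z \<in> add_subcat C M" and R: "cat_ideal C R" and M: "Ident C M \<in> R M M"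
  shows "Ident C Z \<in> R Z Z"
  using Z
proof induction
  case self show ?case by (rule M)
next
  case (zero Z) then show ?case using cat_ideal_zero[OF R] by (simp add: zero_obj_iff)
next
  case (sum X Y W)
  from sum(3) obtain i j p q where *: "i \<in> Hom C X W" "j \<in> Hom C Y W" "p \<in> Hom C W X" "q \<in> Hom C W Y"
    "i \<star> p + j \<star> q = Ident C W" unfolding direct_sum_def by blast
  have "i \<star> p \<in> R W W" "j \<star> q \<in> R W W"
    using cat_ideal_pre[OF R cat_ideal_post[OF R sum(4) *(1)] *(3)]
      cat_ideal_pre[OF R cat_ideal_post[OF R sum(5) *(2)] *(4)] * by (simp_all add: Ident_right)
  then show ?case using cat_ideal_add[OF R] *(5) by fastforce
next
  case (summand W X Y)
  from summand(2) obtain i p where *: "i \<in> Hom C X W" "p \<in> Hom C W X" "p \<star> i = Ident C X"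
    unfolding direct_sum_def by blast
  show ?case
    using cat_ideal_pre[OF R cat_ideal_post[OF R summand(3) *(2)] *(1)] * by (simp add: Ident_right)
next
  case (iso X Y)
  from iso(2) obtain f g where *: "f \<in> Hom C X Y" "g \<in> Hom C Y X" "f \<star> g = Ident C Y"
    unfolding iso_obj_def iso_mor_def by blast
  show ?case
    using cat_ideal_pre[OF R cat_ideal_post[OF R iso(3) *(1)] *(2)] * by (simp add: Ident_right)
qed

end

section \<open>Finite biproducts\<close>

text \<open>
  Direct sums indexed by a set, so that one summand can be dropped or exchanged without renumbering
  the others.
\<close>
definition biproduct ::
  "('k, 'o, 'm::ab_group_add) shift_category \<Rightarrow> 'i set \<Rightarrow> ('i \<Rightarrow> 'o) \<Rightarrow> ('i \<Rightarrow> 'm) \<Rightarrow> ('i \<Rightarrow> 'm) \<Rightarrow> 'o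
    \<Rightarrow> bool" where
  "biproduct C I N \<iota> \<pi> W \<longleftrightarrow> finite I \<and>
     (\<forall>i\<in>I. \<iota> i \<in> Hom C (N i) W) \<and> (\<forall>i\<in>I. \<pi> i \<in> Hom C W (N i)) \<and>
     (\<forall>i\<in>I. \<forall>j\<in>I. Comp C (\<pi> i) (\<iota> j) = (if i = j then Ident C (N i) else 0)) \<and>
     (\<Sum>i\<in>I. Comp C (\<iota> i) (\<pi> i)) = Ident C W"

context linear_category
begin

lemma
  assumes "biproduct C I N \<iota> \<pi> W"
  shows biproduct_finite: "finite I"
    and biproduct_inj: "i \<in> I \<Longrightarrow> \<iota> i \<in> Hom C (N i) W"
    and biproduct_proj: "i \<in> I \<Longrightarrow> \<pi> i \<in> Hom C W (N i)"
    and biproduct_proj_inj: "\<lbrakk>i \<in> I; j \<in> I\<rbrakk> \<Longrightarrow> \<pi> i \<star> \<iota> j = (if i = j then Ident C (N i) else 0)"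
    and biproduct_sum: "(\<Sum>i\<in>I. \<iota> i \<star> \<pi> i) = Ident C W"
  using assms unfolding biproduct_def by blast+

lemma biproduct_cong:
  assumes "biproduct C I N \<iota> \<pi> W" "\<And>i. i \<in> I \<Longrightarrow> N i = N' i"
  shows "biproduct C I N' \<iota> \<pi> W"
  using assms unfolding biproduct_def by auto

text \<open>
  Multiplication of matrices, with the row supported on \<open>J\<close> and the column on \<open>K\<close>.
\<close>
lemma biproduct_comp:
  assumes bp: "biproduct C I N \<iota> \<pi> W" and J: "J \<subseteq> I" and K: "K \<subseteq> I"
    and b: "\<And>k. k \<in> J \<Longrightarrow> b k \<in> Hom C (N k) B"
    and a: "\<And>k. k \<in> K \<Longrightarrow> a k \<in> Hom C A (N k)"
  shows "(\<Sum>k\<in>J. b k \<star> \<pi> k) \<star> (\<Sum>l\<in>K. \<iota> l \<star> a l) = (\<Sum>k\<in>J \<inter> K. b k \<star> a k)"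
proof -
  note fin = finite_subset[OF J biproduct_finite[OF bp]] finite_subset[OF K biproduct_finite[OF bp]]
  have i: "\<iota> l \<in> Hom C (N l) W" and p: "\<pi> l \<in> Hom C W (N l)" if "l \<in> I" for l
    using that biproduct_inj[OF bp] biproduct_proj[OF bp] by auto
  have ia: "\<iota> l \<star> a l \<in> Hom C A W" if "l \<in> K" for l
    using that K a i by (blast intro: Comp_in_Hom)
  have bpi: "b k \<star> \<pi> k \<in> Hom C W B" if "k \<in> J" for k
    using that J b p by (blast intro: Comp_in_Hom)
  have entry: "(b k \<star> \<pi> k) \<star> (\<iota> l \<star> a l) = (if k = l then b k \<star> a k else 0)"
    if k: "k \<in> J" and l: "l \<in> K" for k l
  proof -
    have kI: "k \<in> I" and lI: "l \<in> I" using k l J K by auto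
    have "(b k \<star> \<pi> k) \<star> (\<iota> l \<star> a l) = b k \<star> ((\<pi> k \<star> \<iota> l) \<star> a l)"
      using Comp_assoc[OF ia[OF l] p[OF kI] b[OF k]] Comp_assoc[OF a[OF l] i[OF lI] p[OF kI]] by simp
    also have "\<dots> = (if k = l then b k \<star> a k else 0)"
      using biproduct_proj_inj[OF bp kI lI] Ident_left[OF a[OF l]] Comp_zero_left[OF a[OF l]]
        Comp_zero_right[OF b[OF k]] by auto
    finally show ?thesis .
  qed
  have "(\<Sum>k\<in>J. b k \<star> \<pi> k) \<star> (\<Sum>l\<in>K. \<iota> l \<star> a l) = (\<Sum>k\<in>J. (b k \<star> \<pi> k) \<star> (\<Sum>l\<in>K. \<iota> l \<star> a l))"
    by (rule Comp_sum_left[OF sum_in_Hom[OF ia] bpi])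
  also have "\<dots> = (\<Sum>k\<in>J. \<Sum>l\<in>K. (b k \<star> \<pi> k) \<star> (\<iota> l \<star> a l))"
    by (intro sum.cong refl Comp_sum_right[OF bpi ia])
  also have "\<dots> = (\<Sum>k\<in>J. \<Sum>l\<in>K. if k = l then b k \<star> a k else 0)"
    by (intro sum.cong refl entry)
  also have "\<dots> = (\<Sum>k\<in>J. if k \<in> K then b k \<star> a k else 0)"
    using fin by (simp add: sum.delta)
  also have "\<dots> = (\<Sum>k\<in>J \<inter> K. b k \<star> a k)" using fin by (simp add: sum.inter_restrict)
  finally show ?thesis .
qed

lemma biproduct_proj_sum:
  assumes bp: "biproduct C I N \<iota> \<pi> W" and K: "K \<subseteq> I" and i: "i \<in> I"
    and a: "\<And>k. k \<in> K \<Longrightarrow> a k \<in> Hom C A (N k)"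
  shows "\<pi> i \<star> (\<Sum>l\<in>K. \<iota> l \<star> a l) = (if i \<in> K then a i else 0)"
proof -
  have "(\<Sum>k\<in>{i}. Ident C (N k) \<star> \<pi> k) \<star> (\<Sum>l\<in>K. \<iota> l \<star> a l) = (\<Sum>k\<in>{i} \<inter> K. Ident C (N k) \<star> a k)"
    using i by (intro biproduct_comp[OF bp _ K _ a, where B = "N i"]) (auto intro: Ident_in_Hom)
  then show ?thesis
    using Ident_left[OF biproduct_proj[OF bp i]] Ident_left[OF a[of i]] by auto
qed

lemma biproduct_sum_inj:
  assumes bp: "biproduct C I N \<iota> \<pi> W" and J: "J \<subseteq> I" and i: "i \<in> I"
    and b: "\<And>k. k \<in> J \<Longrightarrow> b k \<in> Hom C (N k) B"
  shows "(\<Sum>k\<in>J. b k \<star> \<pi> k) \<star> \<iota> i = (if i \<in> J then b i else 0)"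
proof -
  have "(\<Sum>k\<in>J. b k \<star> \<pi> k) \<star> (\<Sum>l\<in>{i}. \<iota> l \<star> Ident C (N l)) = (\<Sum>k\<in>J \<inter> {i}. b k \<star> Ident C (N k))"
    using i by (intro biproduct_comp[OF bp J _ b, where A = "N i"]) (auto intro: Ident_in_Hom)
  then show ?thesis
    using Ident_right[OF biproduct_inj[OF bp i]] Ident_right[OF b[of i]] by auto
qed

lemma biproduct_expand_source:
  assumes bp: "biproduct C I N \<iota> \<pi> W" and g: "g \<in> Hom C W Z"
  shows "g = (\<Sum>i\<in>I. (g \<star> \<iota> i) \<star> \<pi> i)"
proof -
  have "g = g \<star> (\<Sum>i\<in>I. \<iota> i \<star> \<pi> i)" using biproduct_sum[OF bp] g by (simp add: Ident_right)
  also have "\<dots> = (\<Sum>i\<in>I. g \<star> (\<iota> i \<star> \<pi> i))"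
    using biproduct_inj[OF bp] biproduct_proj[OF bp]
    by (intro Comp_sum_right[OF g]) (blast intro: Comp_in_Hom)
  also have "\<dots> = (\<Sum>i\<in>I. (g \<star> \<iota> i) \<star> \<pi> i)"
    using biproduct_inj[OF bp] biproduct_proj[OF bp] g by (intro sum.cong refl Comp_assoc[symmetric])
  finally show ?thesis .
qed

lemma biproduct_expand_target:
  assumes bp: "biproduct C I N \<iota> \<pi> W" and g: "g \<in> Hom C Z W"
  shows "g = (\<Sum>i\<in>I. \<iota> i \<star> (\<pi> i \<star> g))"
proof -
  have "g = (\<Sum>i\<in>I. \<iota> i \<star> \<pi> i) \<star> g" using biproduct_sum[OF bp] g by (simp add: Ident_left)
  also have "\<dots> = (\<Sum>i\<in>I. (\<iota> i \<star> \<pi> i) \<star> g)"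
    using biproduct_inj[OF bp] biproduct_proj[OF bp]
    by (intro Comp_sum_left[OF g]) (blast intro: Comp_in_Hom)
  also have "\<dots> = (\<Sum>i\<in>I. \<iota> i \<star> (\<pi> i \<star> g))"
    using biproduct_inj[OF bp] biproduct_proj[OF bp] g by (intro sum.cong refl Comp_assoc)
  finally show ?thesis .
qed

lemma biproduct_in_ideal:
  assumes bp: "biproduct C I N \<iota> \<pi> W" and bp': "biproduct C J L \<iota>' \<pi>' Z" and R: "cat_ideal C R"
    and f: "f \<in> Hom C W Z"
    and entries: "\<And>i j. \<lbrakk>i \<in> I; j \<in> J\<rbrakk> \<Longrightarrow> \<pi>' j \<star> (f \<star> \<iota> i) \<in> R (N i) (L j)"
  shows "f \<in> R W Z"
proof -
  have "f \<star> \<iota> i \<in> R (N i) Z" if i: "i \<in> I" for i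
  proof -
    have "f \<star> \<iota> i = (\<Sum>j\<in>J. \<iota>' j \<star> (\<pi>' j \<star> (f \<star> \<iota> i)))"
      by (rule biproduct_expand_target[OF bp' Comp_in_Hom[OF biproduct_inj[OF bp i] f]])
    also have "\<dots> \<in> R (N i) Z"
      using entries[OF i] biproduct_inj[OF bp']
      by (intro cat_ideal_sum[OF R]) (blast intro: cat_ideal_post[OF R])
    finally show ?thesis .
  qed
  then have "(\<Sum>i\<in>I. (f \<star> \<iota> i) \<star> \<pi> i) \<in> R W Z"
    using biproduct_proj[OF bp] by (intro cat_ideal_sum[OF R]) (blast intro: cat_ideal_pre[OF R])
  then show ?thesis using biproduct_expand_source[OF bp f] by simp
qed

lemma biproduct_iso_summand:
  assumes bp: "biproduct C I N \<iota> \<pi> W" and j: "j \<in> I" and iso: "iso_obj C X (N j)"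
  shows "\<exists>a\<in>Hom C X W. \<exists>b\<in>Hom C W X. b \<star> a = Ident C X"
proof -
  obtain t s where t: "t \<in> Hom C X (N j)" "s \<in> Hom C (N j) X" "s \<star> t = Ident C X"
    using iso unfolding iso_obj_def iso_mor_def by blast
  note i = biproduct_inj[OF bp j] and p = biproduct_proj[OF bp j]
  have "(s \<star> \<pi> j) \<star> (\<iota> j \<star> t) = s \<star> ((\<pi> j \<star> \<iota> j) \<star> t)"
    using Comp_assoc[OF Comp_in_Hom[OF t(1) i] p t(2)] Comp_assoc[OF t(1) i p] by simp
  also have "\<dots> = Ident C X" using biproduct_proj_inj[OF bp j j] t Ident_left[OF t(1)] by simp
  finally show ?thesis using Comp_in_Hom[OF t(1) i] Comp_in_Hom[OF p t(2)] by blast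
qed

lemma direct_sum_commute: "direct_sum C X Y W \<Longrightarrow> direct_sum C Y X W"
  unfolding direct_sum_def by (metis add.commute)

lemma biproduct_iso_obj:
  assumes bp: "biproduct C I N \<iota> \<pi> W" and bp': "biproduct C I N \<iota>' \<pi>' W'"
  shows "iso_obj C W W'"
proof -
  have comp: "(\<Sum>k\<in>I. \<iota>' k \<star> \<pi> k) \<star> (\<Sum>k\<in>I. \<iota> k \<star> \<pi>' k) = Ident C W'"
    if bp: "biproduct C I N \<iota> \<pi> W" and bp': "biproduct C I N \<iota>' \<pi>' W'" for \<iota> \<pi> W \<iota>' \<pi>' W'
    using biproduct_comp[OF bp subset_refl subset_refl biproduct_inj[OF bp'] biproduct_proj[OF bp']]
      biproduct_sum[OF bp'] by simp
  have in_Hom: "(\<Sum>k\<in>I. \<iota>' k \<star> \<pi> k) \<in> Hom C W W'"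
    if bp: "biproduct C I N \<iota> \<pi> W" and bp': "biproduct C I N \<iota>' \<pi>' W'" for \<iota> \<pi> W \<iota>' \<pi>' W'
    using biproduct_inj[OF bp'] biproduct_proj[OF bp]
    by (intro sum_in_Hom) (blast intro: Comp_in_Hom)
  show ?thesis
    unfolding iso_obj_def
    using iso_morI[OF in_Hom[OF bp bp'] in_Hom[OF bp' bp] comp[OF bp' bp] comp[OF bp bp']] by blast
qed

lemma biproduct_reindex:
  assumes \<sigma>: "bij_betw \<sigma> I' I" and bp: "biproduct C I N \<iota> \<pi> W"
  shows "biproduct C I' (\<lambda>i. N (\<sigma> i)) (\<lambda>i. \<iota> (\<sigma> i)) (\<lambda>i. \<pi> (\<sigma> i)) W"
proof -
  have mem: "\<sigma> i \<in> I" if "i \<in> I'" for i using \<sigma> that by (auto simp: bij_betw_def)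
  have inj: "\<sigma> i = \<sigma> j \<longleftrightarrow> i = j" if "i \<in> I'" "j \<in> I'" for i j
    using \<sigma> that by (auto simp: bij_betw_def inj_on_def)
  have "(\<Sum>i\<in>I'. \<iota> (\<sigma> i) \<star> \<pi> (\<sigma> i)) = Ident C W"
    using sum.reindex_bij_betw[OF \<sigma>, of "\<lambda>i. \<iota> i \<star> \<pi> i"] biproduct_sum[OF bp] by simp
  then show ?thesis
    unfolding biproduct_def
    using bij_betw_finite[OF \<sigma>] biproduct_finite[OF bp] biproduct_inj[OF bp mem] biproduct_proj[OF bp mem]
      biproduct_proj_inj[OF bp mem mem] inj by auto
qed

lemma biproduct_transport:
  assumes bp: "biproduct C I N \<iota> \<pi> W" and iso: "\<And>i. i \<in> I \<Longrightarrow> iso_obj C (N i) (N' i)"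
  shows "\<exists>\<iota>' \<pi>'. biproduct C I N' \<iota>' \<pi>' W"
proof -
  have "\<forall>i\<in>I. \<exists>t. \<exists>s. t \<in> Hom C (N i) (N' i) \<and> s \<in> Hom C (N' i) (N i) \<and>
          s \<star> t = Ident C (N i) \<and> t \<star> s = Ident C (N' i)"
    using iso unfolding iso_obj_def iso_mor_def by blast
  then obtain t s where t: "\<And>i. i \<in> I \<Longrightarrow> t i \<in> Hom C (N i) (N' i)"
    and s: "\<And>i. i \<in> I \<Longrightarrow> s i \<in> Hom C (N' i) (N i)"
    and st: "\<And>i. i \<in> I \<Longrightarrow> s i \<star> t i = Ident C (N i)"
    and ts: "\<And>i. i \<in> I \<Longrightarrow> t i \<star> s i = Ident C (N' i)" by metis
  have i: "\<iota> l \<in> Hom C (N l) W" and p: "\<pi> l \<in> Hom C W (N l)" if "l \<in> I" for l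
    using that biproduct_inj[OF bp] biproduct_proj[OF bp] by auto
  have ts': "\<iota> l \<star> s l \<in> Hom C (N' l) W" and tp: "t l \<star> \<pi> l \<in> Hom C W (N' l)" if "l \<in> I" for l
    using that i p s t by (blast intro: Comp_in_Hom)+
  have orth: "(t k \<star> \<pi> k) \<star> (\<iota> l \<star> s l) = (if k = l then Ident C (N' k) else 0)"
    if k: "k \<in> I" and l: "l \<in> I" for k l
    using biproduct_comp[OF bp, of "{k}" "{l}" t "N' k" s "N' l"] k l t s ts by auto
  have "(\<iota> k \<star> s k) \<star> (t k \<star> \<pi> k) = \<iota> k \<star> \<pi> k" if k: "k \<in> I" for k
    using Comp_assoc[OF tp[OF k] s[OF k] i[OF k]] Comp_assoc[OF p[OF k] t[OF k] s[OF k]] st[OF k]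
      Ident_left[OF p[OF k]] by simp
  then have "(\<Sum>k\<in>I. (\<iota> k \<star> s k) \<star> (t k \<star> \<pi> k)) = Ident C W"
    using biproduct_sum[OF bp] by simp
  then have "biproduct C I N' (\<lambda>k. \<iota> k \<star> s k) (\<lambda>k. t k \<star> \<pi> k) W"
    using ts' tp orth biproduct_finite[OF bp] by (auto simp: biproduct_def)
  then show ?thesis by blast
qed

lemma biproduct_insert:
  assumes bp: "biproduct C I N \<iota> \<pi> V" and x: "x \<notin> I" and ds: "direct_sum C (N x) V W"
  shows "\<exists>\<iota>' \<pi>'. biproduct C (insert x I) N \<iota>' \<pi>' W"
proof -
  from ds obtain i j p q where h: "i \<in> Hom C (N x) W" "j \<in> Hom C V W" "p \<in> Hom C W (N x)"
    "q \<in> Hom C W V" and e: "p \<star> i = Ident C (N x)" "q \<star> j = Ident C V" "q \<star> i = 0" "p \<star> j = 0"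
    and s: "i \<star> p + j \<star> q = Ident C W" unfolding direct_sum_def by blast
  define \<iota>' where "\<iota>' k = (if k = x then i else j \<star> \<iota> k)" for k
  define \<pi>' where "\<pi>' k = (if k = x then p else \<pi> k \<star> q)" for k
  have i: "\<iota> l \<in> Hom C (N l) V" and p: "\<pi> l \<in> Hom C V (N l)" if "l \<in> I" for l
    using that biproduct_inj[OF bp] biproduct_proj[OF bp] by auto
  have i': "\<iota>' l \<in> Hom C (N l) W" and p': "\<pi>' l \<in> Hom C W (N l)" if "l \<in> insert x I" for l
    using that h i p by (auto simp: \<iota>'_def \<pi>'_def intro: Comp_in_Hom)
  have orth: "\<pi>' k \<star> \<iota>' l = (if k = l then Ident C (N k) else 0)"
    if k: "k \<in> insert x I" and l: "l \<in> insert x I" for k l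
  proof -
    consider "k = x" "l = x" | "k = x" "l \<in> I" | "k \<in> I" "l = x" | "k \<in> I" "l \<in> I" using k l by blast
    then show ?thesis
    proof cases
      case 1 then show ?thesis using e by (simp add: \<iota>'_def \<pi>'_def)
    next
      case 2
      then have "\<pi>' k \<star> \<iota>' l = (p \<star> j) \<star> \<iota> l"
        using x Comp_assoc[OF i h(2,3)] by (auto simp: \<iota>'_def \<pi>'_def)
      then show ?thesis using 2 x e Comp_zero_left[OF i] by auto
    next
      case 3
      then have "\<pi>' k \<star> \<iota>' l = \<pi> k \<star> (q \<star> i)"
        using x Comp_assoc[OF h(1,4) p] by (auto simp: \<iota>'_def \<pi>'_def)
      then show ?thesis using 3 x e Comp_zero_right[OF p] by auto
    next
      case 4
      then have "\<pi>' k \<star> \<iota>' l = \<pi> k \<star> ((q \<star> j) \<star> \<iota> l)"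
        using x Comp_assoc[OF Comp_in_Hom[OF i h(2)] h(4) p] Comp_assoc[OF i h(2,4)]
        by (auto simp: \<iota>'_def \<pi>'_def)
      also have "\<dots> = \<pi> k \<star> \<iota> l" using e 4 Ident_left[OF i] by simp
      finally show ?thesis using biproduct_proj_inj[OF bp] 4 by auto
    qed
  qed
  have "(\<Sum>k\<in>I. \<iota>' k \<star> \<pi>' k) = (\<Sum>k\<in>I. (j \<star> (\<iota> k \<star> \<pi> k)) \<star> q)"
  proof (rule sum.cong[OF refl])
    fix k assume k: "k \<in> I"
    have "(j \<star> \<iota> k) \<star> (\<pi> k \<star> q) = (j \<star> (\<iota> k \<star> \<pi> k)) \<star> q"
      using Comp_assoc[OF h(4) p[OF k] Comp_in_Hom[OF i[OF k] h(2)]] Comp_assoc[OF p[OF k] i[OF k] h(2)]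
      by simp
    then show "\<iota>' k \<star> \<pi>' k = (j \<star> (\<iota> k \<star> \<pi> k)) \<star> q" using k x by (auto simp: \<iota>'_def \<pi>'_def)
  qed
  also have "\<dots> = (\<Sum>k\<in>I. j \<star> (\<iota> k \<star> \<pi> k)) \<star> q"
    using h i p by (intro Comp_sum_left[OF h(4), symmetric]) (blast intro: Comp_in_Hom)
  also have "(\<Sum>k\<in>I. j \<star> (\<iota> k \<star> \<pi> k)) = j \<star> (\<Sum>k\<in>I. \<iota> k \<star> \<pi> k)"
    using h i p by (intro Comp_sum_right[OF h(2), symmetric]) (blast intro: Comp_in_Hom)
  finally have "(\<Sum>k\<in>I. \<iota>' k \<star> \<pi>' k) = j \<star> q"
    using biproduct_sum[OF bp] h by (simp add: Ident_right)
  then have "(\<Sum>k\<in>insert x I. \<iota>' k \<star> \<pi>' k) = Ident C W"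
    using x s biproduct_finite[OF bp] by (simp add: \<iota>'_def \<pi>'_def)
  then have "biproduct C (insert x I) N \<iota>' \<pi>' W"
    using i' p' orth biproduct_finite[OF bp] by (auto simp: biproduct_def)
  then show ?thesis by blast
qed

lemma biproduct_empty: "zero_obj C W \<Longrightarrow> biproduct C {} N \<iota> \<pi> W"
  by (simp add: biproduct_def zero_obj_iff)

lemma direct_sum_list_biproduct:
  "direct_sum_list C Xs W \<Longrightarrow> \<exists>\<iota> \<pi>. biproduct C {n..<n + length Xs} (\<lambda>i. Xs ! (i - n)) \<iota> \<pi> W"
proof (induction Xs arbitrary: W n)
  case Nil
  then show ?case using biproduct_empty by fastforce
next
  case (Cons X Xs)
  then obtain V where V: "direct_sum_list C Xs V" "direct_sum C X V W" by auto
  obtain \<iota> \<pi> where "biproduct C {Suc n..<Suc n + length Xs} (\<lambda>i. Xs ! (i - Suc n)) \<iota> \<pi> V"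
    using Cons.IH[OF V(1)] by blast
  then have "biproduct C {Suc n..<Suc n + length Xs} (\<lambda>i. (X # Xs) ! (i - n)) \<iota> \<pi> V"
    by (rule biproduct_cong) (auto simp: nth_Cons' diff_diff_eq)
  then have "\<exists>\<iota>' \<pi>'. biproduct C (insert n {Suc n..<Suc n + length Xs}) (\<lambda>i. (X # Xs) ! (i - n)) \<iota>' \<pi>' W"
    by (rule biproduct_insert) (use V in auto)
  moreover have "insert n {Suc n..<Suc n + length Xs} = {n..<n + length (X # Xs)}" by auto
  ultimately show ?case by simp
qed

lemma biproduct_split:
  assumes bp: "biproduct C I N \<iota> \<pi> W" and x: "x \<in> I" and bp': "biproduct C (I - {x}) N \<iota>' \<pi>' V"
  shows "direct_sum C (N x) V W"
proof -
  let ?J = "I - {x}"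
  define j where "j = (\<Sum>k\<in>?J. \<iota> k \<star> \<pi>' k)"
  define q where "q = (\<Sum>k\<in>?J. \<iota>' k \<star> \<pi> k)"
  have i: "\<iota> l \<in> Hom C (N l) W" and p: "\<pi> l \<in> Hom C W (N l)" if "l \<in> I" for l
    using that biproduct_inj[OF bp] biproduct_proj[OF bp] by auto
  have i': "\<iota>' l \<in> Hom C (N l) V" and p': "\<pi>' l \<in> Hom C V (N l)" if "l \<in> ?J" for l
    using that biproduct_inj[OF bp'] biproduct_proj[OF bp'] by auto
  have j: "j \<in> Hom C V W" and q: "q \<in> Hom C W V"
    unfolding j_def q_def using i p i' p' by (intro sum_in_Hom; blast intro: Comp_in_Hom)+
  have qj: "q \<star> j = Ident C V"
    unfolding j_def q_def using biproduct_comp[OF bp _ _ i' p', of ?J ?J] biproduct_sum[OF bp'] by simp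
  have pj: "\<pi> x \<star> j = 0"
    unfolding j_def using biproduct_proj_sum[OF bp _ x p', of ?J] by auto
  have qi: "q \<star> \<iota> x = 0"
    unfolding q_def using biproduct_sum_inj[OF bp _ x i', of ?J] by auto
  have "j \<star> q = (\<Sum>k\<in>?J. \<iota> k \<star> \<pi> k)"
    unfolding j_def q_def
    using biproduct_comp[OF bp' subset_refl subset_refl, of \<iota> W \<pi> W] i p by simp
  then have "\<iota> x \<star> \<pi> x + j \<star> q = Ident C W"
    using biproduct_sum[OF bp] biproduct_finite[OF bp] x by (simp add: sum.remove)
  then show ?thesis
    unfolding direct_sum_def using i[OF x] p[OF x] j q qj pj qi biproduct_proj_inj[OF bp x x] by fastforce
qed

text \<open>
  Expanding \<open>b a\<close> through the summands gives a sum of endomorphisms of \<open>X\<close>, one of which is invertible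
  because \<open>X\<close> is local.
\<close>
lemma biproduct_local_summand:
  assumes bp: "biproduct C J L \<iota> \<pi> W" and L: "\<And>j. j \<in> J \<Longrightarrow> local_obj C (L j)"
    and X: "local_obj C X" and a: "a \<in> Hom C X W" and b: "b \<in> Hom C W X"
    and iso: "iso_mor C X X (b \<star> a)"
  shows "\<exists>j\<in>J. iso_mor C X (L j) (\<pi> j \<star> a)"
proof -
  have i: "\<iota> l \<in> Hom C (L l) W" and p: "\<pi> l \<in> Hom C W (L l)" if "l \<in> J" for l
    using that biproduct_inj[OF bp] biproduct_proj[OF bp] by auto
  have ba: "b \<star> a = (\<Sum>j\<in>J. (b \<star> \<iota> j) \<star> (\<pi> j \<star> a))"
  proof -
    have "b \<star> a = b \<star> (\<Sum>j\<in>J. \<iota> j \<star> (\<pi> j \<star> a))" using biproduct_expand_target[OF bp a] by simp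
    also have "\<dots> = (\<Sum>j\<in>J. b \<star> (\<iota> j \<star> (\<pi> j \<star> a)))"
      using a i p by (intro Comp_sum_right[OF b]) (blast intro: Comp_in_Hom)
    also have "\<dots> = (\<Sum>j\<in>J. (b \<star> \<iota> j) \<star> (\<pi> j \<star> a))"
      using a i p b by (intro sum.cong refl Comp_assoc[symmetric]) (auto intro: Comp_in_Hom)
    finally show ?thesis .
  qed
  have "\<exists>j\<in>J. iso_mor C X X ((b \<star> \<iota> j) \<star> (\<pi> j \<star> a))"
    by (rule local_obj_sumD[OF X biproduct_finite[OF bp]])
      (use ba iso a b i p in \<open>auto intro!: Comp_in_Hom\<close>)
  then obtain j where j: "j \<in> J" "iso_mor C X X ((b \<star> \<iota> j) \<star> (\<pi> j \<star> a))" by blast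
  have "iso_mor C X (L j) (\<pi> j \<star> a)"
    using X by (intro local_obj_iso_mor[OF L[OF j(1)] _ _ _ j(2)] Comp_in_Hom[OF a p[OF j(1)]]
        Comp_in_Hom[OF i[OF j(1)] b]) (simp add: local_obj_iff)
  then show ?thesis using j by blast
qed

end

context triangulated_category
begin

lemma biproduct_exists: "finite I \<Longrightarrow> \<exists>W \<iota> \<pi>. biproduct C I N \<iota> \<pi> W"
proof (induction I rule: finite_induct)
  case empty
  then show ?case using zero_obj_exists biproduct_empty by blast
next
  case (insert x I)
  then show ?case using direct_sum_exists[of "N x"] biproduct_insert[OF _ insert(2)] by meson
qed

lemma biproduct_direct_sum:
  assumes bp: "biproduct C I N \<iota> \<pi> W" and x: "x \<in> I"
  shows "\<exists>V \<iota>' \<pi>'. biproduct C (I - {x}) N \<iota>' \<pi>' V \<and> direct_sum C (N x) V W"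
  using biproduct_exists[of "I - {x}" N] biproduct_split[OF bp x] biproduct_finite[OF bp] by blast

lemma biproduct_summand_in_add:
  assumes "biproduct C I N \<iota> \<pi> W" "i \<in> I" "W \<in> add_subcat C M"
  shows "N i \<in> add_subcat C M"
proof -
  obtain V where "direct_sum C (N i) V W" using biproduct_direct_sum[OF assms(1,2)] by blast
  then show ?thesis by (rule add_subcat.summand[OF assms(3)])
qed

lemma biproduct_in_add:
  assumes "biproduct C I N \<iota> \<pi> W" "\<And>i. i \<in> I \<Longrightarrow> N i \<in> add_subcat C M"
  shows "W \<in> add_subcat C M"
proof -
  have "finite I" using biproduct_finite[OF assms(1)] .
  then show ?thesis
    using assms
  proof (induction I arbitrary: W \<iota> \<pi> rule: finite_induct)
    case empty
    then have "zero_obj C W" using biproduct_sum by (fastforce simp: zero_obj_iff)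
    then show ?case by (rule add_subcat.zero)
  next
    case (insert x I)
    obtain V \<iota>' \<pi>' where V: "biproduct C (insert x I - {x}) N \<iota>' \<pi>' V" "direct_sum C (N x) V W"
      using biproduct_direct_sum[OF insert.prems(1), of x] by auto
    moreover have "insert x I - {x} = I" using insert(2) by auto
    ultimately have "V \<in> add_subcat C M" using insert.IH insert.prems(2) by auto
    then show ?case using add_subcat.sum[OF insert.prems(2) _ V(2)] by simp
  qed
qed

end

context krull_schmidt_triangulated_category
begin

lemma local_decomposition:
  "\<exists>(n::nat) N \<iota> \<pi>. biproduct C {..<n} N \<iota> \<pi> X \<and> (\<forall>i<n. local_obj C (N i))"
proof -
  obtain Xs where Xs: "direct_sum_list C Xs X" "\<forall>Y\<in>set Xs. local_obj C Y" using krull_schmidt by blast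
  from direct_sum_list_biproduct[OF Xs(1), of 0]
  obtain \<iota> \<pi> where "biproduct C {..<length Xs} (\<lambda>i. Xs ! i) \<iota> \<pi> X" by (auto simp: atLeast0LessThan)
  moreover have "\<forall>i<length Xs. local_obj C (Xs ! i)" using Xs(2) by simp
  ultimately show ?thesis by blast
qed

end

section \<open>Exactness and vanishing in triangulated categories\<close>

context linear_category
begin

lemma Hom_zeroI: "(\<And>f. f \<in> Hom C X Y \<Longrightarrow> f = 0) \<Longrightarrow> Hom C X Y = {0}"
  using zero_in_Hom by blast

lemma Hom_zero_iso:
  assumes X: "iso_obj C X X'" and Y: "iso_obj C Y Y'" and zero: "Hom C X Y = {0}"
  shows "Hom C X' Y' = {0}"
proof (rule Hom_zeroI)
  obtain a a' where a: "a \<in> Hom C X X'" "a' \<in> Hom C X' X" "a \<star> a' = Ident C X'"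
    using X unfolding iso_obj_def iso_mor_def by blast
  obtain b b' where b: "b \<in> Hom C Y Y'" "b' \<in> Hom C Y' Y" "b \<star> b' = Ident C Y'"
    using Y unfolding iso_obj_def iso_mor_def by blast
  fix f assume f: "f \<in> Hom C X' Y'"
  have "b' \<star> (f \<star> a) = 0" using zero Comp_in_Hom[OF Comp_in_Hom[OF a(1) f] b(2)] by blast
  then have "b \<star> (b' \<star> (f \<star> a)) = 0" using Comp_zero_right[OF b(1)] by simp
  then have "f \<star> a = 0"
    using Comp_assoc[OF Comp_in_Hom[OF a(1) f] b(2,1)] b(3) Ident_left[OF Comp_in_Hom[OF a(1) f]] by simp
  then show "f = 0"
    using Comp_assoc[OF a(2,1) f] a(3) Ident_right[OF f] Comp_zero_left[OF a(2)] by simp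
qed

end

context triangulated_category
begin

subsection \<open>Iterated shifts\<close>

abbreviation shO :: "nat \<Rightarrow> 'o \<Rightarrow> 'o" where "shO n \<equiv> ShO C ^^ n"

abbreviation shM :: "nat \<Rightarrow> 'm \<Rightarrow> 'm" where "shM n \<equiv> ShM C ^^ n"

lemma ShM_funpow_in_Hom:
  "f \<in> Hom C X Y \<Longrightarrow> shM n f \<in> Hom C (shO n X) (shO n Y)"
  by (induction n) (auto intro: ShM_in_Hom)

lemma ShM_funpow_Ident: "shM n (Ident C X) = Ident C (shO n X)"
  by (induction n) (auto simp: ShM_Ident)

lemma ShM_funpow_Comp:
  "\<lbrakk>f \<in> Hom C X Y; g \<in> Hom C Y Z\<rbrakk> \<Longrightarrow> shM n (g \<star> f) = shM n g \<star> shM n f"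
  by (induction n) (auto simp: ShM_Comp[OF ShM_funpow_in_Hom ShM_funpow_in_Hom])

lemma ShM_funpow_add:
  "\<lbrakk>f \<in> Hom C X Y; g \<in> Hom C X Y\<rbrakk> \<Longrightarrow> shM n (f + g) = shM n f + shM n g"
  by (induction n) (auto simp: ShM_add[OF ShM_funpow_in_Hom ShM_funpow_in_Hom])

lemma ShM_funpow_zero: "shM n 0 = 0"
  using ShM_funpow_add[OF zero_in_Hom zero_in_Hom] by simp

lemma ShM_zero: "ShM C 0 = 0"
  using ShM_funpow_zero[of 1] by simp

lemma ShM_funpow_bij:
  "bij_betw (shM n) (Hom C X Y) (Hom C (shO n X) (shO n Y))"
proof (induction n)
  case (Suc n)
  then show ?case using bij_betw_trans[OF Suc ShM_bij] by (simp add: comp_def)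
qed (simp add: bij_betw_def)

lemma ShM_funpow_eq_iff:
  "\<lbrakk>f \<in> Hom C X Y; g \<in> Hom C X Y\<rbrakk> \<Longrightarrow> shM n f = shM n g \<longleftrightarrow> f = g"
  using ShM_funpow_bij[of n X Y] unfolding bij_betw_def inj_on_def by blast

lemma ShM_funpow_full:
  assumes "f \<in> Hom C (shO n X) (shO n Y)"
  obtains g where "g \<in> Hom C X Y" "f = shM n g"
  using assms ShM_funpow_bij[of n X Y] unfolding bij_betw_def by blast

lemma ShM_funpow_iso_iff:
  assumes f: "f \<in> Hom C X Y"
  shows "iso_mor C (shO n X) (shO n Y) (shM n f) \<longleftrightarrow> iso_mor C X Y f"
proof
  assume "iso_mor C X Y f"
  then obtain g where g: "g \<in> Hom C Y X" "g \<star> f = Ident C X" "f \<star> g = Ident C Y" by (rule iso_morE)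
  then show "iso_mor C (shO n X) (shO n Y) (shM n f)"
    using ShM_funpow_Comp[OF f g(1), of n] ShM_funpow_Comp[OF g(1) f, of n]
    by (intro iso_morI[of _ _ _ "shM n g"] ShM_funpow_in_Hom f) (auto simp: ShM_funpow_Ident)
next
  assume "iso_mor C (shO n X) (shO n Y) (shM n f)"
  then obtain g' where g': "g' \<in> Hom C (shO n Y) (shO n X)"
    "g' \<star> shM n f = Ident C (shO n X)" "shM n f \<star> g' = Ident C (shO n Y)"
    by (rule iso_morE)
  obtain g where g: "g \<in> Hom C Y X" "g' = shM n g" using g'(1) by (rule ShM_funpow_full)
  have "g \<star> f = Ident C X"
    using g'(2) g(2) ShM_funpow_Comp[OF f g(1), of n]
    by (subst ShM_funpow_eq_iff[OF Comp_in_Hom[OF f g(1)] Ident_in_Hom, of n, symmetric])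
      (simp add: ShM_funpow_Ident)
  moreover have "f \<star> g = Ident C Y"
    using g'(3) g(2) ShM_funpow_Comp[OF g(1) f, of n]
    by (subst ShM_funpow_eq_iff[OF Comp_in_Hom[OF g(1) f] Ident_in_Hom, of n, symmetric])
      (simp add: ShM_funpow_Ident)
  ultimately show "iso_mor C X Y f" using f g(1) by (auto intro: iso_morI)
qed

lemma ShO_funpow_iso: "iso_obj C X Y \<Longrightarrow> iso_obj C (shO n X) (shO n Y)"
  using ShM_funpow_iso_iff iso_mor_in_Hom unfolding iso_obj_def by blast

text \<open>An object has an \<open>n\<close>-fold desuspension only up to isomorphism.\<close>
lemma ShO_funpow_ess_surj: "\<exists>X. iso_obj C (shO n X) Y"
proof (induction n)
  case 0 show ?case using iso_obj_refl by auto
next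
  case (Suc n)
  then obtain X where X: "iso_obj C (shO n X) Y" by blast
  obtain X' where "iso_obj C (ShO C X') X" using ShO_ess_surj by blast
  then have "iso_obj C (shO n (ShO C X')) Y" using ShO_funpow_iso X iso_obj_trans by blast
  then show ?case by (metis funpow_swap1 funpow.simps(2) comp_apply)
qed

lemma ShO_funpow_Suc: "shO n (ShO C X) = shO (Suc n) X"
  by (simp add: funpow_swap1)

lemma Hom_shift_zero: "Hom C X Y = {0} \<Longrightarrow> Hom C (shO n X) (shO n Y) = {0}"
  using ShM_funpow_bij[of n X Y] ShM_funpow_zero[of n] unfolding bij_betw_def by auto

lemma Hom_shift_zeroD: "Hom C (shO n X) (shO n Y) = {0} \<Longrightarrow> Hom C X Y = {0}"
  by (rule Hom_zeroI) (metis ShM_funpow_eq_iff ShM_funpow_in_Hom ShM_funpow_zero singletonD zero_in_Hom)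

lemma Hom_shift_zero_diff:
  "\<lbrakk>Hom C X (shO (m - n) Y) = {0}; n \<le> m\<rbrakk> \<Longrightarrow> Hom C (shO n X) (shO m Y) = {0}"
  using Hom_shift_zero[of X "shO (m - n) Y" n] funpow_add[of n "m - n" "ShO C"] by simp

subsection \<open>Long exact sequences\<close>

lemma Dist_rot: "Dist C X Y Z f g h \<Longrightarrow> Dist C Y Z (ShO C X) g h (- ShM C f)"
  using Dist_in_Hom Dist_rotate by blast

lemma
  assumes "Dist C X Y Z f g h"
  shows Dist_Hom1: "f \<in> Hom C X Y" and Dist_Hom2: "g \<in> Hom C Y Z" and Dist_Hom3: "h \<in> Hom C Z (ShO C X)"
  using Dist_in_Hom[OF assms] by auto

lemma Dist_comp:
  assumes D: "Dist C X Y Z f g h"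
  shows "g \<star> f = 0"
proof -
  obtain Z\<^sub>0 where Z\<^sub>0: "zero_obj C Z\<^sub>0" using zero_obj_exists by blast
  have "\<exists>c\<in>Hom C Z\<^sub>0 Z. c \<star> 0 = g \<star> f \<and> ShM C (Ident C X) \<star> 0 = h \<star> c"
    by (rule Dist_morphism[OF Dist_Ident[OF Z\<^sub>0] D Ident_in_Hom Dist_Hom1[OF D]]) simp
  then show ?thesis using Comp_zero_right by fastforce
qed

lemma Dist_comp':
  assumes D: "Dist C X Y Z f g h"
  shows "ShM C f \<star> h = 0"
proof -
  have "(- ShM C f) \<star> h = 0" by (rule Dist_comp[OF Dist_rot[OF Dist_rot[OF D]]])
  then show ?thesis
    using Comp_uminus_left[OF Dist_Hom3[OF D] ShM_in_Hom[OF Dist_Hom1[OF D]]] by simp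
qed

text \<open>
  The condition \<open>t f = 0\<close> makes \<open>(0, t)\<close> a map to the triangle \<open>0 \<rightarrow> A \<rightarrow> A \<rightarrow> 0[1]\<close>.
\<close>
lemma Dist_extend:
  assumes D: "Dist C X Y Z f g h" and t: "t \<in> Hom C Y A" "t \<star> f = 0"
  shows "\<exists>s\<in>Hom C Z A. s \<star> g = t"
proof -
  obtain Z\<^sub>0 where Z\<^sub>0: "zero_obj C Z\<^sub>0" using zero_obj_exists by blast
  have "zero_obj C (ShO C Z\<^sub>0)"
    using Z\<^sub>0 ShM_Ident[of Z\<^sub>0] by (simp add: zero_obj_iff ShM_zero)
  from Dist_Ident[OF this, of A] have D': "Dist C Z\<^sub>0 A A 0 (Ident C A) 0"
    using Dist_rotate[OF zero_in_Hom Ident_in_Hom zero_in_Hom] by (simp add: ShM_zero)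
  have "\<exists>c\<in>Hom C Z A. c \<star> g = Ident C A \<star> t \<and> ShM C 0 \<star> h = 0 \<star> c"
    by (rule Dist_morphism[OF D D' zero_in_Hom t(1)])
      (use t Comp_zero_left[OF zero_in_Hom] in simp)
  then show ?thesis using Ident_left[OF t(1)] by auto
qed

text \<open>
  The condition \<open>g t = 0\<close> makes \<open>(t, 0)\<close> a map from \<open>A \<rightarrow> 0 \<rightarrow> A[1]\<close> to the rotated triangle, and its
  third component \<open>A[1] \<rightarrow> X[1]\<close> is the shift of the required lift.
\<close>
lemma Dist_lift:
  assumes D: "Dist C X Y Z f g h" and t: "t \<in> Hom C A Y" "g \<star> t = 0"
  shows "\<exists>s\<in>Hom C A X. f \<star> s = t"
proof -
  obtain Z\<^sub>0 where Z\<^sub>0: "zero_obj C Z\<^sub>0" using zero_obj_exists by blast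
  have D': "Dist C A Z\<^sub>0 (ShO C A) 0 0 (- ShM C (Ident C A))"
    by (rule Dist_rot[OF Dist_Ident[OF Z\<^sub>0]])
  have "\<exists>c\<in>Hom C (ShO C A) (ShO C X). c \<star> 0 = h \<star> 0 \<and> ShM C t \<star> (- ShM C (Ident C A)) = (- ShM C f) \<star> c"
    by (rule Dist_morphism[OF D' Dist_rot[OF D] t(1) zero_in_Hom])
      (use t Comp_zero_left[OF zero_in_Hom] in simp)
  then obtain c where c: "c \<in> Hom C (ShO C A) (ShO C X)"
    "ShM C t \<star> (- ShM C (Ident C A)) = (- ShM C f) \<star> c" by blast
  note St = ShM_in_Hom[OF t(1)] and Sf = ShM_in_Hom[OF Dist_Hom1[OF D]]
  have c': "ShM C t = ShM C f \<star> c"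
    using c(2) Comp_uminus_right[OF Ident_in_Hom St] Comp_uminus_left[OF c(1) Sf] Ident_right[OF St]
    by (simp add: ShM_Ident)
  obtain s where s: "s \<in> Hom C A X" "c = ShM C s" using ShM_funpow_full[of c 1] c(1) by auto
  have "ShM C (f \<star> s) = ShM C t" using ShM_Comp[OF s(1) Dist_Hom1[OF D]] s(2) c' by simp
  then have "f \<star> s = t"
    using ShM_funpow_eq_iff[OF Comp_in_Hom[OF s(1) Dist_Hom1[OF D]] t(1), of 1] by simp
  then show ?thesis using s by blast
qed

text \<open>
  Replacing \<open>A\<close> by an \<open>n\<close>-fold shift reduces this to the unshifted triangle and avoids the signs in the
  shifted one.
\<close>
lemma Dist_lift_shift:
  assumes D: "Dist C X Y Z f g h" and t: "t \<in> Hom C A (shO n Y)" "shM n g \<star> t = 0"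
  shows "\<exists>s\<in>Hom C A (shO n X). shM n f \<star> s = t"
proof -
  obtain A' where "iso_obj C (shO n A') A" using ShO_funpow_ess_surj by blast
  then obtain a b where a: "a \<in> Hom C (shO n A') A" and b: "b \<in> Hom C A (shO n A')"
    and ab: "a \<star> b = Ident C A" unfolding iso_obj_def iso_mor_def by blast
  note f = Dist_Hom1[OF D] and g = Dist_Hom2[OF D]
  obtain t' where t': "t' \<in> Hom C A' Y" "t \<star> a = shM n t'"
    using Comp_in_Hom[OF a t(1)] by (rule ShM_funpow_full)
  have "shM n (g \<star> t') = (shM n g \<star> t) \<star> a"
    using ShM_funpow_Comp[OF t'(1) g] t'(2) Comp_assoc[OF a t(1) ShM_funpow_in_Hom[OF g]] by simp
  also have "\<dots> = shM n 0" using t(2) Comp_zero_left[OF a] by (simp add: ShM_funpow_zero)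
  finally have "g \<star> t' = 0"
    using ShM_funpow_eq_iff[OF Comp_in_Hom[OF t'(1) g] zero_in_Hom] by blast
  then obtain s where s: "s \<in> Hom C A' X" "f \<star> s = t'" using Dist_lift[OF D t'(1)] by blast
  note Ss = ShM_funpow_in_Hom[OF s(1), of n] and Sf = ShM_funpow_in_Hom[OF f, of n]
  have "shM n f \<star> (shM n s \<star> b) = (t \<star> a) \<star> b"
    using Comp_assoc[OF b Ss Sf] ShM_funpow_Comp[OF s(1) f, of n] s(2) t'(2) by simp
  also have "\<dots> = t" using Comp_assoc[OF b a t(1)] ab Ident_right[OF t(1)] by simp
  finally show ?thesis using Comp_in_Hom[OF b Ss] by blast
qed

lemma Dist_Hom_zero_target:
  assumes D: "Dist C X Y Z f g h"
    and "Hom C A (shO n X) = {0}" "Hom C A (shO n Z) = {0}"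
  shows "Hom C A (shO n Y) = {0}"
proof (rule Hom_zeroI)
  fix t assume t: "t \<in> Hom C A (shO n Y)"
  have "shM n g \<star> t = 0"
    using Comp_in_Hom[OF t ShM_funpow_in_Hom[OF Dist_Hom2[OF D]]] assms(3) by blast
  then obtain s where "s \<in> Hom C A (shO n X)" "shM n f \<star> s = t"
    using Dist_lift_shift[OF D t] by blast
  then show "t = 0"
    using assms(2) Comp_zero_right[OF ShM_funpow_in_Hom[OF Dist_Hom1[OF D], of n]] by simp
qed

lemma Dist_Hom_zero_source:
  assumes D: "Dist C X Y Z f g h" and "Hom C X A = {0}" "Hom C Z A = {0}"
  shows "Hom C Y A = {0}"
proof (rule Hom_zeroI)
  fix t assume t: "t \<in> Hom C Y A"
  have "t \<star> f = 0" using Comp_in_Hom[OF Dist_Hom1[OF D] t] assms(2) by blast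
  then obtain s where "s \<in> Hom C Z A" "s \<star> g = t" using Dist_extend[OF D t] by blast
  then show "t = 0" using assms(3) Comp_zero_left[OF Dist_Hom2[OF D]] by simp
qed

text \<open>
  Since \<open>d - 1\<close> vanishes on \<open>g\<close>, it factors as \<open>s h\<close>; since \<open>h (d - 1) = 0\<close>, its square is zero.
\<close>
lemma Dist_unipotent:
  assumes D: "Dist C X Y Z f g h" and d: "d \<in> Hom C Z Z" "d \<star> g = g" "h \<star> d = h"
  shows "iso_mor C Z Z d"
proof -
  note g = Dist_Hom2[OF D] and h = Dist_Hom3[OF D]
  let ?e = "d - Ident C Z"
  have e: "?e \<in> Hom C Z Z" using d by (intro diff_in_Hom Ident_in_Hom)
  have "?e \<star> g = 0" using d g by (simp add: Comp_diff_left[OF g d(1) Ident_in_Hom] Ident_left)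
  then obtain s where s: "s \<in> Hom C (ShO C X) Z" "s \<star> h = ?e"
    using Dist_extend[OF Dist_rot[OF D] e] by blast
  have "h \<star> ?e = 0" using d h by (simp add: Comp_diff_right[OF d(1) Ident_in_Hom h] Ident_right)
  then have ee: "?e \<star> ?e = 0"
    using Comp_assoc[OF e h s(1)] s(2) Comp_zero_right[OF s(1)] by simp
  let ?v = "Ident C Z - ?e"
  have v: "?v \<in> Hom C Z Z" by (rule diff_in_Hom[OF Ident_in_Hom e])
  have dv: "d = Ident C Z + ?e" by simp
  have "d \<star> ?v = Ident C Z"
    using Comp_add_left[OF v Ident_in_Hom e] Comp_diff_right[OF Ident_in_Hom e e] ee dv
    by (simp add: Ident_left[OF v] Ident_right[OF e] del: diff_diff_eq2)
  moreover have "?v \<star> d = Ident C Z"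
    using Comp_add_right[OF Ident_in_Hom e v] Comp_diff_left[OF e Ident_in_Hom e] ee dv
    by (simp add: Ident_left[OF e] Ident_right[OF v] del: diff_diff_eq2)
  ultimately show ?thesis using d v by (auto intro: iso_morI)
qed

text \<open>
  The inverses of \<open>b\<close> and \<open>c\<close> extend to an endomorphism \<open>a'\<close> of \<open>Z\<close>, and \<open>a' a\<close> and \<open>a a'\<close> induce the
  identity on the rest of the triangle, so both are unipotent.
\<close>
lemma Dist_five:
  assumes D: "Dist C X Y Z f g h"
    and c: "iso_mor C X X c" and b: "iso_mor C Y Y b" and a: "a \<in> Hom C Z Z"
    and bf: "b \<star> f = f \<star> c" and ag: "a \<star> g = g \<star> b" and ha: "ShM C c \<star> h = h \<star> a"
  shows "iso_mor C Z Z a"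
proof -
  note f = Dist_Hom1[OF D] and g = Dist_Hom2[OF D] and h = Dist_Hom3[OF D]
  obtain c' where c': "c' \<in> Hom C X X" "c' \<star> c = Ident C X" "c \<star> c' = Ident C X" using c by (rule iso_morE)
  obtain b' where b': "b' \<in> Hom C Y Y" "b' \<star> b = Ident C Y" "b \<star> b' = Ident C Y" using b by (rule iso_morE)
  note c0 = iso_mor_in_Hom[OF c] and b0 = iso_mor_in_Hom[OF b]
  note Sc = ShM_in_Hom[OF c0] and Sc' = ShM_in_Hom[OF c'(1)]
  have "b' \<star> f = b' \<star> ((f \<star> c) \<star> c')"
    using Comp_assoc[OF c'(1) c0 f] c'(3) Ident_right[OF f] by simp
  also have "\<dots> = b' \<star> (b \<star> (f \<star> c'))" using Comp_assoc[OF c'(1) f b0] bf by simp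
  also have "\<dots> = f \<star> c'"
    using Comp_assoc[OF Comp_in_Hom[OF c'(1) f] b0 b'(1)] b'(2) Ident_left[OF Comp_in_Hom[OF c'(1) f]] by simp
  finally obtain a' where a': "a' \<in> Hom C Z Z" "a' \<star> g = g \<star> b'" "ShM C c' \<star> h = h \<star> a'"
    using Dist_morphism[OF D D c'(1) b'(1)] by blast
  have 1: "iso_mor C Z Z (a' \<star> a)"
  proof (rule Dist_unipotent[OF D Comp_in_Hom[OF a a'(1)]])
    have "(a' \<star> a) \<star> g = (a' \<star> g) \<star> b"
      using Comp_assoc[OF g a a'(1)] ag Comp_assoc[OF b0 g a'(1)] by simp
    then show "(a' \<star> a) \<star> g = g"
      using a'(2) Comp_assoc[OF b0 b'(1) g] b'(2) Ident_right[OF g] by simp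
    have "h \<star> (a' \<star> a) = ShM C c' \<star> (ShM C c \<star> h)"
      using Comp_assoc[OF a a'(1) h] a'(3) Comp_assoc[OF a h Sc'] ha by simp
    then show "h \<star> (a' \<star> a) = h"
      using Comp_assoc[OF h Sc Sc'] ShM_Comp[OF c0 c'(1)] c'(2) Ident_left[OF h] by (simp add: ShM_Ident)
  qed
  have 2: "iso_mor C Z Z (a \<star> a')"
  proof (rule Dist_unipotent[OF D Comp_in_Hom[OF a'(1) a]])
    have "(a \<star> a') \<star> g = (a \<star> g) \<star> b'"
      using Comp_assoc[OF g a'(1) a] a'(2) Comp_assoc[OF b'(1) g a] by simp
    then show "(a \<star> a') \<star> g = g"
      using ag Comp_assoc[OF b'(1) b0 g] b'(3) Ident_right[OF g] by simp
    have "h \<star> (a \<star> a') = ShM C c \<star> (ShM C c' \<star> h)"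
      using Comp_assoc[OF a'(1) a h] a'(3) Comp_assoc[OF a'(1) h Sc] ha by simp
    then show "h \<star> (a \<star> a') = h"
      using Comp_assoc[OF h Sc' Sc] ShM_Comp[OF c'(1) c0] c'(3) Ident_left[OF h] by (simp add: ShM_Ident)
  qed
  show ?thesis by (rule iso_mor_if_both_composites[OF a a'(1) 1 2])
qed

section \<open>Thick and additive closures\<close>

lemma thick_zero: "zero_obj C Z\<^sub>0 \<Longrightarrow> Z\<^sub>0 \<in> thick C M"
  by (rule thick.cone[OF thick.self thick.self Dist_Ident])

lemma thick_cocone:
  assumes "Dist C X Y Z f g h" "Y \<in> thick C M" "Z \<in> thick C M"
  shows "X \<in> thick C M"
  using thick.unshift[OF thick.cone[OF assms(2,3) Dist_rot[OF assms(1)]]] .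

lemma thick_extension:
  assumes "Dist C X Y Z f g h" "X \<in> thick C M" "Z \<in> thick C M"
  shows "Y \<in> thick C M"
  using thick_cocone[OF Dist_rot[OF assms(1)] assms(3) thick.shift[OF assms(2)]] .

text \<open>
  The connecting map of the cone of the inclusion \<open>i\<close> vanishes because \<open>i\<close> is a split monomorphism, and
  then the projection to \<open>Y\<close> induces an isomorphism from the cone.
\<close>
lemma direct_sum_cone:
  assumes "direct_sum C X Y W"
  shows "\<exists>Z f g h. Dist C X W Z f g h \<and> iso_obj C Y Z"
proof -
  from assms obtain i j p q where m: "i \<in> Hom C X W" "j \<in> Hom C Y W" "p \<in> Hom C W X" "q \<in> Hom C W Y"
    and e: "p \<star> i = Ident C X" "q \<star> j = Ident C Y" "q \<star> i = 0" "p \<star> j = 0"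
      "i \<star> p + j \<star> q = Ident C W" unfolding direct_sum_def by blast
  obtain Z g h where D: "Dist C X W Z i g h" using Dist_cone[OF m(1)] by blast
  note g = Dist_Hom2[OF D] and h = Dist_Hom3[OF D]
  obtain c where c: "c \<in> Hom C Z Y" "c \<star> g = q" using Dist_extend[OF D m(4) e(3)] by blast
  have "h = ShM C p \<star> (ShM C i \<star> h)"
    using Comp_assoc[OF h ShM_in_Hom[OF m(1)] ShM_in_Hom[OF m(3)]] ShM_Comp[OF m(1,3)] e(1)
      Ident_left[OF h] by (simp add: ShM_Ident)
  then have h0: "h = 0" using Dist_comp'[OF D] Comp_zero_right[OF ShM_in_Hom[OF m(3)]] by simp
  let ?u = "g \<star> j"
  have u: "?u \<in> Hom C Y Z" by (rule Comp_in_Hom[OF m(2) g])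
  have cu: "c \<star> ?u = Ident C Y" using Comp_assoc[OF m(2) g c(1)] c(2) e(2) by simp
  have uc: "?u \<star> c \<in> Hom C Z Z" by (rule Comp_in_Hom[OF c(1) u])
  have "(?u \<star> c) \<star> g = g \<star> (j \<star> q)"
    using Comp_assoc[OF g c(1) u] Comp_assoc[OF m(4,2) g] c(2) by simp
  also have "j \<star> q = Ident C W - i \<star> p" using e(5) by (simp add: algebra_simps)
  also have "g \<star> (Ident C W - i \<star> p) = g"
    using Comp_diff_right[OF Ident_in_Hom Comp_in_Hom[OF m(3,1)] g] Ident_right[OF g]
      Comp_assoc[OF m(3,1) g] Dist_comp[OF D] Comp_zero_left[OF m(3)] by simp
  finally have "(?u \<star> c - Ident C Z) \<star> g = 0"
    using Comp_diff_left[OF g uc Ident_in_Hom] Ident_left[OF g] by simp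
  then obtain s where "s \<in> Hom C (ShO C X) Z" "s \<star> h = ?u \<star> c - Ident C Z"
    using Dist_extend[OF Dist_rot[OF D] diff_in_Hom[OF uc Ident_in_Hom]] by blast
  then have "?u \<star> c = Ident C Z" using h0 Comp_zero_right by fastforce
  then have "iso_obj C Y Z" unfolding iso_obj_def using iso_morI[OF u c(1) cu] by blast
  then show ?thesis using D by blast
qed

lemma thick_direct_sum:
  assumes "X \<in> thick C M" "Y \<in> thick C M" "direct_sum C X Y W"
  shows "W \<in> thick C M"
  using direct_sum_cone[OF assms(3)] thick_extension assms(1) thick.iso[OF assms(2)] by meson

lemma add_subcat_in_thick:
  assumes "M \<in> thick C V" "Z \<in> add_subcat C M"
  shows "Z \<in> thick C V"
  using assms(2)
  by induction (auto intro: assms(1) thick_zero thick_direct_sum thick.summand thick.iso)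

lemma thick_minimal:
  assumes "M \<in> thick C V" "Z \<in> thick C M"
  shows "Z \<in> thick C V"
  using assms(2)
  by induction (auto intro: assms(1) thick.shift thick.unshift thick.cone thick.summand thick.iso)

lemma add_subcat_Hom_zero_source:
  assumes Z: "Z \<in> add_subcat C M" and 0: "Hom C M A = {0}"
  shows "Hom C Z A = {0}"
proof -
  let ?R = "\<lambda>X Y. {f \<in> Hom C X Y. \<forall>t\<in>Hom C Y A. t \<star> f = 0}"
  have "cat_ideal C ?R"
  proof (rule cat_idealI, goal_cases)
    case (3 X Y f g) then show ?case by (auto simp: add_in_Hom Comp_add_right)
  next
    case (4 X Y Z f g)
    then have "t \<star> (g \<star> f) = 0" if "t \<in> Hom C Z A" for t
      using that Comp_assoc[of f X Y g Z t A] Comp_in_Hom[of g Y Z t A] by auto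
    then show ?case using 4 by (auto intro: Comp_in_Hom)
  next
    case (5 W X Y f g)
    then have "t \<star> (f \<star> g) = 0" if "t \<in> Hom C Y A" for t
      using that Comp_assoc[of g W X f Y t A] Comp_zero_left[of g W X] by auto
    then show ?case using 5 by (auto intro: Comp_in_Hom)
  qed (auto simp: zero_in_Hom Comp_zero_right)
  from add_subcat_ideal[OF Z this] have "Ident C Z \<in> ?R Z Z"
    using 0 Ident_in_Hom[of M] Comp_zero_left[OF Ident_in_Hom[of M]] by auto
  then show ?thesis using Ident_right by (intro Hom_zeroI) force
qed

lemma add_subcat_Hom_zero_target:
  assumes Z: "Z \<in> add_subcat C M" and 0: "Hom C A (shO n M) = {0}"
  shows "Hom C A (shO n Z) = {0}"
proof -
  let ?R = "\<lambda>X Y. {f \<in> Hom C X Y. \<forall>t\<in>Hom C A (shO n X). shM n f \<star> t = 0}"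
  have "cat_ideal C ?R"
  proof (rule cat_idealI, goal_cases)
    case (3 X Y f g)
    then have "shM n (f + g) \<star> t = 0" if "t \<in> Hom C A (shO n X)" for t
      using 3 that Comp_add_left[OF that ShM_funpow_in_Hom ShM_funpow_in_Hom, of f Y g]
        ShM_funpow_add[of f X Y g n] by simp
    then show ?case using 3 by (auto simp: add_in_Hom)
  next
    case (4 X Y Z f g)
    then have "shM n (g \<star> f) \<star> t = 0" if "t \<in> Hom C A (shO n X)" for t
      using Comp_assoc[OF that ShM_funpow_in_Hom ShM_funpow_in_Hom, of f Y g Z] that
        Comp_zero_right[OF ShM_funpow_in_Hom, of g Y Z n] ShM_funpow_Comp[of f X Y g Z n]
      by simp
    then show ?case using 4 by (auto intro: Comp_in_Hom)
  next
    case (5 W X Y f g)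
    then have "shM n (f \<star> g) \<star> t = 0" if "t \<in> Hom C A (shO n W)" for t
      using Comp_assoc[OF that ShM_funpow_in_Hom ShM_funpow_in_Hom, of g X f Y]
        Comp_in_Hom[OF that ShM_funpow_in_Hom, of g X] ShM_funpow_Comp[of g W X f Y n] by simp
    then show ?case using 5 by (auto intro: Comp_in_Hom)
  qed (auto simp: zero_in_Hom Comp_zero_left ShM_funpow_zero)
  from add_subcat_ideal[OF Z this] have "Ident C Z \<in> ?R Z Z"
    using 0 Ident_in_Hom[of M] Comp_zero_right[OF ShM_funpow_in_Hom[OF Ident_in_Hom[of M]], of n] by auto
  then show ?thesis using Ident_left by (intro Hom_zeroI) (force simp: ShM_funpow_Ident)
qed

text \<open>
  It matters that \<open>n\<close> does not depend on \<open>Y\<close>: in \<open>silting_vanishing\<close> the degree is raised at the price of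
  changing \<open>Y\<close>.
\<close>
lemma thick_bounded:
  assumes "Z \<in> thick C T"
  shows "\<exists>n. \<forall>Y. silting_ge C T Y \<longrightarrow> (\<forall>j>n. Hom C Z (shO j Y) = {0})"
  using assms
proof induction
  case self
  then show ?case by (auto simp: silting_ge_def)
next
  case (shift X)
  then obtain n where n: "\<forall>Y. silting_ge C T Y \<longrightarrow> (\<forall>j>n. Hom C X (shO j Y) = {0})" by blast
  have "Hom C (ShO C X) (shO j Y) = {0}" if "silting_ge C T Y" "j > Suc n" for Y j
    using Hom_shift_zero_diff[of X j 1 Y] n that by simp
  then show ?case by blast
next
  case (unshift X)
  then obtain n where n: "\<forall>Y. silting_ge C T Y \<longrightarrow> (\<forall>j>n. Hom C (ShO C X) (shO j Y) = {0})" by blast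
  have "Hom C X (shO j Y) = {0}" if "silting_ge C T Y" "j > n" for Y j
    using Hom_shift_zeroD[of 1 X "shO j Y"] n[rule_format, OF that(1), of "Suc j"] that(2) by simp
  then show ?case by blast
next
  case (cone X Y Z f g h)
  from cone.IH(1) obtain n where n: "\<forall>Y. silting_ge C T Y \<longrightarrow> (\<forall>j>n. Hom C X (shO j Y) = {0})"
    by blast
  from cone.IH(2) obtain m where m: "\<forall>V. silting_ge C T V \<longrightarrow> (\<forall>j>m. Hom C Y (shO j V) = {0})"
    by blast
  have "Hom C Z (shO j V) = {0}" if "silting_ge C T V" "j > max (Suc n) m" for V j
  proof (rule Dist_Hom_zero_source[OF Dist_rot[OF cone(3)]])
    show "Hom C Y (shO j V) = {0}" using m that by simp
    have "n < j - 1" using that(2) by linarith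
    then have "Hom C X (shO (j - 1) V) = {0}" using n that(1) by blast
    then show "Hom C (ShO C X) (shO j V) = {0}"
      using Hom_shift_zero_diff[of X j 1 V] that(2) by simp
  qed
  then show ?case by blast
next
  case (summand W X Y)
  then obtain n where n: "\<forall>Y. silting_ge C T Y \<longrightarrow> (\<forall>j>n. Hom C W (shO j Y) = {0})" by blast
  have X: "X \<in> add_subcat C W" by (rule add_subcat.summand[OF add_subcat.self summand(2)])
  show ?case using n add_subcat_Hom_zero_source[OF X] by blast
next
  case (iso X Y)
  then obtain n where n: "\<forall>Y. silting_ge C T Y \<longrightarrow> (\<forall>j>n. Hom C X (shO j Y) = {0})" by blast
  have X: "Y \<in> add_subcat C X" by (rule add_subcat.iso[OF add_subcat.self iso(2)])
  show ?case using n add_subcat_Hom_zero_source[OF X] by blast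
qed

end

section \<open>Approximations\<close>

context linear_category
begin

lemma add_subcat_trans: "\<lbrakk>N \<in> add_subcat C M; M \<in> add_subcat C T\<rbrakk> \<Longrightarrow> N \<in> add_subcat C T"
  by (induction rule: add_subcat.induct) (auto intro: add_subcat.intros)

text \<open>
  The maps \<open>g\<close> for which every \<open>g h\<close> factors through \<open>f\<close> form an ideal.
\<close>
lemma add_subcat_factor:
  assumes f: "f \<in> Hom C X W" and M: "\<And>h. h \<in> Hom C X M \<Longrightarrow> \<exists>h'\<in>Hom C W M. h' \<star> f = h"
    and N: "N \<in> add_subcat C M" and h: "h \<in> Hom C X N"
  shows "\<exists>h'\<in>Hom C W N. h' \<star> f = h"
proof -
  let ?R = "\<lambda>A B. {g \<in> Hom C A B. \<forall>h\<in>Hom C X A. \<exists>h'\<in>Hom C W B. h' \<star> f = g \<star> h}"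
  have "cat_ideal C ?R"
  proof (rule cat_idealI, goal_cases)
    case (2 A B)
    show ?case
      by (auto simp: zero_in_Hom Comp_zero_left intro!: bexI[of _ 0] Comp_zero_left[OF f])
  next
    case (3 A B g g')
    have "\<exists>h'\<in>Hom C W B. h' \<star> f = (g + g') \<star> h" if h: "h \<in> Hom C X A" for h
    proof -
      obtain k k' where k: "k \<in> Hom C W B" "k \<star> f = g \<star> h" "k' \<in> Hom C W B" "k' \<star> f = g' \<star> h"
        using 3 h by blast
      then show ?thesis
        using 3 Comp_add_left[OF f k(1,3)] Comp_add_left[OF h, of g B g'] add_in_Hom[OF k(1,3)] by auto
    qed
    then show ?case using 3 add_in_Hom by auto
  next
    case (4 A B D g k)
    have "\<exists>h'\<in>Hom C W D. h' \<star> f = (k \<star> g) \<star> h" if h: "h \<in> Hom C X A" for h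
    proof -
      obtain h' where h': "h' \<in> Hom C W B" "h' \<star> f = g \<star> h" using 4 h by blast
      then show ?thesis
        using 4 Comp_assoc[OF f h'(1), of k D] Comp_assoc[OF h, of g B k D] Comp_in_Hom[OF h'(1), of k D]
        by auto
    qed
    then show ?case using 4 Comp_in_Hom by blast
  next
    case (5 A B D g k)
    have "\<exists>h'\<in>Hom C W D. h' \<star> f = (g \<star> k) \<star> h" if h: "h \<in> Hom C X A" for h
      using 5 Comp_in_Hom[OF h, of k B] Comp_assoc[OF h, of k B g D] by auto
    moreover have "g \<star> k \<in> Hom C A D" using 5 by (auto intro: Comp_in_Hom)
    ultimately show ?case by blast
  qed auto
  moreover have "Ident C M \<in> ?R M M"
    using M Ident_left[of _ X M] by (auto simp: Ident_in_Hom)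
  ultimately have "Ident C N \<in> ?R N N" by (rule add_subcat_ideal[OF N])
  then have "\<exists>h'\<in>Hom C W N. h' \<star> f = Ident C N \<star> h" using h by blast
  then show ?thesis by (simp add: Ident_left[OF h])
qed

text \<open>
  The ideal of maps through which \<open>X\<close> does not split off contains the identity of \<open>M\<close> only if it contains
  that of \<open>N\<close>.
\<close>
lemma add_subcat_local_split:
  assumes X: "local_obj C X" and N: "N \<in> add_subcat C M"
    and a: "a \<in> Hom C X N" and b: "b \<in> Hom C N X" and iso: "iso_mor C X X (b \<star> a)"
  shows "\<exists>a\<in>Hom C X M. \<exists>b\<in>Hom C M X. iso_mor C X X (b \<star> a)"
proof (rule ccontr)
  assume *: "\<not> ?thesis"
  have "Ident C M \<in> avoiding_ideal X M M"
    using * by (auto simp: avoiding_ideal_def Ident_in_Hom Ident_left)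
  then have "Ident C N \<in> avoiding_ideal X N N"
    by (rule add_subcat_ideal[OF N cat_ideal_avoiding[OF X]])
  then show False
    using iso a b Ident_left[OF a] by (auto simp: avoiding_ideal_def)
qed

end

context hom_finite_triangulated_category
begin

text \<open>
  A finite spanning set \<open>B\<close> of \<open>Hom(X, M)\<close> defines a map from \<open>X\<close> to the sum of \<open>B\<close> copies of \<open>M\<close>.
\<close>
lemma left_approximation_exists: "\<exists>W f. left_add_approximation C M X W f"
proof -
  obtain B where B: "finite B" "span B = Hom C X M" using Hom_finite_dim by blast
  have b: "b \<in> Hom C X M" if "b \<in> B" for b using B(2) span_base[OF that] by simp
  obtain W \<iota> \<pi> where bp: "biproduct C B (\<lambda>_. M) \<iota> \<pi> W" using biproduct_exists[OF B(1)] by blast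
  let ?f = "\<Sum>b\<in>B. \<iota> b \<star> b"
  have f: "?f \<in> Hom C X W"
    using b biproduct_inj[OF bp] by (intro sum_in_Hom) (blast intro: Comp_in_Hom)
  have "\<exists>h'\<in>Hom C W M. h' \<star> ?f = h" if h: "h \<in> Hom C X M" for h
  proof -
    obtain u where u: "h = (\<Sum>b\<in>B. Scale C (u b) b)" using h B span_finite[OF B(1)] by auto
    let ?h = "\<Sum>b\<in>B. Scale C (u b) (Ident C M) \<star> \<pi> b"
    have s: "Scale C r (Ident C M) \<in> Hom C M M" for r by (rule scale_in_Hom[OF Ident_in_Hom])
    have "?h \<star> ?f = (\<Sum>b\<in>B \<inter> B. Scale C (u b) (Ident C M) \<star> b)"
      by (rule biproduct_comp[OF bp subset_refl subset_refl s b])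
    also have "\<dots> = h" 
      unfolding u using Comp_scale_left[OF b Ident_in_Hom] Ident_left[OF b] by (simp cong: sum.cong)
    finally have "?h \<star> ?f = h" .
    moreover have "?h \<in> Hom C W M"
      using s biproduct_proj[OF bp] by (intro sum_in_Hom) (blast intro: Comp_in_Hom)
    ultimately show ?thesis by blast
  qed
  moreover have "W \<in> add_subcat C M" by (rule biproduct_in_add[OF bp add_subcat.self])
  ultimately show ?thesis
    unfolding left_add_approximation_def using f add_subcat_factor[OF f] by blast
qed

lemma right_approximation_exists:
  "\<exists>W p. W \<in> add_subcat C M \<and> p \<in> Hom C W Y \<and> (\<forall>h\<in>Hom C M Y. \<exists>h'\<in>Hom C M W. p \<star> h' = h)"
proof -
  obtain B where B: "finite B" "span B = Hom C M Y" using Hom_finite_dim by blast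
  have b: "b \<in> Hom C M Y" if "b \<in> B" for b using B(2) span_base[OF that] by simp
  obtain W \<iota> \<pi> where bp: "biproduct C B (\<lambda>_. M) \<iota> \<pi> W" using biproduct_exists[OF B(1)] by blast
  let ?p = "\<Sum>b\<in>B. b \<star> \<pi> b"
  have p: "?p \<in> Hom C W Y"
    using b biproduct_proj[OF bp] by (intro sum_in_Hom) (blast intro: Comp_in_Hom)
  have "\<exists>h'\<in>Hom C M W. ?p \<star> h' = h" if h: "h \<in> Hom C M Y" for h
  proof -
    obtain u where u: "h = (\<Sum>b\<in>B. Scale C (u b) b)" using h B span_finite[OF B(1)] by auto
    let ?h = "\<Sum>b\<in>B. \<iota> b \<star> Scale C (u b) (Ident C M)"
    have s: "Scale C r (Ident C M) \<in> Hom C M M" for r by (rule scale_in_Hom[OF Ident_in_Hom])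
    have "?p \<star> ?h = (\<Sum>b\<in>B \<inter> B. b \<star> Scale C (u b) (Ident C M))"
      by (rule biproduct_comp[OF bp subset_refl subset_refl b s])
    also have "\<dots> = h"
      unfolding u using Comp_scale_right[OF Ident_in_Hom b] Ident_right[OF b] by (simp cong: sum.cong)
    finally have "?p \<star> ?h = h" .
    moreover have "?h \<in> Hom C M W"
      using s biproduct_inj[OF bp] by (intro sum_in_Hom) (blast intro: Comp_in_Hom)
    ultimately show ?thesis by blast
  qed
  moreover have "W \<in> add_subcat C M" by (rule biproduct_in_add[OF bp add_subcat.self])
  ultimately show ?thesis using p by blast
qed

section \<open>Vanishing criteria for silting objects\<close>

lemma silting_add_Hom_zero:
  assumes "silting C T" "A \<in> add_subcat C T" "B \<in> add_subcat C T" "n > 0"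
  shows "Hom C A (shO n B) = {0}"
  using assms add_subcat_Hom_zero_source[OF assms(2)] add_subcat_Hom_zero_target[OF assms(3)]
  unfolding silting_def by blast

text \<open>
  Here \<open>p\<close> is a right approximation of \<open>Y\<close> by \<open>add T\<close>, and \<open>Y'[1]\<close> is its cone. The approximation property
  kills the maps from \<open>T\<close> to the cone, so \<open>Y'\<close> satisfies the same hypothesis as \<open>Y\<close> and the step can be
  repeated. The last clause is the long exact sequence of the triangle.
\<close>
lemma silting_approximation_step:
  assumes T: "silting C T" and Y: "silting_ge C T Y"
  shows "\<exists>T\<^sub>0 p Y'. T\<^sub>0 \<in> add_subcat C T \<and> p \<in> Hom C T\<^sub>0 Y \<and> silting_ge C T Y' \<and>
     (\<forall>Z j. Hom C Z (shO (Suc j) Y') = {0} \<longrightarrow>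
        (\<forall>s\<in>Hom C Z (shO j Y). \<exists>t\<in>Hom C Z (shO j T\<^sub>0). shM j p \<star> t = s))"
proof -
  obtain T0 p where T0: "T0 \<in> add_subcat C T" and p: "p \<in> Hom C T0 Y"
    and lift: "\<And>h. h \<in> Hom C T Y \<Longrightarrow> \<exists>h'\<in>Hom C T T0. p \<star> h' = h"
    using right_approximation_exists by blast
  obtain Y1 g h where D: "Dist C T0 Y Y1 p g h" using Dist_cone[OF p] by blast
  note g = Dist_Hom2[OF D]
  obtain Y' where Y': "iso_obj C (ShO C Y') Y1" using ShO_ess_surj by blast
  have TT0: "Hom C T (shO n T0) = {0}" if "n > 0" for n
    using silting_add_Hom_zero[OF T add_subcat.self T0 that] .
  have Y1: "Hom C T (shO n Y1) = {0}" for n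
  proof (cases n)
    case 0
    have "t = 0" if t: "t \<in> Hom C T Y1" for t
    proof -
      have "h \<star> t = 0" using Comp_in_Hom[OF t Dist_Hom3[OF D]] TT0[of 1] by auto
      then obtain s where s: "s \<in> Hom C T Y" "g \<star> s = t" using Dist_lift[OF Dist_rot[OF D] t] by blast
      obtain s' where s': "s' \<in> Hom C T T0" "p \<star> s' = s" using lift[OF s(1)] by blast
      show ?thesis
        using Comp_assoc[OF s'(1) p g] s(2) s'(2) Dist_comp[OF D] Comp_zero_left[OF s'(1)] by simp
    qed
    then show ?thesis using 0 Hom_zeroI[of T Y1] by simp
  next
    case (Suc m)
    then have "Hom C T (shO n Y) = {0}" using Y unfolding silting_ge_def by blast
    moreover have "Hom C T (shO n (ShO C T0)) = {0}"
      using TT0[of "Suc n"] by (simp only: ShO_funpow_Suc)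
    ultimately show ?thesis by (rule Dist_Hom_zero_target[OF Dist_rot[OF D]])
  qed
  have Y1': "iso_obj C (shO n Y1) (shO (Suc n) Y')" for n
    using ShO_funpow_iso[OF iso_obj_sym[OF Y'], of n] ShO_funpow_Suc[of n Y'] by simp
  have "silting_ge C T Y'"
    unfolding silting_ge_def
  proof (intro allI impI)
    fix i :: nat assume "i > 0"
    then show "Hom C T (shO i Y') = {0}"
      using Hom_zero_iso[OF iso_obj_refl Y1' Y1, of "i - 1"] by simp
  qed
  moreover have "\<exists>t\<in>Hom C Z (shO j T0). shM j p \<star> t = s"
    if Z: "Hom C Z (shO (Suc j) Y') = {0}" and s: "s \<in> Hom C Z (shO j Y)" for Z j s
  proof (rule Dist_lift_shift[OF D s])
    have "Hom C Z (shO j Y1) = {0}"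
      by (rule Hom_zero_iso[OF iso_obj_refl iso_obj_sym[OF Y1'] Z])
    then show "shM j g \<star> s = 0" using Comp_in_Hom[OF s ShM_funpow_in_Hom[OF g]] by blast
  qed
  ultimately show ?thesis using T0 p by blast
qed

text \<open>
  By \<open>silting_approximation_step\<close>, a map \<open>Z \<rightarrow> Y[j]\<close> factors through \<open>T\<^sub>0[j]\<close>, hence is zero, as soon as
  \<open>Hom(Z, Y'[j+1]) = 0\<close>. Descending induction on \<open>j\<close> starts from the uniform bound of \<open>thick_bounded\<close>.
\<close>
lemma silting_vanishing:
  assumes T: "silting C T" and Z: "\<And>i. i \<ge> n \<Longrightarrow> Hom C Z (shO i T) = {0}"
    and Y: "silting_ge C T Y" and j: "j \<ge> n"
  shows "Hom C Z (shO j Y) = {0}"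
proof -
  have "Z \<in> thick C T" using T by (simp add: silting_def)
  then obtain m where m: "\<And>Y j. silting_ge C T Y \<Longrightarrow> j > m \<Longrightarrow> Hom C Z (shO j Y) = {0}"
    using thick_bounded by blast
  have "Hom C Z (shO j Y) = {0}" if "silting_ge C T Y" "j \<ge> n" "m < j + d" for d j Y
    using that
  proof (induction d arbitrary: j Y)
    case 0 then show ?case using m by simp
  next
    case (Suc d)
    obtain T0 p Y' where T0: "T0 \<in> add_subcat C T" "p \<in> Hom C T0 Y" "silting_ge C T Y'"
      and lift: "\<And>j s. Hom C Z (shO (Suc j) Y') = {0} \<Longrightarrow> s \<in> Hom C Z (shO j Y) \<Longrightarrow>
        \<exists>t\<in>Hom C Z (shO j T0). shM j p \<star> t = s"
      using silting_approximation_step[OF T Suc.prems(1)] by meson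
    have Y': "Hom C Z (shO (Suc j) Y') = {0}" using Suc T0 by (intro Suc.IH) auto
    show ?case
    proof (rule Hom_zeroI)
      fix s assume "s \<in> Hom C Z (shO j Y)"
      then obtain t where t: "t \<in> Hom C Z (shO j T0)" "shM j p \<star> t = s"
        using lift[OF Y'] by blast
      have "t = 0" using t(1) add_subcat_Hom_zero_target[OF T0(1) Z[OF Suc.prems(2)]] by blast
      then show "s = 0" using t(2) Comp_zero_right[OF ShM_funpow_in_Hom[OF T0(2)]] by blast
    qed
  qed
  from this[of Y j "Suc m"] show ?thesis using Y j by simp
qed

lemma silting_ge_trans:
  assumes "silting C V" "silting_ge C T V" "silting_ge C V P"
  shows "silting_ge C T P"
  unfolding silting_ge_def
proof (intro allI impI)
  fix i :: nat assume "i > 0"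
  then show "Hom C T (shO i P) = {0}"
    using assms(2) by (intro silting_vanishing[OF assms(1) _ assms(3), of 1]) (auto simp: silting_ge_def)
qed

end

section \<open>Minimal approximations\<close>

context krull_schmidt_triangulated_category
begin

text \<open>
  Suppose that \<open>g f = f\<close> with \<open>g\<close> not invertible. Then \<open>e = 1 - g\<close> kills \<open>f\<close> but is not radical, so some
  entry of \<open>e\<close> is an isomorphism from \<open>N x\<close> to \<open>N y\<close>. Row \<open>y\<close> of the equation \<open>e f = 0\<close> expresses the component
  of \<open>f\<close> at \<open>x\<close> by its other components, and \<open>N x\<close> can be dropped.
\<close>
lemma local_approximation_not_minimal:
  assumes bp: "biproduct C I N \<iota> \<pi> W" and N: "\<And>i. i \<in> I \<Longrightarrow> local_obj C (N i)"
    and f: "f \<in> Hom C X W" and nm: "\<not> left_minimal C W f"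
  shows "\<exists>i\<in>I. \<exists>V \<iota>' \<pi>' f' r. biproduct C (I - {i}) N \<iota>' \<pi>' V \<and> f' \<in> Hom C X V \<and> r \<in> Hom C V W \<and> r \<star> f' = f"
proof -
  obtain g where g: "g \<in> Hom C W W" "g \<star> f = f" "\<not> iso_mor C W W g"
    using nm by (auto simp: left_minimal_def)
  let ?e = "Ident C W - g"
  have e: "?e \<in> Hom C W W" by (rule diff_in_Hom[OF Ident_in_Hom g(1)])
  have ef: "?e \<star> f = 0" using Comp_diff_left[OF f Ident_in_Hom g(1)] g(2) Ident_left[OF f] by simp
  have i: "\<iota> l \<in> Hom C (N l) W" and p: "\<pi> l \<in> Hom C W (N l)" if "l \<in> I" for l
    using that biproduct_inj[OF bp] biproduct_proj[OF bp] by auto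
  have "?e \<notin> cat_radical C W W"
  proof
    assume "?e \<in> cat_radical C W W"
    then have "iso_mor C W W (Ident C W - Ident C W \<star> ?e)"
      unfolding cat_radical_def using Ident_in_Hom by blast
    then show False using g(3) by (simp add: Ident_left[OF e])
  qed
  then obtain x y where x: "x \<in> I" and y: "y \<in> I"
    and "\<pi> y \<star> (?e \<star> \<iota> x) \<notin> cat_radical C (N x) (N y)"
    using biproduct_in_ideal[OF bp bp cat_ideal_radical e] by blast
  then have "iso_mor C (N x) (N y) (\<pi> y \<star> (?e \<star> \<iota> x))"
    by (intro local_iso_if_not_radical[OF N[OF x] N[OF y]])
      (auto intro: Comp_in_Hom[OF Comp_in_Hom[OF i[OF x] e] p[OF y]])
  then obtain v where v: "v \<in> Hom C (N y) (N x)" "v \<star> (\<pi> y \<star> (?e \<star> \<iota> x)) = Ident C (N x)"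
    by (rule iso_morE)
  \<comment> \<open>\<open>?s\<close> fixes \<open>f\<close> and kills the summand \<open>N x\<close>.\<close>
  let ?k = "\<iota> x \<star> (v \<star> (\<pi> y \<star> ?e))"
  let ?s = "Ident C W - ?k"
  have k1: "\<pi> y \<star> ?e \<in> Hom C W (N y)" by (rule Comp_in_Hom[OF e p[OF y]])
  have k2: "v \<star> (\<pi> y \<star> ?e) \<in> Hom C W (N x)" by (rule Comp_in_Hom[OF k1 v(1)])
  have k: "?k \<in> Hom C W W" by (rule Comp_in_Hom[OF k2 i[OF x]])
  have s: "?s \<in> Hom C W W" by (rule diff_in_Hom[OF Ident_in_Hom k])
  have "?k \<star> f = 0"
    using Comp_assoc[OF f k2 i[OF x]] Comp_assoc[OF f k1 v(1)] Comp_assoc[OF f e p[OF y]] ef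
      Comp_zero_right[OF p[OF y]] Comp_zero_right[OF v(1)] Comp_zero_right[OF i[OF x]] by simp
  then have sf: "?s \<star> f = f" using Comp_diff_left[OF f Ident_in_Hom k] Ident_left[OF f] by simp
  have "?k \<star> \<iota> x = \<iota> x"
    using Comp_assoc[OF i[OF x] k2 i[OF x]] Comp_assoc[OF i[OF x] k1 v(1)] Comp_assoc[OF i[OF x] e p[OF y]]
      v(2) Ident_right[OF i[OF x]] by simp
  then have si: "?s \<star> \<iota> x = 0"
    using Comp_diff_left[OF i[OF x] Ident_in_Hom k] Ident_left[OF i[OF x]] by simp
  let ?J = "I - {x}"
  obtain V \<iota>' \<pi>' where bp': "biproduct C ?J N \<iota>' \<pi>' V"
    using biproduct_exists[of ?J N] biproduct_finite[OF bp] by auto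
  let ?f = "\<Sum>l\<in>?J. \<iota>' l \<star> (\<pi> l \<star> f)" and ?r = "\<Sum>l\<in>?J. (?s \<star> \<iota> l) \<star> \<pi>' l"
  have pf: "\<pi> l \<star> f \<in> Hom C X (N l)" and si': "?s \<star> \<iota> l \<in> Hom C (N l) W" if "l \<in> I" for l
    using that f s i p by (blast intro: Comp_in_Hom)+
  have f': "?f \<in> Hom C X V"
    by (intro sum_in_Hom Comp_in_Hom[OF pf biproduct_inj[OF bp']]) auto
  have r: "?r \<in> Hom C V W"
    by (intro sum_in_Hom Comp_in_Hom[OF biproduct_proj[OF bp'] si']) auto
  have "?r \<star> ?f = (\<Sum>l\<in>?J \<inter> ?J. (?s \<star> \<iota> l) \<star> (\<pi> l \<star> f))"
    by (rule biproduct_comp[OF bp' subset_refl subset_refl]) (auto intro: pf si')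
  also have "\<dots> = (\<Sum>l\<in>I. (?s \<star> \<iota> l) \<star> (\<pi> l \<star> f))"
    using sum.remove[OF biproduct_finite[OF bp] x, of "\<lambda>l. (?s \<star> \<iota> l) \<star> (\<pi> l \<star> f)"]
      si Comp_zero_left[OF pf[OF x]] by simp
  also have "\<dots> = (\<Sum>l\<in>I. (?s \<star> \<iota> l) \<star> \<pi> l) \<star> (\<Sum>l\<in>I. \<iota> l \<star> (\<pi> l \<star> f))"
    using biproduct_comp[OF bp subset_refl subset_refl si' pf] by simp
  also have "\<dots> = ?s \<star> f"
    using biproduct_expand_source[OF bp s] biproduct_expand_target[OF bp f] by simp
  finally have "?r \<star> ?f = f" using sf by simp
  then show ?thesis using x bp' f' r by blast
qed

text \<open>
  An approximation with the least number of local summands is minimal, as otherwise a summand could be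
  dropped.
\<close>
lemma minimal_left_approximation_exists:
  "\<exists>W f. left_add_approximation C M X W f \<and> left_minimal C W f"
proof -
  define P where "P n \<longleftrightarrow> (\<exists>(I::nat set) N \<iota> \<pi> W f. card I = n \<and> biproduct C I N \<iota> \<pi> W \<and>
    (\<forall>i\<in>I. local_obj C (N i) \<and> N i \<in> add_subcat C M) \<and> left_add_approximation C M X W f)" for n
  have "\<exists>n. P n"
  proof -
    obtain W f where f: "left_add_approximation C M X W f" using left_approximation_exists by blast
    obtain n :: nat and N \<iota> \<pi> where N: "biproduct C {..<n} N \<iota> \<pi> W" "\<forall>i<n. local_obj C (N i)"
      using local_decomposition by blast
    have "W \<in> add_subcat C M" using f by (simp add: left_add_approximation_def)
    then have "\<forall>i\<in>{..<n}. local_obj C (N i) \<and> N i \<in> add_subcat C M"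
      using N biproduct_summand_in_add[OF N(1)] by blast
    then have "P (card {..<n})" unfolding P_def using N(1) f by blast
    then show ?thesis by blast
  qed
  then obtain n where n: "P n" "\<And>m. m < n \<Longrightarrow> \<not> P m" using exists_least_iff[of P] by blast
  then obtain I :: "nat set" and N \<iota> \<pi> W f where I: "card I = n" and bp: "biproduct C I N \<iota> \<pi> W"
    and N: "\<And>i. i \<in> I \<Longrightarrow> local_obj C (N i)" "\<And>i. i \<in> I \<Longrightarrow> N i \<in> add_subcat C M"
    and f: "left_add_approximation C M X W f" unfolding P_def by blast
  have "left_minimal C W f"
  proof (rule ccontr)
    assume "\<not> left_minimal C W f"
    then obtain i V \<iota>' \<pi>' f' r where i: "i \<in> I" and bp': "biproduct C (I - {i}) N \<iota>' \<pi>' V"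
      and f': "f' \<in> Hom C X V" and r: "r \<in> Hom C V W" "r \<star> f' = f"
      using local_approximation_not_minimal[OF bp N(1)] f unfolding left_add_approximation_def by meson
    have "V \<in> add_subcat C M" by (rule biproduct_in_add[OF bp']) (use N(2) in auto)
    moreover have "\<exists>h'\<in>Hom C V A. h' \<star> f' = h" if A: "A \<in> add_subcat C M" "h \<in> Hom C X A" for A h
    proof -
      obtain h' where h': "h' \<in> Hom C W A" "h' \<star> f = h"
        using f A unfolding left_add_approximation_def by blast
      then show ?thesis
        using Comp_assoc[OF f' r(1) h'(1)] r(2) Comp_in_Hom[OF r(1) h'(1)] by auto
    qed
    ultimately have "left_add_approximation C M X V f'"
      using f' unfolding left_add_approximation_def by blast
    moreover have "\<forall>j\<in>I - {i}. local_obj C (N j) \<and> N j \<in> add_subcat C M" using N by blast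
    ultimately have "P (card (I - {i}))" unfolding P_def using bp' by blast
    moreover have "card (I - {i}) < n" using I i biproduct_finite[OF bp] by (metis card_Diff1_less)
    ultimately show False using n(2) by blast
  qed
  then show ?thesis using f by blast
qed

end

section \<open>Left mutation\<close>

context triangulated_category
begin

lemma direct_sum_Hom_zero_source:
  assumes "direct_sum C X Y W" "Hom C X A = {0}" "Hom C Y A = {0}"
  shows "Hom C W A = {0}"
proof -
  obtain Z f g h where D: "Dist C X W Z f g h" and Z: "iso_obj C Y Z"
    using direct_sum_cone[OF assms(1)] by blast
  show ?thesis
    by (rule Dist_Hom_zero_source[OF D assms(2) Hom_zero_iso[OF Z iso_obj_refl assms(3)]])
qed

lemma direct_sum_Hom_zero_target:
  assumes "direct_sum C X Y W" "Hom C A (shO n X) = {0}" "Hom C A (shO n Y) = {0}"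
  shows "Hom C A (shO n W) = {0}"
proof -
  obtain Z f g h where D: "Dist C X W Z f g h" and Z: "iso_obj C Y Z"
    using direct_sum_cone[OF assms(1)] by blast
  show ?thesis
    by (rule Dist_Hom_zero_target[OF D assms(2) Hom_zero_iso[OF iso_obj_refl ShO_funpow_iso[OF Z] assms(3)]])
qed

end

context krull_schmidt_triangulated_category
begin

text \<open>
  The exchange triangle of a local summand \<open>X\<close> of \<open>T\<close>. The hypothesis \<open>nonsplit\<close> says that \<open>X\<close> is not a
  summand of \<open>M\<close>; for a basic \<open>T\<close> it holds by \<open>basic_nonsplit\<close>.
\<close>
context
  fixes T X M M' Y f g h
  assumes T: "silting C T" and TXM: "direct_sum C X M T" and X: "local_obj C X"
    and nonsplit: "\<And>a b. \<lbrakk>a \<in> Hom C X M; b \<in> Hom C M X\<rbrakk> \<Longrightarrow> \<not> iso_mor C X X (b \<star> a)"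
    and approx: "left_add_approximation C M X M' f" and min: "left_minimal C M' f"
    and D: "Dist C X M' Y f g h"
begin

lemma f_in: "f \<in> Hom C X M'" and g_in: "g \<in> Hom C M' Y" and h_in: "h \<in> Hom C Y (ShO C X)"
  using Dist_in_Hom[OF D] by auto

lemma M'_in: "M' \<in> add_subcat C M"
  using approx by (simp add: left_add_approximation_def)

lemma approxD: "\<lbrakk>N \<in> add_subcat C M; t \<in> Hom C X N\<rbrakk> \<Longrightarrow> \<exists>t'\<in>Hom C M' N. t' \<star> f = t"
  using approx by (simp add: left_add_approximation_def)

lemma X_in_add: "X \<in> add_subcat C T"
  by (rule add_subcat.summand[OF add_subcat.self TXM])

lemma M_in_add: "M \<in> add_subcat C T"
  by (rule add_subcat.summand[OF add_subcat.self direct_sum_commute[OF TXM]])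

lemma M'_in_add: "M' \<in> add_subcat C T"
  by (rule add_subcat_trans[OF M'_in M_in_add])

lemmas add_vanish = silting_add_Hom_zero[OF T]

text \<open>
  If \<open>h = 0\<close> then \<open>f\<close> is a split monomorphism and \<open>X\<close> is a summand of \<open>M'\<close>, hence of \<open>M\<close>.
\<close>
lemma connecting_nonzero: "h \<noteq> 0"
proof
  assume h0: "h = 0"
  note Sf = ShM_in_Hom[OF f_in]
  have D': "Dist C Y (ShO C X) (ShO C M') h (- ShM C f) (- ShM C g)"
    by (rule Dist_rot[OF Dist_rot[OF D]])
  have "Ident C (ShO C X) \<star> h = 0" using h0 Comp_zero_right[OF Ident_in_Hom] by simp
  then obtain s where s: "s \<in> Hom C (ShO C M') (ShO C X)" "s \<star> (- ShM C f) = Ident C (ShO C X)"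
    using Dist_extend[OF D' Ident_in_Hom] by blast
  obtain s' where s': "s' \<in> Hom C M' X" "s = ShM C s'"
    using ShM_funpow_full[of s 1 M' X] s(1) by auto
  have ms: "- s' \<in> Hom C M' X" by (rule uminus_in_Hom[OF s'(1)])
  have "ShM C (- s') = - s"
    using ShM_add[OF s'(1) ms] s'(2) by (simp add: ShM_zero eq_neg_iff_add_eq_0 add.commute)
  then have "ShM C ((- s') \<star> f) = ShM C (Ident C X)"
    using ShM_Comp[OF f_in ms] s(2) Comp_uminus_left[OF Sf s(1)] Comp_uminus_right[OF Sf s(1)]
    by (simp add: ShM_Ident)
  then have "(- s') \<star> f = Ident C X"
    using ShM_funpow_eq_iff[OF Comp_in_Hom[OF f_in ms] Ident_in_Hom, of 1] by simp
  then have "iso_mor C X X ((- s') \<star> f)" by (simp add: iso_mor_Ident)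
  then show False
    using add_subcat_local_split[OF X M'_in f_in ms] nonsplit by blast
qed

lemma M_cone_vanish:
  assumes "A \<in> add_subcat C T" "n > 0"
  shows "Hom C A (shO n Y) = {0}"
proof (rule Dist_Hom_zero_target[OF Dist_rot[OF D] add_vanish[OF assms(1) M'_in_add assms(2)]])
  show "Hom C A (shO n (ShO C X)) = {0}"
    unfolding ShO_funpow_Suc by (rule add_vanish[OF assms(1) X_in_add]) simp
qed

lemma mutation_le:
  assumes V: "direct_sum C Y M V"
  shows "silting_ge C T V"
  unfolding silting_ge_def
  using direct_sum_Hom_zero_target[OF V M_cone_vanish[OF add_subcat.self]
      add_vanish[OF add_subcat.self M_in_add]] by blast

lemma cone_vanish:
  assumes MA: "Hom C M A = {0}"
    and XA: "\<And>s. s \<in> Hom C (ShO C X) A \<Longrightarrow> s \<star> h = 0"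
  shows "Hom C Y A = {0}"
proof (rule Hom_zeroI)
  fix t assume t: "t \<in> Hom C Y A"
  have "t \<star> g = 0"
    using Comp_in_Hom[OF g_in t] add_subcat_Hom_zero_source[OF M'_in MA] by blast
  then obtain s where "s \<in> Hom C (ShO C X) A" "s \<star> h = t"
    using Dist_extend[OF Dist_rot[OF D] t] by blast
  then show "t = 0" using XA by blast
qed

text \<open>
  Only degree one needs the approximation property: there a map \<open>X[1] \<rightarrow> A[1]\<close> becomes zero on \<open>Y\<close> because it
  extends along \<open>f[1]\<close>.
\<close>
lemma cone_vanish_shift:
  assumes n: "n > 0" and MA: "Hom C M (shO n A) = {0}"
    and XA: "\<And>i. i > 0 \<Longrightarrow> Hom C X (shO i A) = {0}"
    and ext: "\<And>s. s \<in> Hom C X A \<Longrightarrow> \<exists>t\<in>Hom C M' A. t \<star> f = s"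
  shows "Hom C Y (shO n A) = {0}"
proof (rule cone_vanish[OF MA])
  fix s assume s: "s \<in> Hom C (ShO C X) (shO n A)"
  show "s \<star> h = 0"
  proof (cases "n = 1")
    case True
    then obtain s' where s': "s' \<in> Hom C X A" "s = ShM C s'"
      using ShM_funpow_full[of s 1 X A] s by auto
    obtain t where t: "t \<in> Hom C M' A" "t \<star> f = s'" using ext[OF s'(1)] by blast
    have "s \<star> h = ShM C t \<star> (ShM C f \<star> h)"
      using Comp_assoc[OF h_in ShM_in_Hom[OF f_in] ShM_in_Hom[OF t(1)]] ShM_Comp[OF f_in t(1)] t(2) s'(2)
      by simp
    then show ?thesis using Dist_comp'[OF D] Comp_zero_right[OF ShM_in_Hom[OF t(1)]] by simp
  next
    case False
    then have "Hom C (ShO C X) (shO n A) = {0}"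
      using Hom_shift_zero_diff[of X n 1 A] XA[of "n - 1"] n by simp
    then show ?thesis using s Comp_zero_left[OF h_in] by simp
  qed
qed

text \<open>
  The orthogonality conditions follow by running the triangle through both arguments of \<open>Hom\<close>. For
  generation, \<open>X\<close> is recovered from \<open>Y\<close> and \<open>M'\<close> by the triangle.
\<close>
lemma mutation_silting:
  assumes V: "direct_sum C Y M V"
  shows "silting C V"
proof -
  have MY: "Hom C M (shO n Y) = {0}" if "n > 0" for n
    by (rule M_cone_vanish[OF M_in_add that])
  have YN: "Hom C Y (shO n N) = {0}" if N: "N \<in> add_subcat C M" and n: "n > 0" for N n
  proof (rule cone_vanish_shift[OF n])
    have NT: "N \<in> add_subcat C T" by (rule add_subcat_trans[OF N M_in_add])
    show "Hom C M (shO n N) = {0}" by (rule add_vanish[OF M_in_add NT n])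
    show "Hom C X (shO i N) = {0}" if "i > 0" for i by (rule add_vanish[OF X_in_add NT that])
    show "\<exists>t\<in>Hom C M' N. t \<star> f = s" if "s \<in> Hom C X N" for s by (rule approxD[OF N that])
  qed
  have YX: "Hom C Y (shO (Suc n) X) = {0}" if n: "n > 0" for n
  proof (rule Dist_Hom_zero_source[OF Dist_rot[OF D]])
    show "Hom C M' (shO (Suc n) X) = {0}" by (rule add_vanish[OF M'_in_add X_in_add]) simp
    show "Hom C (ShO C X) (shO (Suc n) X) = {0}"
      using Hom_shift_zero_diff[of X "Suc n" 1 X] add_vanish[OF X_in_add X_in_add n] by simp
  qed
  have YY: "Hom C Y (shO n Y) = {0}" if n: "n > 0" for n
    using YN[OF M'_in n] YX[OF n]
    by (intro Dist_Hom_zero_target[OF Dist_rot[OF D]]) (simp_all only: ShO_funpow_Suc)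
  have VV: "Hom C V (shO n V) = {0}" if n: "n > 0" for n
    by (intro direct_sum_Hom_zero_source[OF V] direct_sum_Hom_zero_target[OF V] YY YN MY
        add_vanish M_in_add n add_subcat.self)
  have Y_thick: "Y \<in> thick C V" by (rule thick.summand[OF thick.self V])
  have M_thick: "M \<in> thick C V" by (rule thick.summand[OF thick.self direct_sum_commute[OF V]])
  have "X \<in> thick C V" by (rule thick_cocone[OF D add_subcat_in_thick[OF M_thick M'_in] Y_thick])
  then have "T \<in> thick C V" using M_thick TXM by (rule thick_direct_sum)
  moreover have "thick C T = UNIV" using T by (simp add: silting_def)
  ultimately have "thick C V = UNIV" using thick_minimal[of T V] by blast
  then show ?thesis using VV by (simp add: silting_def)
qed

text \<open>The map \<open>h\<close> is a nonzero element of \<open>Hom(Y, X[1])\<close>.\<close>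
lemma mutation_not_ge:
  assumes V: "direct_sum C Y M V"
  shows "\<not> silting_ge C V T"
proof
  assume "silting_ge C V T"
  then have "Hom C V (shO 1 T) = {0}" unfolding silting_ge_def by (metis zero_less_one)
  then have "Hom C Y (shO 1 X) = {0}"
    using add_subcat_Hom_zero_source[OF add_subcat.summand[OF add_subcat.self V]]
      add_subcat_Hom_zero_target[OF X_in_add] by blast
  then show False using h_in connecting_nonzero by auto
qed

lemma mutation_ge:
  assumes V: "direct_sum C Y M V" and TU: "silting_ge C T U"
    and ext: "\<And>s. s \<in> Hom C X U \<Longrightarrow> \<exists>t\<in>Hom C M' U. t \<star> f = s"
  shows "silting_ge C V U"
  unfolding silting_ge_def
proof (intro allI impI)
  fix n :: nat assume n: "n > 0"
  have TU': "Hom C T (shO i U) = {0}" if "i > 0" for i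
    using TU that unfolding silting_ge_def by blast
  note XU = add_subcat_Hom_zero_source[OF X_in_add TU']
    and MU = add_subcat_Hom_zero_source[OF M_in_add TU']
  show "Hom C V (shO n U) = {0}"
    using MU[OF n] by (intro direct_sum_Hom_zero_source[OF V] cone_vanish_shift n XU ext)
qed

lemma M_to_shift_X_zero: "b \<in> Hom C M (ShO C X) \<Longrightarrow> b = 0"
  using add_vanish[OF M_in_add X_in_add, of 1] by simp

text \<open>
  If \<open>1 = b a\<close> on \<open>Y\<close>, then \<open>h = (h b) a\<close>, and \<open>h b\<close> lies in \<open>Hom(M, X[1]) = 0\<close>.
\<close>
lemma cone_not_summand:
  assumes "a \<in> Hom C Y M" "b \<in> Hom C M Y"
  shows "b \<star> a \<noteq> Ident C Y"
proof
  assume ba: "b \<star> a = Ident C Y"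
  have "h \<star> b = 0" by (rule M_to_shift_X_zero[OF Comp_in_Hom[OF assms(2) h_in]])
  then have "h = 0"
    using Comp_assoc[OF assms h_in] ba Ident_right[OF h_in] Comp_zero_left[OF assms(1)] by simp
  then show False using connecting_nonzero by simp
qed

text \<open>
  An endomorphism \<open>a\<close> of \<open>Y\<close> lifts to an endomorphism \<open>(c, b, a)\<close> of the triangle because
  \<open>Hom(M', X[1]) = 0\<close>. As \<open>X\<close> is local, \<open>c\<close> or \<open>1 - c\<close> is invertible. Suppose that \<open>c\<close> has an inverse \<open>c'\<close>.
  The approximation property supplies \<open>b'\<close> with \<open>b' f = f c'\<close>, minimality of \<open>f\<close> makes \<open>b b'\<close> and \<open>b' b\<close>
  invertible, and then \<open>a\<close> is invertible by the five lemma. Otherwise the same applies to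
  \<open>(1 - c, 1 - b, 1 - a)\<close>.
\<close>
lemma cone_local: "local_obj C Y"
proof (rule local_objI)
  show "Ident C Y \<noteq> 0"
    using connecting_nonzero Ident_right[OF h_in] Comp_zero_right[OF h_in] by auto
next
  have iso_b: "iso_mor C M' M' b" if b: "b \<in> Hom C M' M'" and c: "iso_mor C X X c" and bf: "b \<star> f = f \<star> c"
    for b c
  proof -
    obtain c' where c': "c' \<in> Hom C X X" "c' \<star> c = Ident C X" "c \<star> c' = Ident C X"
      using c by (rule iso_morE)
    note c0 = iso_mor_in_Hom[OF c]
    obtain b' where b': "b' \<in> Hom C M' M'" "b' \<star> f = f \<star> c'"
      using approxD[OF M'_in Comp_in_Hom[OF c'(1) f_in]] by blast
    have "(b \<star> b') \<star> f = f"
      using Comp_assoc[OF f_in b'(1) b] b'(2) Comp_assoc[OF c'(1) f_in b] bf Comp_assoc[OF c'(1) c0 f_in]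
        c'(3) Ident_right[OF f_in] by simp
    then have 1: "iso_mor C M' M' (b \<star> b')"
      using min Comp_in_Hom[OF b'(1) b] by (simp add: left_minimal_def)
    have "(b' \<star> b) \<star> f = f"
      using Comp_assoc[OF f_in b b'(1)] b'(2) Comp_assoc[OF c0 f_in b'(1)] bf Comp_assoc[OF c0 c'(1) f_in]
        c'(2) Ident_right[OF f_in] by simp
    then have 2: "iso_mor C M' M' (b' \<star> b)"
      using min Comp_in_Hom[OF b b'(1)] by (simp add: left_minimal_def)
    show ?thesis by (rule iso_mor_if_both_composites[OF b b'(1) 2 1])
  qed
  fix a assume a: "a \<in> Hom C Y Y"
  have "h \<star> (a \<star> g) = 0"
  proof -
    have "h \<star> (a \<star> g) \<in> Hom C M' (ShO C X)" using a g_in h_in by (blast intro: Comp_in_Hom)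
    moreover have "Hom C M' (ShO C X) = {0}" using add_vanish[OF M'_in_add X_in_add, of 1] by simp
    ultimately show ?thesis by simp
  qed
  then obtain b where b: "b \<in> Hom C M' M'" "g \<star> b = a \<star> g"
    using Dist_lift[OF Dist_rot[OF D] Comp_in_Hom[OF g_in a]] by blast
  note Sf = ShM_in_Hom[OF f_in]
  \<comment> \<open>Complete \<open>(b, a)\<close> to an endomorphism of the rotated triangle and shift the third map back.\<close>
  obtain c1 where c1: "c1 \<in> Hom C (ShO C X) (ShO C X)" "c1 \<star> h = h \<star> a"
    "ShM C b \<star> (- ShM C f) = (- ShM C f) \<star> c1"
    using Dist_morphism[OF Dist_rot[OF D] Dist_rot[OF D] b(1) a b(2)[symmetric]] by blast
  obtain c where c: "c \<in> Hom C X X" "c1 = ShM C c" using ShM_funpow_full[of c1 1 X X] c1(1) by auto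
  have "ShM C (b \<star> f) = ShM C (f \<star> c)"
    using c1(3) Comp_uminus_right[OF Sf ShM_in_Hom[OF b(1)]] Comp_uminus_left[OF c1(1) Sf]
      ShM_Comp[OF f_in b(1)] ShM_Comp[OF c(1) f_in] c(2) by simp
  then have bf: "b \<star> f = f \<star> c"
    using ShM_funpow_eq_iff[OF Comp_in_Hom[OF f_in b(1)] Comp_in_Hom[OF c(1) f_in], of 1] by simp
  show "iso_mor C Y Y a \<or> iso_mor C Y Y (Ident C Y - a)"
  proof (cases "iso_mor C X X c")
    case True
    have "iso_mor C Y Y a"
      by (rule Dist_five[OF D True iso_b[OF b(1) True bf] a bf]) (use b c c1 in auto)
    then show ?thesis ..
  next
    case False
    let ?a = "Ident C Y - a" and ?b = "Ident C M' - b" and ?c = "Ident C X - c"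
    have c': "iso_mor C X X ?c" by (rule local_obj_complement[OF X c(1) False])
    have a': "?a \<in> Hom C Y Y" and b': "?b \<in> Hom C M' M'"
      using a b by (auto intro: diff_in_Hom Ident_in_Hom)
    have bf': "?b \<star> f = f \<star> ?c"
      using bf Comp_diff_left[OF f_in Ident_in_Hom b(1)] Comp_diff_right[OF Ident_in_Hom c(1) f_in]
        Ident_left[OF f_in] Ident_right[OF f_in] by simp
    have ag': "?a \<star> g = g \<star> ?b"
      using b(2) Comp_diff_left[OF g_in Ident_in_Hom a] Comp_diff_right[OF Ident_in_Hom b(1) g_in]
        Ident_left[OF g_in] Ident_right[OF g_in] by simp
    have "ShM C ?c + ShM C c = Ident C (ShO C X)"
      using ShM_add[OF diff_in_Hom[OF Ident_in_Hom c(1)] c(1)] by (simp add: ShM_Ident)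
    then have "ShM C ?c = Ident C (ShO C X) - c1" using c(2) by (simp add: algebra_simps)
    then have ha': "ShM C ?c \<star> h = h \<star> ?a"
      using c1(2) Comp_diff_left[OF h_in Ident_in_Hom c1(1)] Comp_diff_right[OF Ident_in_Hom a h_in]
        Ident_left[OF h_in] Ident_right[OF h_in] by simp
    show ?thesis using Dist_five[OF D c' iso_b[OF b' c' bf'] a' bf' ag' ha'] ..
  qed
qed

end

text \<open>
  Of two complementary idempotents in a local ring, one is invertible, and then the other one vanishes.
\<close>
lemma local_indecomposable:
  assumes X: "local_obj C X"
  shows "indecomposable C X"
  unfolding indecomposable_def
proof (intro conjI allI impI)
  show "\<not> zero_obj C X" using X by (simp add: zero_obj_iff local_obj_iff)
  fix A B assume "direct_sum C A B X"
  then obtain i j p q where m: "i \<in> Hom C A X" "j \<in> Hom C B X" "p \<in> Hom C X A" "q \<in> Hom C X B"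
    and e: "p \<star> i = Ident C A" "q \<star> j = Ident C B" "q \<star> i = 0" "p \<star> j = 0"
      "i \<star> p + j \<star> q = Ident C X" unfolding direct_sum_def by blast
  have *: "zero_obj C B" if m: "i \<in> Hom C A X" "j \<in> Hom C B X" "p \<in> Hom C X A" "q \<in> Hom C X B"
    and e: "p \<star> i = Ident C A" "q \<star> j = Ident C B" "q \<star> i = 0" and iso: "iso_mor C X X (i \<star> p)"
    for A B i j p q
  proof -
    obtain u where u: "u \<in> Hom C X X" "(i \<star> p) \<star> u = Ident C X" using iso by (rule iso_morE)
    have "q = q \<star> ((i \<star> p) \<star> u)" using u Ident_right[OF m(4)] by simp
    also have "\<dots> = (q \<star> i) \<star> (p \<star> u)"
      using Comp_assoc[OF u(1) m(3,1)] Comp_assoc[OF Comp_in_Hom[OF u(1) m(3)] m(1,4)] by simp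
    also have "\<dots> = 0" using e(3) Comp_zero_left[OF Comp_in_Hom[OF u(1) m(3)]] by simp
    finally show ?thesis using e(2) Comp_zero_left[OF m(2)] by (simp add: zero_obj_iff)
  qed
  have "iso_mor C X X (i \<star> p) \<or> iso_mor C X X (j \<star> q)"
    using local_objD[OF X Comp_in_Hom[OF m(3,1)] Comp_in_Hom[OF m(4,2)]] e(5) iso_mor_Ident by simp
  then show "zero_obj C A \<or> zero_obj C B"
    using *[OF m e(1-3)] *[OF m(2,1,4,3) e(2,1,4)] by blast
qed

end

section \<open>Basic endomorphism rings\<close>

lemma (in ring) additive_subgroupI':
  assumes "I \<subseteq> carrier R" "\<zero> \<in> I" "\<And>a b. \<lbrakk>a \<in> I; b \<in> I\<rbrakk> \<Longrightarrow> a \<oplus> b \<in> I"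
    and "\<And>a r. \<lbrakk>a \<in> I; r \<in> carrier R\<rbrakk> \<Longrightarrow> a \<otimes> r \<in> I"
  shows "subgroup I (add_monoid R)"
proof (rule add.subgroupI)
  fix a assume a: "a \<in> I"
  then have "a \<otimes> (\<ominus> \<one>) \<in> I" "a \<in> carrier R" using assms(1,4) by auto
  then show "\<ominus> a \<in> I" by (simp add: r_minus)
qed (use assms in auto)

lemma (in ring) right_idealI:
  assumes "I \<subseteq> carrier R" "\<zero> \<in> I" "\<And>a b. \<lbrakk>a \<in> I; b \<in> I\<rbrakk> \<Longrightarrow> a \<oplus> b \<in> I"
    and "\<And>a r. \<lbrakk>a \<in> I; r \<in> carrier R\<rbrakk> \<Longrightarrow> a \<otimes> r \<in> I"
  shows "right_ideal I R"
  using additive_subgroupI'[OF assms] assms(4) by (auto simp: right_ideal_def additive_subgroup_def)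

lemma
  assumes "right_ideal I R"
  shows right_ideal_zero: "\<zero>\<^bsub>R\<^esub> \<in> I" and right_ideal_subset: "I \<subseteq> carrier R"
    and right_ideal_add: "\<lbrakk>a \<in> I; b \<in> I\<rbrakk> \<Longrightarrow> a \<oplus>\<^bsub>R\<^esub> b \<in> I"
    and right_ideal_mult: "\<lbrakk>a \<in> I; r \<in> carrier R\<rbrakk> \<Longrightarrow> a \<otimes>\<^bsub>R\<^esub> r \<in> I"
proof -
  interpret additive_subgroup I R using assms by (simp add: right_ideal_def)
  show "\<zero>\<^bsub>R\<^esub> \<in> I" "I \<subseteq> carrier R" by (rule zero_closed, rule a_subset)
  show "a \<oplus>\<^bsub>R\<^esub> b \<in> I" if "a \<in> I" "b \<in> I" using that by (rule a_closed)
  show "a \<otimes>\<^bsub>R\<^esub> r \<in> I" if "a \<in> I" "r \<in> carrier R"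
    using assms that by (simp add: right_ideal_def)
qed

lemma (in ring) division_ring_quotient:
  assumes I: "ideal I R" and one: "\<one> \<notin> I"
    and inv: "\<And>a. \<lbrakk>a \<in> carrier R; a \<notin> I\<rbrakk> \<Longrightarrow> \<exists>b\<in>carrier R. a \<otimes> b \<ominus> \<one> \<in> I \<and> b \<otimes> a \<ominus> \<one> \<in> I"
  shows "division_ring (R Quot I)"
proof -
  interpret I: ideal I R by (rule I)
  let ?Q = "R Quot I"
  interpret Q: ring ?Q by (rule I.quotient_is_ring)
  have carr: "carrier ?Q = {I +> a | a. a \<in> carrier R}"
    by (auto simp: FactRing_def A_RCOSETS_def')
  have zero: "I +> a = \<zero>\<^bsub>?Q\<^esub> \<longleftrightarrow> a \<in> I" if "a \<in> carrier R" for a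
    using that a_rcos_zero[OF I] I.rcos_const_imp_mem by (auto simp: FactRing_def)
  have eq_one: "I +> a = \<one>\<^bsub>?Q\<^esub>" if "a \<in> carrier R" "a \<ominus> \<one> \<in> I" for a
    using that quotient_eq_iff_same_a_r_cos[OF I that(1) one_closed] by (simp add: FactRing_def)
  have mult: "(I +> a) \<otimes>\<^bsub>?Q\<^esub> (I +> b) = I +> (a \<otimes> b)" if "a \<in> carrier R" "b \<in> carrier R" for a b
    using I.rcoset_mult_add[OF that] by (simp add: FactRing_def)
  have ne: "\<one>\<^bsub>?Q\<^esub> \<noteq> \<zero>\<^bsub>?Q\<^esub>"
    using zero[OF one_closed] one by (simp add: FactRing_def)
  have "x \<in> Units ?Q" if x: "x \<in> carrier ?Q" "x \<noteq> \<zero>\<^bsub>?Q\<^esub>" for x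
  proof -
    obtain a where a: "a \<in> carrier R" "x = I +> a" using x carr by auto
    then have "a \<notin> I" using zero x by auto
    then obtain b where b: "b \<in> carrier R" "a \<otimes> b \<ominus> \<one> \<in> I" "b \<otimes> a \<ominus> \<one> \<in> I" using inv a by blast
    have "I +> b \<in> carrier ?Q" using b carr by auto
    moreover have "x \<otimes>\<^bsub>?Q\<^esub> (I +> b) = \<one>\<^bsub>?Q\<^esub>" "(I +> b) \<otimes>\<^bsub>?Q\<^esub> x = \<one>\<^bsub>?Q\<^esub>"
      using a b by (auto simp: mult intro!: eq_one)
    ultimately show ?thesis using x by (auto simp: Units_def)
  qed
  moreover have "\<zero>\<^bsub>?Q\<^esub> \<notin> Units ?Q" using ne by (auto simp: Units_def)
  ultimately have "Units ?Q = carrier ?Q - {\<zero>\<^bsub>?Q\<^esub>}" using Q.Units_closed by blast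
  then show ?thesis using ne Q.ring_axioms by (simp add: division_ring_def)
qed

lemma division_ring_square_zero:
  assumes "division_ring D" "x \<in> carrier D" "x \<otimes>\<^bsub>D\<^esub> x = \<zero>\<^bsub>D\<^esub>"
  shows "x = \<zero>\<^bsub>D\<^esub>"
proof (rule ccontr)
  interpret ring D using assms(1) by (simp add: division_ring_def)
  assume "x \<noteq> \<zero>\<^bsub>D\<^esub>"
  then have "x \<in> Units D" using assms by (simp add: division_ring_def)
  then obtain y where y: "y \<in> carrier D" "y \<otimes>\<^bsub>D\<^esub> x = \<one>\<^bsub>D\<^esub>" by (auto simp: Units_def)
  have "x = (y \<otimes>\<^bsub>D\<^esub> x) \<otimes>\<^bsub>D\<^esub> x" using y assms by simp
  also have "\<dots> = y \<otimes>\<^bsub>D\<^esub> (x \<otimes>\<^bsub>D\<^esub> x)" using y(1) assms(2) by (intro m_assoc)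
  also have "\<dots> = \<zero>\<^bsub>D\<^esub>" using y(1) assms(3) by simp
  finally show False using \<open>x \<noteq> \<zero>\<^bsub>D\<^esub>\<close> by simp
qed

text \<open>A product of division rings is reduced.\<close>
lemma RDirProd_list_square_zero:
  assumes "\<And>D. D \<in> set Ds \<Longrightarrow> division_ring D" "x \<in> carrier (RDirProd_list Ds)"
    and "x \<otimes>\<^bsub>RDirProd_list Ds\<^esub> x = \<zero>\<^bsub>RDirProd_list Ds\<^esub>"
  shows "x = \<zero>\<^bsub>RDirProd_list Ds\<^esub>"
  using assms
proof (induction Ds arbitrary: x)
  case Nil then show ?case by (simp add: monoid.defs)
next
  case (Cons D Ds)
  obtain a as where x: "x = a # as" "a \<in> carrier D" "as \<in> carrier (RDirProd_list Ds)"
    using Cons.prems(2) by (auto simp: RDirProd_list_carrier)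
  then have c: "(a, as) \<in> carrier (RDirProd D (RDirProd_list Ds))" by (simp add: RDirProd_carrier)
  have "x \<otimes>\<^bsub>RDirProd_list (D # Ds)\<^esub> x = (a \<otimes>\<^bsub>D\<^esub> a) # (as \<otimes>\<^bsub>RDirProd_list Ds\<^esub> as)"
    using ring_iso_memE(2)[OF RDirProd_list_iso1 c c] x(1)
    by (simp add: RDirProd_def DirProd_def monoid.defs)
  then have "a \<otimes>\<^bsub>D\<^esub> a = \<zero>\<^bsub>D\<^esub>" "as \<otimes>\<^bsub>RDirProd_list Ds\<^esub> as = \<zero>\<^bsub>RDirProd_list Ds\<^esub>"
    using Cons.prems(3) by (auto simp: RDirProd_list_zero')
  then have "a = \<zero>\<^bsub>D\<^esub>" "as = \<zero>\<^bsub>RDirProd_list Ds\<^esub>"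
    using division_ring_square_zero[of D a] x Cons.prems(1) Cons.IH by auto
  then show ?case using x(1) by (simp add: RDirProd_list_zero')
qed

context linear_category
begin

lemma ideal_End_ringI:
  assumes R: "cat_ideal C R"
  shows "ideal (R X X) (End_ring C X)"
proof (rule idealI[OF ring_End_ring])
  interpret E: ring "End_ring C X" by (rule ring_End_ring)
  show "subgroup (R X X) (add_monoid (End_ring C X))"
    by (rule E.additive_subgroupI')
      (auto simp: End_ring_simps cat_ideal_Hom[OF R] cat_ideal_zero[OF R] cat_ideal_add[OF R]
        intro: cat_ideal_pre[OF R])
qed (auto simp: End_ring_simps intro: cat_ideal_pre[OF R] cat_ideal_post[OF R])

text \<open>
  If a maximal right ideal \<open>I\<close> misses the radical element \<open>f\<close>, then \<open>I\<close> contains some \<open>1 - f e\<close>, which is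
  invertible.
\<close>
lemma radical_subset_jacobson: "cat_radical C W W \<subseteq> jacobson_radical (End_ring C W)"
proof
  interpret E: ring "End_ring C W" by (rule ring_End_ring)
  fix f assume f: "f \<in> cat_radical C W W"
  then have f0: "f \<in> Hom C W W" by (simp add: cat_radical_def)
  have "f \<in> I" if I: "maximal_right_ideal I (End_ring C W)" for I
  proof (rule ccontr)
    assume fI: "f \<notin> I"
    have rI: "right_ideal I (End_ring C W)" using I by (simp add: maximal_right_ideal_def)
    have I0: "0 \<in> I" and IH: "\<And>y. y \<in> I \<Longrightarrow> y \<in> Hom C W W"
      and Ia: "\<And>y z. \<lbrakk>y \<in> I; z \<in> I\<rbrakk> \<Longrightarrow> y + z \<in> I"
      and Im: "\<And>y e. \<lbrakk>y \<in> I; e \<in> Hom C W W\<rbrakk> \<Longrightarrow> y \<star> e \<in> I"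
      using right_ideal_zero[OF rI] right_ideal_subset[OF rI] right_ideal_add[OF rI]
        right_ideal_mult[OF rI] by (auto simp: End_ring_simps)
    let ?J = "{y + f \<star> e | y e. y \<in> I \<and> e \<in> Hom C W W}"
    have "right_ideal ?J (End_ring C W)"
    proof (rule E.right_idealI)
      show "?J \<subseteq> carrier (End_ring C W)"
        using IH f0 by (auto simp: End_ring_simps intro: add_in_Hom Comp_in_Hom)
      show "\<zero>\<^bsub>End_ring C W\<^esub> \<in> ?J"
        using I0 Comp_zero_right[OF f0] zero_in_Hom[of W W] by (force simp: End_ring_simps)
    next
      fix a b assume "a \<in> ?J" "b \<in> ?J"
      then obtain y e y' e' where "a = y + f \<star> e" "b = y' + f \<star> e'" "y \<in> I" "y' \<in> I"
        "e \<in> Hom C W W" "e' \<in> Hom C W W" by blast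
      moreover from this have "a + b = (y + y') + f \<star> (e + e')"
        using Comp_add_right[of e W W e' f W] f0 by (simp add: algebra_simps)
      ultimately show "a \<oplus>\<^bsub>End_ring C W\<^esub> b \<in> ?J"
        unfolding End_ring_simps using Ia add_in_Hom by blast
    next
      fix a r assume "a \<in> ?J" and r: "r \<in> carrier (End_ring C W)"
      then obtain y e where a: "a = y + f \<star> e" and y: "y \<in> I" and e: "e \<in> Hom C W W" by blast
      have r: "r \<in> Hom C W W" using r by (simp add: End_ring_simps)
      have "a \<star> r = y \<star> r + f \<star> (e \<star> r)"
        unfolding a using Comp_add_left[OF r IH[OF y] Comp_in_Hom[OF e f0]] Comp_assoc[OF r e f0] by simp
      then show "a \<otimes>\<^bsub>End_ring C W\<^esub> r \<in> ?J"
        unfolding End_ring_simps using Im[OF y r] Comp_in_Hom[OF r e] by blast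
    qed
    moreover have "I \<subseteq> ?J"
    proof
      fix y assume "y \<in> I"
      moreover have "y = y + f \<star> 0" using Comp_zero_right[OF f0] by simp
      ultimately show "y \<in> ?J" using zero_in_Hom by blast
    qed
    moreover have "f \<in> ?J"
      using I0 Ident_right[OF f0] Ident_in_Hom[of W] by force
    ultimately have "?J = carrier (End_ring C W)"
      using I fI unfolding maximal_right_ideal_def by blast
    then have "Ident C W \<in> ?J" by (simp add: End_ring_simps Ident_in_Hom)
    then obtain y e where y: "y \<in> I" and e: "e \<in> Hom C W W" and 1: "Ident C W = y + f \<star> e" by blast
    have fe: "f \<star> e \<in> cat_radical C W W" by (rule cat_ideal_pre[OF cat_ideal_radical f e])
    then have "iso_mor C W W (Ident C W - Ident C W \<star> (f \<star> e))"
      unfolding cat_radical_def using Ident_in_Hom by blast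
    then have "iso_mor C W W y" using 1 Ident_left[OF Comp_in_Hom[OF e f0]] by (simp add: algebra_simps)
    then obtain z where z: "z \<in> Hom C W W" "y \<star> z = Ident C W" by (rule iso_morE)
    have "Ident C W \<in> I" using Im[OF y z(1)] z(2) by simp
    then have "r \<in> I" if "r \<in> Hom C W W" for r using Im[OF _ that] Ident_left[OF that] by metis
    then have "I = carrier (End_ring C W)" using IH by (auto simp: End_ring_simps)
    then show False using I by (simp add: maximal_right_ideal_def)
  qed
  then show "f \<in> jacobson_radical (End_ring C W)"
    using f0 by (simp add: jacobson_radical_def End_ring_simps)
qed

text \<open>
  For \<open>g\<close> outside the ideal some \<open>p g x\<close> is invertible because \<open>N\<close> is local; let \<open>u\<close> be its inverse. The
  right ideal generated by \<open>g\<close> contains \<open>k = g x u p\<close>, and \<open>p k = p\<close> puts \<open>1 - k\<close> into the ideal given here.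
\<close>
lemma maximal_right_ideal_of_local_summand:
  assumes N: "local_obj C N" and i: "i \<in> Hom C N W" and p: "p \<in> Hom C W N" and pi: "p \<star> i = Ident C N"
  shows "maximal_right_ideal {g \<in> Hom C W W. p \<star> g \<in> cat_radical C W N} (End_ring C W)"
    (is "maximal_right_ideal ?I _")
proof -
  interpret E: ring "End_ring C W" by (rule ring_End_ring)
  note rad_zero = cat_ideal_zero[OF cat_ideal_radical]
  have rI: "right_ideal ?I (End_ring C W)"
  proof (rule E.right_idealI)
    fix a b assume "a \<in> ?I" "b \<in> ?I"
    then show "a \<oplus>\<^bsub>End_ring C W\<^esub> b \<in> ?I"
      using cat_ideal_add[OF cat_ideal_radical] Comp_add_right[OF _ _ p, of a W b]
      by (auto simp: End_ring_simps add_in_Hom)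
  next
    fix a r assume a: "a \<in> ?I" and r: "r \<in> carrier (End_ring C W)"
    then have r: "r \<in> Hom C W W" and a0: "a \<in> Hom C W W" by (auto simp: End_ring_simps)
    have "(p \<star> a) \<star> r \<in> cat_radical C W N" using a r by (auto intro: cat_ideal_pre[OF cat_ideal_radical])
    then show "a \<otimes>\<^bsub>End_ring C W\<^esub> r \<in> ?I"
      using Comp_assoc[OF r a0 p] Comp_in_Hom[OF r a0] by (simp add: End_ring_simps)
  qed (auto simp: End_ring_simps zero_in_Hom Comp_zero_right[OF p] rad_zero)
  have "Ident C W \<notin> ?I"
  proof
    assume "Ident C W \<in> ?I"
    then have "p \<in> cat_radical C W N" using Ident_right[OF p] by simp
    then have "Ident C N \<in> cat_radical C N N" using cat_ideal_pre[OF cat_ideal_radical _ i] pi by metis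
    then show False using radical_not_iso[of N] N iso_mor_Ident[of N] unfolding local_obj_iff by blast
  qed
  then have "?I \<noteq> carrier (End_ring C W)" using Ident_in_Hom by (auto simp: End_ring_simps)
  moreover have "J = ?I \<or> J = carrier (End_ring C W)" if J: "right_ideal J (End_ring C W)" "?I \<subseteq> J" for J
  proof (cases "J \<subseteq> ?I")
    case False
    then obtain g where g: "g \<in> J" "g \<notin> ?I" by blast
    have g0: "g \<in> Hom C W W" using right_ideal_subset[OF J(1)] g by (auto simp: End_ring_simps)
    have pg: "p \<star> g \<in> Hom C W N" by (rule Comp_in_Hom[OF g0 p])
    then obtain x where x: "x \<in> Hom C N W" "\<not> iso_mor C W W (Ident C W - x \<star> (p \<star> g))"
      using g g0 by (auto simp: cat_radical_def)
    then have "\<not> iso_mor C N N (Ident C N - (p \<star> g) \<star> x)"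
      using iso_mor_Ident_minus_swap[OF x(1) pg] by blast
    then have "iso_mor C N N ((p \<star> g) \<star> x)"
      using local_obj_complement[OF N] Comp_in_Hom[OF x(1) pg] by blast
    then obtain u where u: "u \<in> Hom C N N" "((p \<star> g) \<star> x) \<star> u = Ident C N" by (rule iso_morE)
    have up: "u \<star> p \<in> Hom C W N" by (rule Comp_in_Hom[OF p u(1)])
    have e: "x \<star> (u \<star> p) \<in> Hom C W W" by (rule Comp_in_Hom[OF up x(1)])
    let ?k = "g \<star> (x \<star> (u \<star> p))"
    have k: "?k \<in> J" using right_ideal_mult[OF J(1) g(1), of "x \<star> (u \<star> p)"] e by (simp add: End_ring_simps)
    have k0: "?k \<in> Hom C W W" by (rule Comp_in_Hom[OF e g0])
    have "p \<star> ?k = (((p \<star> g) \<star> x) \<star> u) \<star> p"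
      using Comp_assoc[OF e g0 p] Comp_assoc[OF up x(1) pg]
        Comp_assoc[OF p u(1) Comp_in_Hom[OF x(1) pg]] by simp
    then have "p \<star> (Ident C W - ?k) = 0"
      using Comp_diff_right[OF Ident_in_Hom k0 p] u(2) Ident_left[OF p] Ident_right[OF p] by simp
    then have "Ident C W - ?k \<in> J" using J(2) diff_in_Hom[OF Ident_in_Hom k0] rad_zero by auto
    then have "(Ident C W - ?k) + ?k \<in> J"
      using right_ideal_add[OF J(1) _ k] by (simp only: End_ring_simps)
    then have one: "Ident C W \<in> J" by simp
    have "r \<in> J" if "r \<in> Hom C W W" for r
      using right_ideal_mult[OF J(1) one, of r] that Ident_left[OF that] by (simp add: End_ring_simps)
    then show ?thesis using right_ideal_subset[OF J(1)] by (auto simp: End_ring_simps)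
  qed (use J(2) in blast)
  ultimately show ?thesis unfolding maximal_right_ideal_def using rI by blast
qed

text \<open>
  By the maximal right ideals belonging to the local summands, the rows of an element of the Jacobson
  radical are radical.
\<close>
lemma jacobson_radical_local_biproduct:
  assumes bp: "biproduct C I N \<iota> \<pi> W" and N: "\<And>i. i \<in> I \<Longrightarrow> local_obj C (N i)"
  shows "jacobson_radical (End_ring C W) = cat_radical C W W"
proof
  show "cat_radical C W W \<subseteq> jacobson_radical (End_ring C W)" by (rule radical_subset_jacobson)
  show "jacobson_radical (End_ring C W) \<subseteq> cat_radical C W W"
  proof
    fix f assume f: "f \<in> jacobson_radical (End_ring C W)"
    then have f0: "f \<in> Hom C W W" by (simp add: jacobson_radical_def End_ring_simps)
    have "\<pi> k \<star> f \<in> cat_radical C W (N k)" if k: "k \<in> I" for k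
      using f maximal_right_ideal_of_local_summand[OF N[OF k] biproduct_inj[OF bp k] biproduct_proj[OF bp k]]
        biproduct_proj_inj[OF bp k k] unfolding jacobson_radical_def by auto
    then have "(\<Sum>k\<in>I. \<iota> k \<star> (\<pi> k \<star> f)) \<in> cat_radical C W W"
      using biproduct_inj[OF bp] by (intro cat_ideal_sum[OF cat_ideal_radical])
        (blast intro: cat_ideal_post[OF cat_ideal_radical])
    then show "f \<in> cat_radical C W W" using biproduct_expand_target[OF bp f0] by simp
  qed
qed

text \<open>
  The quotient by the radical is a product of division rings and has no nonzero element of square zero.
\<close>
lemma basic_square_zero:
  assumes bp: "biproduct C I N \<iota> \<pi> W" and N: "\<And>i. i \<in> I \<Longrightarrow> local_obj C (N i)"
    and W: "basic_obj C W" and a: "a \<in> Hom C W W" "a \<star> a = 0"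
  shows "a \<in> cat_radical C W W"
proof -
  let ?E = "End_ring C W" and ?J = "cat_radical C W W"
  interpret E: ring ?E by (rule ring_End_ring)
  have id: "ideal ?J ?E" by (rule ideal_End_ringI[OF cat_ideal_radical])
  interpret J: ideal ?J ?E by (rule id)
  let ?Q = "?E Quot ?J"
  interpret Q: ring ?Q by (rule J.quotient_is_ring)
  have jac: "jacobson_radical ?E = ?J" by (rule jacobson_radical_local_biproduct[OF bp N])
  have "\<exists>Ds :: 'm set ring list. (\<forall>D\<in>set Ds. division_ring D) \<and> ?Q \<simeq> RDirProd_list Ds"
    using W jac by (simp only: basic_obj_def basic_algebra_def)
  then obtain Ds :: "'m set ring list" where Ds: "\<And>D. D \<in> set Ds \<Longrightarrow> division_ring D"
    and iso: "?Q \<simeq> RDirProd_list Ds" by blast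
  obtain \<phi> where \<phi>: "\<phi> \<in> ring_iso ?Q (RDirProd_list Ds)" using iso by (auto simp: is_ring_iso_def)
  interpret P: ring "RDirProd_list Ds"
    using Ds by (intro RDirProd_list_is_ring) (auto simp: division_ring_def)
  let ?a = "?J +>\<^bsub>?E\<^esub> a"
  have ac: "?a \<in> carrier ?Q" using a(1) by (auto simp: FactRing_def A_RCOSETS_def' End_ring_simps)
  have "?a \<otimes>\<^bsub>?Q\<^esub> ?a = ?J +>\<^bsub>?E\<^esub> \<zero>\<^bsub>?E\<^esub>"
    using J.rcoset_mult_add[of a a] a by (simp add: FactRing_def End_ring_simps)
  also have "\<dots> = \<zero>\<^bsub>?Q\<^esub>"
    using E.a_rcos_zero[OF id J.zero_closed] by (simp add: FactRing_def)
  finally have aa: "?a \<otimes>\<^bsub>?Q\<^esub> ?a = \<zero>\<^bsub>?Q\<^esub>" .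
  have \<phi>0: "\<phi> \<zero>\<^bsub>?Q\<^esub> = \<zero>\<^bsub>RDirProd_list Ds\<^esub>"
    using \<phi> by (intro ring_hom_zero[OF _ Q.ring_axioms P.ring_axioms]) (simp add: ring_iso_def)
  have "\<phi> ?a = \<zero>\<^bsub>RDirProd_list Ds\<^esub>"
  proof (rule RDirProd_list_square_zero[OF Ds])
    show "\<phi> ?a \<in> carrier (RDirProd_list Ds)" by (rule ring_iso_memE(1)[OF \<phi> ac])
    show "\<phi> ?a \<otimes>\<^bsub>RDirProd_list Ds\<^esub> \<phi> ?a = \<zero>\<^bsub>RDirProd_list Ds\<^esub>"
      using ring_iso_memE(2)[OF \<phi> ac ac] aa \<phi>0 by simp
  qed
  then have "?a = \<zero>\<^bsub>?Q\<^esub>"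
    using \<phi>0 by (intro inj_onD[OF bij_betw_imp_inj_on[OF ring_iso_memE(5)[OF \<phi>]] _ ac Q.zero_closed]) simp
  then show ?thesis
    using J.rcos_const_imp_mem[of a] a(1) by (simp add: FactRing_def End_ring_simps)
qed

text \<open>
  If \<open>X\<close> were also a summand of \<open>M\<close>, the map \<open>T \<rightarrow> M \<rightarrow> X \<rightarrow> T\<close> built from \<open>b\<close> would have square zero, hence
  be radical, although \<open>b a\<close> is recovered from it and is invertible.
\<close>
lemma basic_nonsplit:
  assumes bp: "biproduct C I N \<iota> \<pi> T" and N: "\<And>i. i \<in> I \<Longrightarrow> local_obj C (N i)"
    and T: "basic_obj C T" and ds: "direct_sum C X M T" and X: "Ident C X \<noteq> 0"
    and a: "a \<in> Hom C X M" and b: "b \<in> Hom C M X"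
  shows "\<not> iso_mor C X X (b \<star> a)"
proof
  assume iso: "iso_mor C X X (b \<star> a)"
  from ds obtain i j p q where m: "i \<in> Hom C X T" "j \<in> Hom C M T" "p \<in> Hom C T X" "q \<in> Hom C T M"
    and e: "p \<star> i = Ident C X" "q \<star> j = Ident C M" "q \<star> i = 0" unfolding direct_sum_def by blast
  let ?c = "i \<star> (b \<star> q)"
  have bq: "b \<star> q \<in> Hom C T X" by (rule Comp_in_Hom[OF m(4) b])
  have c: "?c \<in> Hom C T T" by (rule Comp_in_Hom[OF bq m(1)])
  have ib: "i \<star> b \<in> Hom C M T" by (rule Comp_in_Hom[OF b m(1)])
  have "(b \<star> q) \<star> ?c = b \<star> ((q \<star> i) \<star> (b \<star> q))"
    using Comp_assoc[OF c m(4) b] Comp_assoc[OF bq m(1,4)] by simp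
  then have "(b \<star> q) \<star> ?c = 0" using e(3) Comp_zero_left[OF bq] Comp_zero_right[OF b] by simp
  then have cc: "?c \<star> ?c = 0" using Comp_assoc[OF c bq m(1)] Comp_zero_right[OF m(1)] by simp
  have "?c \<in> cat_radical C T T" by (rule basic_square_zero[OF bp N T c cc])
  then have "p \<star> (?c \<star> (j \<star> a)) \<in> cat_radical C X X"
    by (intro cat_ideal_post[OF cat_ideal_radical _ m(3)]
        cat_ideal_pre[OF cat_ideal_radical _ Comp_in_Hom[OF a m(2)]])
  also have "p \<star> (?c \<star> (j \<star> a)) = (p \<star> i) \<star> (b \<star> (q \<star> (j \<star> a)))"
    using Comp_assoc[OF Comp_in_Hom[OF a m(2)] bq m(1)] Comp_assoc[OF Comp_in_Hom[OF a m(2)] m(4) b]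
      Comp_assoc[OF Comp_in_Hom[OF Comp_in_Hom[OF a m(2)] bq] m(1,3)] by simp
  also have "\<dots> = b \<star> a"
    using e Comp_assoc[OF a m(2,4)] Ident_left[OF a] Ident_left[OF Comp_in_Hom[OF a b]] by simp
  finally show False using radical_not_iso[OF X] iso by blast
qed

text \<open>
  The endomorphisms of \<open>W\<close> through which \<open>N k\<close> does not split off form a two-sided ideal \<open>I k\<close>. Because
  the summands are pairwise non-isomorphic, membership in \<open>I k\<close> depends only on the \<open>k\<close>-th diagonal entry,
  so \<open>I k\<close> has a division ring as quotient and the diagonal matrices give the surjectivity in the Chinese
  remainder theorem. The intersection of the ideals \<open>I k\<close> is the radical.
\<close>
lemma basic_if_pairwise_non_isomorphic:
  assumes bp: "biproduct C {..<Suc m} N \<iota> \<pi> W" and N: "\<And>i. i < Suc m \<Longrightarrow> local_obj C (N i)"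
    and non_iso: "\<And>i j. \<lbrakk>i < Suc m; j < Suc m; iso_obj C (N i) (N j)\<rbrakk> \<Longrightarrow> i = j"
  shows "basic_obj C W"
proof -
  let ?E = "End_ring C W"
  interpret E: ring ?E by (rule ring_End_ring)
  have i: "\<iota> l \<in> Hom C (N l) W" and p: "\<pi> l \<in> Hom C W (N l)" if "l < Suc m" for l
    using that biproduct_inj[OF bp] biproduct_proj[OF bp] by auto
  have pi: "\<pi> k \<star> \<iota> k = Ident C (N k)" if "k < Suc m" for k
    using that biproduct_proj_inj[OF bp] by auto
  have nz: "Ident C (N k) \<noteq> 0" if "k < Suc m" for k using N[OF that] by (simp add: local_obj_iff)
  have entry_in_Hom: "\<pi> l \<star> (f \<star> \<iota> k) \<in> Hom C (N k) (N l)"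
    if "k < Suc m" "l < Suc m" "f \<in> Hom C W W" for k l f
    using that i p by (blast intro: Comp_in_Hom)
  define I where "I k = avoiding_ideal (N k) W W" for k
  have id: "ideal (I k) ?E" if k: "k < Suc m" for k
    unfolding I_def by (rule ideal_End_ringI[OF cat_ideal_avoiding[OF N[OF k]]])
  have I_in_Hom: "f \<in> Hom C W W" if "f \<in> I k" for f k using that by (simp add: I_def avoiding_ideal_def)
  \<comment> \<open>\<open>N k\<close> does not split off through a map from \<open>N x\<close> to \<open>N y\<close> unless \<open>x = y = k\<close>.\<close>
  have entry: "f \<in> I k"
    if k: "k < Suc m" and f: "f \<in> Hom C W W" and fk: "\<pi> k \<star> (f \<star> \<iota> k) \<in> cat_radical C (N k) (N k)" for k f
    unfolding I_def
  proof (rule biproduct_in_ideal[OF bp bp cat_ideal_avoiding[OF N[OF k]] f])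
    fix x y assume "x \<in> {..<Suc m}" "y \<in> {..<Suc m}"
    then have x: "x < Suc m" and y: "y < Suc m" by auto
    let ?e = "\<pi> y \<star> (f \<star> \<iota> x)"
    note e = entry_in_Hom[OF x y f]
    have "\<not> iso_mor C (N k) (N k) (b \<star> (?e \<star> a))"
      if a: "a \<in> Hom C (N k) (N x)" and b: "b \<in> Hom C (N y) (N k)" for a b
    proof
      assume iso: "iso_mor C (N k) (N k) (b \<star> (?e \<star> a))"
      have "iso_mor C (N k) (N x) a"
        using iso Comp_assoc[OF a e b] by (intro local_obj_iso_mor[OF N[OF x] nz[OF k] a Comp_in_Hom[OF e b]]) simp
      then have "k = x" using non_iso[OF k x] unfolding iso_obj_def by blast
      moreover have "iso_mor C (N k) (N y) (?e \<star> a)"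
        by (rule local_obj_iso_mor[OF N[OF y] nz[OF k] Comp_in_Hom[OF a e] b iso])
      then have "k = y" using non_iso[OF k y] unfolding iso_obj_def by blast
      ultimately have "?e \<in> cat_radical C (N x) (N y)" using fk by simp
      then have "b \<star> (?e \<star> a) \<in> cat_radical C (N k) (N k)"
        by (intro cat_ideal_post[OF cat_ideal_radical _ b] cat_ideal_pre[OF cat_ideal_radical _ a])
      then show False using radical_not_iso[OF nz[OF k]] iso by blast
    qed
    then show "?e \<in> avoiding_ideal (N k) (N x) (N y)" using e by (simp add: avoiding_ideal_def)
  qed
  have entry_iso: "iso_mor C (N k) (N k) (\<pi> k \<star> (f \<star> \<iota> k))"
    if k: "k < Suc m" and f: "f \<in> Hom C W W" "f \<notin> I k" for k f
    using local_iso_if_not_radical[OF N[OF k] N[OF k] entry_in_Hom[OF k k f(1)]] entry[OF k f(1)] f(2) by blast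
  have entry_zero: "f \<in> I k" if k: "k < Suc m" and f: "f \<in> Hom C W W" and 0: "\<pi> k \<star> (f \<star> \<iota> k) = 0" for k f
    using entry[OF k f] 0 cat_ideal_zero[OF cat_ideal_radical] by simp
  have minus: "x \<ominus>\<^bsub>?E\<^esub> y = x - y" if "y \<in> Hom C W W" for x y
  proof -
    have "\<ominus>\<^bsub>?E\<^esub> y = - y"
      by (rule E.minus_equality) (use that in \<open>auto simp: End_ring_simps intro: uminus_in_Hom\<close>)
    then show ?thesis by (simp add: a_minus_def End_ring_simps)
  qed
  have div: "division_ring (?E Quot I k)" if k: "k < Suc m" for k
  proof (rule E.division_ring_quotient[OF id[OF k]])
    have "iso_mor C (N k) (N k) (\<pi> k \<star> (Ident C W \<star> \<iota> k))"
      using pi[OF k] Ident_left[OF i[OF k]] iso_mor_Ident by simp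
    then show "\<one>\<^bsub>?E\<^esub> \<notin> I k"
      using i[OF k] p[OF k] by (auto simp: I_def End_ring_simps avoiding_ideal_def)
  next
    fix a assume "a \<in> carrier ?E" and aI: "a \<notin> I k"
    then have a: "a \<in> Hom C W W" by (simp add: End_ring_simps)
    have ai: "a \<star> \<iota> k \<in> Hom C (N k) W" by (rule Comp_in_Hom[OF i[OF k] a])
    obtain u where u: "u \<in> Hom C (N k) (N k)" "u \<star> (\<pi> k \<star> (a \<star> \<iota> k)) = Ident C (N k)"
      "(\<pi> k \<star> (a \<star> \<iota> k)) \<star> u = Ident C (N k)" using entry_iso[OF k a aI] by (rule iso_morE)
    have up: "u \<star> \<pi> k \<in> Hom C W (N k)" by (rule Comp_in_Hom[OF p[OF k] u(1)])
    let ?b = "\<iota> k \<star> (u \<star> \<pi> k)"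
    have b: "?b \<in> Hom C W W" by (rule Comp_in_Hom[OF up i[OF k]])
    have ab: "a \<star> ?b \<in> Hom C W W" and ba: "?b \<star> a \<in> Hom C W W"
      by (rule Comp_in_Hom[OF b a], rule Comp_in_Hom[OF a b])
    have in_I: "c - Ident C W \<in> I k" if c: "c \<in> Hom C W W" "\<pi> k \<star> (c \<star> \<iota> k) = Ident C (N k)" for c
    proof (rule entry_zero[OF k diff_in_Hom[OF c(1) Ident_in_Hom]])
      show "\<pi> k \<star> ((c - Ident C W) \<star> \<iota> k) = 0"
        using Comp_diff_left[OF i[OF k] c(1) Ident_in_Hom] c(2) pi[OF k] Ident_left[OF i[OF k]]
          Comp_diff_right[OF Comp_in_Hom[OF i[OF k] c(1)] i[OF k] p[OF k]] by simp
    qed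
    have "?b \<star> \<iota> k = \<iota> k \<star> u"
      using Comp_assoc[OF i[OF k] up i[OF k]] Comp_assoc[OF i[OF k] p[OF k] u(1)] pi[OF k] Ident_right[OF u(1)]
      by simp
    then have "(a \<star> ?b) \<star> \<iota> k = (a \<star> \<iota> k) \<star> u"
      using Comp_assoc[OF i[OF k] b a] Comp_assoc[OF u(1) i[OF k] a] by simp
    then have 1: "a \<star> ?b - Ident C W \<in> I k"
      using Comp_assoc[OF u(1) ai p[OF k]] u(3) by (intro in_I[OF ab]) simp
    have "(?b \<star> a) \<star> \<iota> k = \<iota> k \<star> (u \<star> (\<pi> k \<star> (a \<star> \<iota> k)))"
      using Comp_assoc[OF i[OF k] a b] Comp_assoc[OF ai up i[OF k]] Comp_assoc[OF ai p[OF k] u(1)] by simp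
    then have 2: "?b \<star> a - Ident C W \<in> I k"
      using u(2) Ident_right[OF i[OF k]] pi[OF k] by (intro in_I[OF ba]) simp
    show "\<exists>b\<in>carrier ?E. a \<otimes>\<^bsub>?E\<^esub> b \<ominus>\<^bsub>?E\<^esub> \<one>\<^bsub>?E\<^esub> \<in> I k \<and> b \<otimes>\<^bsub>?E\<^esub> a \<ominus>\<^bsub>?E\<^esub> \<one>\<^bsub>?E\<^esub> \<in> I k"
      using 1 2 b minus[OF Ident_in_Hom] by (intro bexI[of _ ?b]) (simp_all only: End_ring_simps simp_thms)
  qed
  have inter: "(\<Inter>k\<le>m. I k) = cat_radical C W W"
  proof
    show "cat_radical C W W \<subseteq> (\<Inter>k\<le>m. I k)"
    proof (rule INT_greatest)
      fix k assume "k \<in> {..m}"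
      then have k: "k < Suc m" by simp
      show "cat_radical C W W \<subseteq> I k"
        using cat_ideal_post[OF cat_ideal_radical cat_ideal_pre[OF cat_ideal_radical _ i[OF k]] p[OF k]]
        by (auto intro!: entry[OF k] cat_ideal_Hom[OF cat_ideal_radical])
    qed
    show "(\<Inter>k\<le>m. I k) \<subseteq> cat_radical C W W"
    proof
      fix f assume fI: "f \<in> (\<Inter>k\<le>m. I k)"
      have f: "f \<in> Hom C W W" using fI by (intro I_in_Hom[of f m]) blast
      show "f \<in> cat_radical C W W"
      proof (rule biproduct_in_ideal[OF bp bp cat_ideal_radical f], rule ccontr)
        fix x y assume "x \<in> {..<Suc m}" "y \<in> {..<Suc m}"
          and n: "\<pi> y \<star> (f \<star> \<iota> x) \<notin> cat_radical C (N x) (N y)"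
        then have x: "x < Suc m" and y: "y < Suc m" by auto
        have iso: "iso_mor C (N x) (N y) (\<pi> y \<star> (f \<star> \<iota> x))"
          by (rule local_iso_if_not_radical[OF N[OF x] N[OF y] entry_in_Hom[OF x y f] n])
        then have "x = y" using non_iso[OF x y] unfolding iso_obj_def by blast
        moreover have "f \<in> avoiding_ideal (N x) W W" using fI x by (simp add: I_def)
        ultimately show False using iso i[OF x] p[OF x] by (simp add: avoiding_ideal_def)
      qed
    qed
  qed
  have idle: "\<And>k. k \<le> m \<Longrightarrow> ideal (I k) ?E" using id by (simp add: less_Suc_eq_le)
  let ?Ds = "map (\<lambda>k. ?E Quot I k) [0..<Suc m]"
  let ?proj = "E.canonical_proj_ext I m"
  interpret proj: ring_hom_ring ?E "RDirProd_list ?Ds" ?proj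
    by (rule E.canonical_proj_ext_ring_hom[OF idle])
  have "?proj ` carrier ?E = carrier (RDirProd_list ?Ds)"
  proof
    show "?proj ` carrier ?E \<subseteq> carrier (RDirProd_list ?Ds)" using proj.hom_closed by blast
    show "carrier (RDirProd_list ?Ds) \<subseteq> ?proj ` carrier ?E"
    proof
      fix xs assume xs: "xs \<in> carrier (RDirProd_list ?Ds)"
      have len: "length xs = Suc m" using RDirProd_list_carrier_mem(1)[OF xs] by simp
      have "\<exists>r. r \<in> Hom C W W \<and> xs ! k = I k +>\<^bsub>?E\<^esub> r" if k: "k < Suc m" for k
      proof -
        have "xs ! k \<in> carrier (?E Quot I k)"
          using RDirProd_list_carrier_mem(2)[OF xs, of k] k by (simp del: upt_Suc)
        then show ?thesis by (auto simp: FactRing_def A_RCOSETS_def' End_ring_simps)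
      qed
      then obtain r where r: "\<And>k. k < Suc m \<Longrightarrow> r k \<in> Hom C W W"
        and xr: "\<And>k. k < Suc m \<Longrightarrow> xs ! k = I k +>\<^bsub>?E\<^esub> r k" by metis
      let ?s = "\<Sum>l<Suc m. \<iota> l \<star> (\<pi> l \<star> r l)"
      have pr: "\<pi> l \<star> r l \<in> Hom C W (N l)" if "l < Suc m" for l
        using Comp_in_Hom[OF r p] that by blast
      have s: "?s \<in> Hom C W W" using Comp_in_Hom[OF pr i] by (intro sum_in_Hom) simp
      have "I k +>\<^bsub>?E\<^esub> ?s = I k +>\<^bsub>?E\<^esub> r k" if k: "k < Suc m" for k
      proof -
        have "\<pi> k \<star> ?s = \<pi> k \<star> r k"
          using biproduct_proj_sum[OF bp subset_refl, of k "\<lambda>l. \<pi> l \<star> r l" W] k pr by simp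
        then have "\<pi> k \<star> ((?s - r k) \<star> \<iota> k) = 0"
          using Comp_diff_right[OF s r[OF k] p[OF k]] Comp_zero_left[OF i[OF k]]
            Comp_assoc[OF i[OF k] diff_in_Hom[OF s r[OF k]] p[OF k]] by simp
        then have "?s \<ominus>\<^bsub>?E\<^esub> r k \<in> I k"
          unfolding minus[OF r[OF k]] by (rule entry_zero[OF k diff_in_Hom[OF s r[OF k]]])
        then show ?thesis
          using E.quotient_eq_iff_same_a_r_cos[OF id[OF k], of ?s "r k"] s r[OF k]
          by (simp add: End_ring_simps(1))
      qed
      then have "xs = ?proj ?s"
        using len xr by (intro nth_equalityI) (auto simp: E.canonical_proj_ext_def simp del: upt_Suc sum.lessThan_Suc)
      then show "xs \<in> ?proj ` carrier ?E" using s by (auto simp: End_ring_simps)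
    qed
  qed
  then have iso: "?E Quot (a_kernel ?E (RDirProd_list ?Ds) ?proj) \<simeq> RDirProd_list ?Ds"
    by (rule proj.FactRing_iso)
  have "a_kernel ?E (RDirProd_list ?Ds) ?proj = cat_radical C W W"
    using E.canonical_proj_ext_ker[of m I, OF idle] inter by (simp only:)
  also have "\<dots> = jacobson_radical ?E"
    using jacobson_radical_local_biproduct[OF bp] N by simp
  finally have "?E Quot jacobson_radical ?E \<simeq> RDirProd_list ?Ds" using iso by simp
  moreover have "\<forall>D\<in>set ?Ds. division_ring D" using div by auto
  ultimately show ?thesis unfolding basic_obj_def basic_algebra_def by blast
qed

end

section \<open>Choosing the summand to mutate\<close>

lemma (in vector_space) dim_strict_mono:
  assumes S: "subspace S" and S': "subspace S'" and lt: "S \<subset> S'" and B: "finite B" "S' \<subseteq> span B"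
  shows "dim S < dim S'"
proof -
  obtain b where b: "b \<subseteq> S" "independent b" "S \<subseteq> span b" "card b = dim S" by (rule basis_exists)
  obtain b' where b': "b' \<subseteq> S'" "independent b'" "S' \<subseteq> span b'" "card b' = dim S'" by (rule basis_exists)
  have fin': "finite b'" using independent_span_bound[OF B(1) b'(2)] b'(1) B(2) by blast
  obtain x where x: "x \<in> S'" "x \<notin> S" using lt by blast
  have "x \<notin> span b" using x(2) span_minimal[OF b(1) S] by blast
  then have ind: "independent (insert x b)" by (rule independent_insertI[OF _ b(2)])
  have "insert x b \<subseteq> span b'" using x(1) b(1) lt b'(3) by blast
  then have "finite (insert x b) \<and> card (insert x b) \<le> card b'"
    by (rule independent_span_bound[OF fin' ind])
  moreover have "x \<notin> b" using \<open>x \<notin> span b\<close> span_base by blast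
  ultimately show ?thesis using b(4) b'(4) by (auto simp: card_insert_disjoint)
qed

context triangulated_category
begin

lemma biproduct_shift:
  assumes bp: "biproduct C I N \<iota> \<pi> W"
  shows "biproduct C I (\<lambda>i. shO n (N i)) (\<lambda>i. shM n (\<iota> i)) (\<lambda>i. shM n (\<pi> i)) (shO n W)"
proof -
  have i: "\<iota> l \<in> Hom C (N l) W" and p: "\<pi> l \<in> Hom C W (N l)" if "l \<in> I" for l
    using that biproduct_inj[OF bp] biproduct_proj[OF bp] by auto
  have sum: "shM n (\<Sum>i\<in>J. f i) = (\<Sum>i\<in>J. shM n (f i))"
    if "finite J" "\<And>i. i \<in> J \<Longrightarrow> f i \<in> Hom C W W" for J and f :: "_ \<Rightarrow> 'm"
    using that
  proof (induction J rule: finite_induct)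
    case empty show ?case by (simp add: ShM_funpow_zero)
  next
    case (insert x J)
    have "shM n (f x + (\<Sum>i\<in>J. f i)) = shM n (f x) + shM n (\<Sum>i\<in>J. f i)"
      using insert.prems by (intro ShM_funpow_add sum_in_Hom) auto
    then show ?case using insert by simp
  qed
  have "(\<Sum>i\<in>I. shM n (\<iota> i) \<star> shM n (\<pi> i)) = (\<Sum>i\<in>I. shM n (\<iota> i \<star> \<pi> i))"
    using ShM_funpow_Comp[OF p i] by (intro sum.cong) auto
  also have "\<dots> = shM n (\<Sum>i\<in>I. \<iota> i \<star> \<pi> i)"
    using Comp_in_Hom[OF p i] by (intro sum[symmetric] biproduct_finite[OF bp]) auto
  also have "\<dots> = Ident C (shO n W)" using biproduct_sum[OF bp] by (simp add: ShM_funpow_Ident)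
  finally have "(\<Sum>i\<in>I. shM n (\<iota> i) \<star> shM n (\<pi> i)) = Ident C (shO n W)" .
  moreover have "shM n (\<pi> i) \<star> shM n (\<iota> j) = (if i = j then Ident C (shO n (N i)) else 0)"
    if "i \<in> I" "j \<in> I" for i j
    using ShM_funpow_Comp[OF i p, of j i n] that biproduct_proj_inj[OF bp that]
    by (auto simp: ShM_funpow_Ident ShM_funpow_zero)
  ultimately show ?thesis
    unfolding biproduct_def using biproduct_finite[OF bp] ShM_funpow_in_Hom[OF i] ShM_funpow_in_Hom[OF p] by blast
qed

lemma local_obj_shift:
  assumes X: "local_obj C X"
  shows "local_obj C (shO n X)"
proof (rule local_objI)
  show "Ident C (shO n X) \<noteq> 0"
    using X ShM_funpow_eq_iff[OF Ident_in_Hom zero_in_Hom, of n X]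
    by (simp add: local_obj_iff ShM_funpow_Ident ShM_funpow_zero)
  fix f assume "f \<in> Hom C (shO n X) (shO n X)"
  then obtain g where g: "g \<in> Hom C X X" "f = shM n g" by (rule ShM_funpow_full)
  have d: "Ident C X - g \<in> Hom C X X" by (rule diff_in_Hom[OF Ident_in_Hom g(1)])
  have "shM n (Ident C X - g) + f = Ident C (shO n X)"
    using ShM_funpow_add[OF d g(1), of n] g(2) by (simp add: ShM_funpow_Ident)
  then have "Ident C (shO n X) - f = shM n (Ident C X - g)" by (simp add: algebra_simps)
  then show "iso_mor C (shO n X) (shO n X) f \<or>
    iso_mor C (shO n X) (shO n X) (Ident C (shO n X) - f)"
    using local_obj_complement[OF X g(1)] ShM_funpow_iso_iff[OF g(1)] ShM_funpow_iso_iff[OF d] g(2) by auto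
qed

end

context hom_finite_triangulated_category
begin

text \<open>
  Nakayama's lemma for the finite-dimensional right \<open>End(X)\<close>-module \<open>Hom(X, U)\<close>. A proper submodule \<open>K\<close> lies
  in a maximal one, \<open>S\<close>, which contains \<open>Hom(X, U)\<close> times the radical. Modulo \<open>S\<close>, a map \<open>X \<rightarrow> T0 \<rightarrow> U\<close> with
  radical first factor vanishes: the identity of \<open>T\<close> splits into the part through \<open>M\<close>, covered by \<open>KM\<close>, and
  the part through \<open>X\<close>, covered by the choice of \<open>S\<close>; and \<open>T0\<close> is in \<open>add T\<close>.
\<close>
lemma local_nakayama:
  assumes ds: "direct_sum C X M T"
    and K: "subspace K" "K \<subseteq> Hom C X U" "\<And>k e. \<lbrakk>k \<in> K; e \<in> Hom C X X\<rbrakk> \<Longrightarrow> k \<star> e \<in> K"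
    and KM: "\<And>a b. \<lbrakk>a \<in> Hom C X M; b \<in> Hom C M U\<rbrakk> \<Longrightarrow> b \<star> a \<in> K"
    and rad: "\<And>h. h \<in> Hom C X U \<Longrightarrow> \<exists>T0\<in>add_subcat C T. \<exists>r\<in>cat_radical C X T0. \<exists>p\<in>Hom C T0 U. p \<star> r = h"
  shows "K = Hom C X U"
proof (rule ccontr)
  assume KH: "K \<noteq> Hom C X U"
  define P where "P S \<longleftrightarrow> subspace S \<and> S \<subseteq> Hom C X U \<and> S \<noteq> Hom C X U \<and> K \<subseteq> S \<and>
    (\<forall>k\<in>S. \<forall>e\<in>Hom C X X. k \<star> e \<in> S)" for S
  obtain B where B: "finite B" "span B = Hom C X U" using Hom_finite_dim by blast
  have bound: "dim S \<le> card B" if "P S" for S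
    using that B dim_le_card[of S B] by (auto simp: P_def)
  have "P K" using K KH by (auto simp: P_def)
  then obtain S where S: "P S" and max: "\<And>S'. P S' \<Longrightarrow> dim S' \<le> dim S"
    using ex_has_greatest_nat[of P K dim "Suc (card B)"] bound by (auto simp: less_Suc_eq_le)
  have SH: "S \<subseteq> Hom C X U" and Se: "\<And>k e. \<lbrakk>k \<in> S; e \<in> Hom C X X\<rbrakk> \<Longrightarrow> k \<star> e \<in> S"
    and Ss: "subspace S" and KS: "K \<subseteq> S" using S by (auto simp: P_def)
  have maximal: "S' = Hom C X U"
    if "subspace S'" "S' \<subseteq> Hom C X U" "S \<subset> S'" "\<And>k e. \<lbrakk>k \<in> S'; e \<in> Hom C X X\<rbrakk> \<Longrightarrow> k \<star> e \<in> S'" for S'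
  proof (rule ccontr)
    assume "S' \<noteq> Hom C X U"
    then have "P S'" using that KS by (auto simp: P_def)
    moreover have "dim S < dim S'" using that B by (intro dim_strict_mono[OF Ss _ _ B(1)]) auto
    ultimately show False using max by (meson leD)
  qed
  have SJ: "x \<star> r \<in> S" if x: "x \<in> Hom C X U" and r: "r \<in> cat_radical C X X" for x r
  proof (rule ccontr)
    assume nS: "x \<star> r \<notin> S"
    have r0: "r \<in> Hom C X X" using r by (simp add: cat_radical_def)
    have xr: "x \<star> r \<in> Hom C X U" by (rule Comp_in_Hom[OF r0 x])
    let ?S = "{k + (x \<star> r) \<star> e | k e. k \<in> S \<and> e \<in> Hom C X X}"
    have "?S = Hom C X U"
    proof (rule maximal)
      show "subspace ?S"
      proof (rule subspaceI)
        have "0 = 0 + (x \<star> r) \<star> 0" using Comp_zero_right[OF xr] by simp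
        then show "0 \<in> ?S" using subspace_0[OF Ss] zero_in_Hom by blast
      next
        fix a b assume "a \<in> ?S" "b \<in> ?S"
        then obtain k e k' e' where *: "a = k + (x \<star> r) \<star> e" "b = k' + (x \<star> r) \<star> e'" "k \<in> S" "k' \<in> S"
          "e \<in> Hom C X X" "e' \<in> Hom C X X" by blast
        then have "a + b = (k + k') + (x \<star> r) \<star> (e + e')"
          using Comp_add_right[OF *(5,6) xr] by (simp add: algebra_simps)
        then show "a + b \<in> ?S" using * subspace_add[OF Ss] add_in_Hom by blast
      next
        fix c a assume "a \<in> ?S"
        then obtain k e where *: "a = k + (x \<star> r) \<star> e" "k \<in> S" "e \<in> Hom C X X" by blast
        then have "Scale C c a = Scale C c k + (x \<star> r) \<star> Scale C c e"
          using Comp_scale_right[OF *(3) xr] by (simp add: scale_right_distrib)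
        then show "Scale C c a \<in> ?S" using * subspace_scale[OF Ss] scale_in_Hom by blast
      qed
      show "?S \<subseteq> Hom C X U" using SH Comp_in_Hom[OF _ xr] add_in_Hom by auto
      have "k \<in> ?S" if "k \<in> S" for k
      proof -
        have "k = k + (x \<star> r) \<star> 0" using Comp_zero_right[OF xr] by simp
        then show ?thesis using that zero_in_Hom by blast
      qed
      moreover have "x \<star> r \<in> ?S"
      proof -
        have "x \<star> r = 0 + (x \<star> r) \<star> Ident C X" using Ident_right[OF xr] by simp
        then show ?thesis using subspace_0[OF Ss] Ident_in_Hom by blast
      qed
      ultimately show "S \<subset> ?S" using nS by blast
    next
      fix a e' assume "a \<in> ?S" and e': "e' \<in> Hom C X X"
      then obtain k e where *: "a = k + (x \<star> r) \<star> e" "k \<in> S" "e \<in> Hom C X X" by blast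
      then have "a \<star> e' = k \<star> e' + (x \<star> r) \<star> (e \<star> e')"
        using Comp_add_left[OF e', of k U "(x \<star> r) \<star> e"] SH Comp_in_Hom[OF *(3) xr]
          Comp_assoc[OF e' *(3) xr] by auto
      then show "a \<star> e' \<in> ?S" using Se[OF *(2) e'] Comp_in_Hom[OF e' *(3)] by blast
    qed
    then obtain k e where ke: "x = k + (x \<star> r) \<star> e" "k \<in> S" "e \<in> Hom C X X" using x by blast
    have re: "r \<star> e \<in> cat_radical C X X" by (rule cat_ideal_pre[OF cat_ideal_radical r ke(3)])
    have re0: "r \<star> e \<in> Hom C X X" by (rule Comp_in_Hom[OF ke(3) r0])
    have "iso_mor C X X (Ident C X - Ident C X \<star> (r \<star> e))"
      using re Ident_in_Hom unfolding cat_radical_def by blast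
    then have "iso_mor C X X (Ident C X - r \<star> e)" using Ident_left[OF re0] by simp
    then obtain u where u: "u \<in> Hom C X X" "(Ident C X - r \<star> e) \<star> u = Ident C X" by (rule iso_morE)
    have d: "Ident C X - r \<star> e \<in> Hom C X X" by (rule diff_in_Hom[OF Ident_in_Hom re0])
    have "x \<star> (Ident C X - r \<star> e) = x - (x \<star> r) \<star> e"
      using Comp_diff_right[OF Ident_in_Hom re0 x] Ident_right[OF x] Comp_assoc[OF ke(3) r0 x] by simp
    also have "\<dots> = k" using ke(1) by (simp add: algebra_simps)
    finally have "x = k \<star> u" using Comp_assoc[OF u(1) d x] u(2) Ident_right[OF x] by simp
    then have "x \<in> S" using Se[OF ke(2) u(1)] by simp
    then show False using nS Se r0 by blast
  qed
  \<comment> \<open>the ideal of maps that vanish modulo \<open>S\<close> between radical maps out of \<open>X\<close> and maps into \<open>U\<close>\<close>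
  let ?R = "\<lambda>A B. {f \<in> Hom C A B. \<forall>a\<in>cat_radical C X A. \<forall>b\<in>Hom C B U. b \<star> (f \<star> a) \<in> S}"
  have radH: "a \<in> Hom C X A" if "a \<in> cat_radical C X A" for a A using that by (simp add: cat_radical_def)
  have "cat_ideal C ?R"
  proof (rule cat_idealI, goal_cases)
    case (2 A B)
    then show ?case
      using subspace_0[OF Ss] Comp_zero_left[OF radH] Comp_zero_right by (auto simp: zero_in_Hom)
  next
    case (3 A B f g)
    have "b \<star> ((f + g) \<star> a) \<in> S" if a: "a \<in> cat_radical C X A" and b: "b \<in> Hom C B U" for a b
      using 3 a b subspace_add[OF Ss] Comp_add_left[OF radH[OF a], of f B g]
        Comp_add_right[OF Comp_in_Hom[OF radH[OF a]] Comp_in_Hom[OF radH[OF a]] b, of f g] by auto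
    then show ?case using 3 add_in_Hom by blast
  next
    case (4 A B D f g)
    have "b \<star> ((g \<star> f) \<star> a) \<in> S" if a: "a \<in> cat_radical C X A" and b: "b \<in> Hom C D U" for a b
    proof -
      have f: "f \<in> Hom C A B" and g: "g \<in> Hom C B D" using 4 by auto
      have "(b \<star> g) \<star> (f \<star> a) \<in> S" using 4 a Comp_in_Hom[OF g b] by blast
      then show ?thesis
        using Comp_assoc[OF radH[OF a] f g] Comp_assoc[OF Comp_in_Hom[OF radH[OF a] f] g b] by simp
    qed
    then show ?case using 4 Comp_in_Hom by blast
  next
    case (5 A B D f g)
    have "b \<star> ((f \<star> g) \<star> a) \<in> S" if a: "a \<in> cat_radical C X A" and b: "b \<in> Hom C D U" for a b
      using 5 a b Comp_assoc[OF radH[OF a], of g B f D] cat_ideal_post[OF cat_ideal_radical a, of g B] by auto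
    moreover have "f \<star> g \<in> Hom C A D" using 5 by (auto intro: Comp_in_Hom)
    ultimately show ?case by blast
  qed auto
  moreover have "Ident C T \<in> ?R T T"
  proof -
    from ds obtain i j p q where m: "i \<in> Hom C X T" "j \<in> Hom C M T" "p \<in> Hom C T X" "q \<in> Hom C T M"
      and e: "i \<star> p + j \<star> q = Ident C T" unfolding direct_sum_def by blast
    have "b \<star> (Ident C T \<star> a) \<in> S" if a: "a \<in> cat_radical C X T" and b: "b \<in> Hom C T U" for a b
    proof -
      note a0 = radH[OF a]
      have ip: "i \<star> p \<in> Hom C T T" and jq: "j \<star> q \<in> Hom C T T" using m by (auto intro: Comp_in_Hom)
      have "b \<star> (Ident C T \<star> a) = b \<star> ((i \<star> p) \<star> a) + b \<star> ((j \<star> q) \<star> a)"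
        using e Comp_add_left[OF a0 ip jq] Comp_add_right[OF Comp_in_Hom[OF a0 ip] Comp_in_Hom[OF a0 jq] b] by simp
      also have "\<dots> = (b \<star> i) \<star> (p \<star> a) + (b \<star> j) \<star> (q \<star> a)"
        using Comp_assoc[OF a0 m(3,1)] Comp_assoc[OF a0 m(4,2)] Comp_assoc[OF Comp_in_Hom[OF a0 m(3)] m(1) b]
          Comp_assoc[OF Comp_in_Hom[OF a0 m(4)] m(2) b] by simp
      also have "\<dots> \<in> S"
        using SJ[OF Comp_in_Hom[OF m(1) b] cat_ideal_post[OF cat_ideal_radical a m(3)]]
          KM[OF Comp_in_Hom[OF a0 m(4)] Comp_in_Hom[OF m(2) b]] KS by (intro subspace_add[OF Ss]) auto
      finally show ?thesis .
    qed
    then show ?thesis using Ident_in_Hom by blast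
  qed
  ultimately have R: "Ident C A \<in> ?R A A" if "A \<in> add_subcat C T" for A
    using add_subcat_ideal[OF that] by blast
  have "Hom C X U \<subseteq> S"
  proof
    fix h assume "h \<in> Hom C X U"
    then obtain T0 r p where "T0 \<in> add_subcat C T" and r: "r \<in> cat_radical C X T0"
      and p: "p \<in> Hom C T0 U" and h: "p \<star> r = h" using rad by blast
    then have "p \<star> (Ident C T0 \<star> r) \<in> S" using R by blast
    then show "h \<in> S" using h Ident_left[OF radH[OF r]] by simp
  qed
  then show False using S by (auto simp: P_def)
qed

end

context krull_schmidt_triangulated_category
begin

text \<open>
  With \<open>l\<close> the largest degree such that \<open>Hom(U, T[l]) \<noteq> 0\<close>, take \<open>i\<close> such that \<open>N i[l]\<close> is a summand of the minimal
  left \<open>add T[l]\<close>-approximation \<open>G: U \<rightarrow> Q\<close>. Let \<open>Z\<close> be the cone of \<open>G\<close>. For \<open>h: N i \<rightarrow> U\<close>, the map \<open>Q \<rightarrow> N i[l] \<rightarrow> U[l]\<close>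
  vanishes on \<open>U\<close>, so it factors through \<open>Z\<close>, and from there through \<open>T0[l]\<close>. The resulting map
  \<open>Q \<rightarrow> Z \<rightarrow> T0[l]\<close> kills \<open>G\<close>; if its restriction to \<open>N i[l]\<close> were split, subtracting the corresponding
  idempotent from the identity of \<open>Q\<close> would contradict minimality.
\<close>
lemma mutable_summand_exists:
  assumes T: "silting C T" and U: "silting C U" and TU: "silting_ge C T U" and UT: "\<not> silting_ge C U T"
    and bp: "biproduct C {..<n} N \<iota> \<pi> T" and N: "\<And>i. i < n \<Longrightarrow> local_obj C (N i)"
  shows "\<exists>i<n. \<forall>h\<in>Hom C (N i) U.
    \<exists>T0\<in>add_subcat C T. \<exists>r\<in>cat_radical C (N i) T0. \<exists>p\<in>Hom C T0 U. p \<star> r = h"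
proof -
  have "silting_ge C T T" using T by (simp add: silting_def silting_ge_def)
  moreover have "U \<in> thick C T" using T by (simp add: silting_def)
  ultimately obtain m where m: "\<And>j. j > m \<Longrightarrow> Hom C U (shO j T) = {0}"
    using thick_bounded by blast
  let ?A = "{j. j > 0 \<and> Hom C U (shO j T) \<noteq> {0}}"
  have "?A \<noteq> {}" using UT by (auto simp: silting_ge_def)
  have "?A \<subseteq> {..m}"
  proof
    fix j assume j: "j \<in> ?A"
    have "\<not> j > m"
    proof
      assume "j > m" then show False using m j by blast
    qed
    then show "j \<in> {..m}" by simp
  qed
  then have fin: "finite ?A" by (rule finite_subset) simp
  define l where "l = Max ?A"
  have lA: "l \<in> ?A" unfolding l_def by (rule Max_in[OF fin \<open>?A \<noteq> {}\<close>])
  then have l0: "l > 0" and lT: "Hom C U (shO l T) \<noteq> {0}" by auto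
  have above: "Hom C U (shO j T) = {0}" if "j > l" for j
  proof (rule ccontr)
    assume "Hom C U (shO j T) \<noteq> {0}"
    then have "j \<in> ?A" using that l0 by simp
    then have "j \<le> l" unfolding l_def by (rule Max_ge[OF fin])
    then show False using that by simp
  qed
  let ?T = "shO l T"
  obtain Q G where G: "left_add_approximation C ?T U Q G" and Gmin: "left_minimal C Q G"
    using minimal_left_approximation_exists by blast
  have Q: "Q \<in> add_subcat C ?T" and G0: "G \<in> Hom C U Q"
    and Gfac: "\<And>A h. \<lbrakk>A \<in> add_subcat C ?T; h \<in> Hom C U A\<rbrakk> \<Longrightarrow> \<exists>h'\<in>Hom C Q A. h' \<star> G = h"
    using G by (auto simp: left_add_approximation_def)
  have Qnz: "Ident C Q \<noteq> 0"
  proof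
    assume "Ident C Q = 0"
    then have G00: "G = 0" using Ident_left[OF G0] Comp_zero_left[OF G0] by simp
    have "Hom C U ?T = {0}"
    proof (rule Hom_zeroI)
      fix h assume "h \<in> Hom C U ?T"
      then obtain h' where "h' \<in> Hom C Q ?T" "h' \<star> G = h" using Gfac[OF add_subcat.self] by blast
      then show "h = 0" using G00 Comp_zero_right by blast
    qed
    then show False using lT by simp
  qed
  \<comment> \<open>Some \<open>N i[l]\<close> is a direct summand of \<open>Q\<close>.\<close>
  obtain k :: nat and L \<kappa> \<rho> where bpQ: "biproduct C {..<k} L \<kappa> \<rho> Q" and L: "\<forall>i<k. local_obj C (L i)"
    using local_decomposition by blast
  have "k \<noteq> 0"
  proof
    assume "k = 0" then show False using biproduct_sum[OF bpQ] Qnz by simp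
  qed
  then have k0: "0 \<in> {..<k}" by simp
  have L0: "local_obj C (L 0)" using L k0 by simp
  have L0T: "L 0 \<in> add_subcat C ?T" by (rule biproduct_summand_in_add[OF bpQ k0 Q])
  have "iso_mor C (L 0) (L 0) (Ident C (L 0) \<star> Ident C (L 0))"
    by (simp add: Ident_left[OF Ident_in_Hom] iso_mor_Ident)
  from add_subcat_local_split[OF L0 L0T Ident_in_Hom Ident_in_Hom this]
  obtain a b where "a \<in> Hom C (L 0) ?T" "b \<in> Hom C ?T (L 0)" "iso_mor C (L 0) (L 0) (b \<star> a)" by blast
  from biproduct_local_summand[OF biproduct_shift[OF bp, of l] _ L0 this]
  obtain i c where i: "i < n" and c: "iso_mor C (L 0) (shO l (N i)) c"
    using local_obj_shift[OF N] by auto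
  let ?X = "shO l (N i)"
  obtain c' where c': "c' \<in> Hom C ?X (L 0)" "c \<star> c' = Ident C ?X" using c by (rule iso_morE)
  note c0 = iso_mor_in_Hom[OF c]
  note \<kappa>0 = biproduct_inj[OF bpQ k0] and \<rho>0 = biproduct_proj[OF bpQ k0]
  define inj where "inj = \<kappa> 0 \<star> c'"
  define prj where "prj = c \<star> \<rho> 0"
  have inj: "inj \<in> Hom C ?X Q" unfolding inj_def by (rule Comp_in_Hom[OF c'(1) \<kappa>0])
  have prj: "prj \<in> Hom C Q ?X" unfolding prj_def by (rule Comp_in_Hom[OF \<rho>0 c0])
  have pi: "prj \<star> inj = Ident C ?X"
    unfolding inj_def prj_def
    using Comp_assoc[OF Comp_in_Hom[OF c'(1) \<kappa>0] \<rho>0 c0] Comp_assoc[OF c'(1) \<kappa>0 \<rho>0]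
      biproduct_proj_inj[OF bpQ k0 k0] Ident_left[OF c'(1)] c'(2) by simp
  obtain Z v w where D: "Dist C U Q Z G v w" using Dist_cone[OF G0] by blast
  note v0 = Dist_Hom2[OF D] and w0 = Dist_Hom3[OF D]
  \<comment> \<open>In degree \<open>l + 1\<close> the approximation property of \<open>G\<close> is used, above it the choice of \<open>l\<close>.\<close>
  have ZT: "Hom C Z (shO j T) = {0}" if j: "j \<ge> Suc l" for j
  proof (rule Hom_zeroI)
    fix t assume t: "t \<in> Hom C Z (shO j T)"
    have "Hom C T (shO (j - l) T) = {0}" using T j by (simp add: silting_def)
    then have "Hom C ?T (shO j T) = {0}" using j by (intro Hom_shift_zero_diff) simp_all
    then have "Hom C Q (shO j T) = {0}" by (rule add_subcat_Hom_zero_source[OF Q])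
    then have "t \<star> v = 0" using Comp_in_Hom[OF v0 t] by blast
    then obtain s where s: "s \<in> Hom C (ShO C U) (shO j T)" "s \<star> w = t"
      using Dist_extend[OF Dist_rot[OF D] t] by blast
    show "t = 0"
    proof (cases "j = Suc l")
      case True
      obtain s' where s': "s' \<in> Hom C U ?T" "s = ShM C s'"
        using ShM_funpow_full[of s 1 U ?T] s(1) True by auto
      obtain x where x: "x \<in> Hom C Q ?T" "x \<star> G = s'" using Gfac[OF add_subcat.self s'(1)] by blast
      have "s \<star> w = ShM C x \<star> (ShM C G \<star> w)"
        using s'(2) x(2) ShM_Comp[OF G0 x(1)] Comp_assoc[OF w0 ShM_in_Hom[OF G0] ShM_in_Hom[OF x(1)]] by simp
      then show ?thesis using s(2) Dist_comp'[OF D] Comp_zero_right[OF ShM_in_Hom[OF x(1)]] by simp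
    next
      case False
      have "Hom C U (shO (j - 1) T) = {0}" using False j by (intro above) simp
      then have "Hom C (ShO C U) (shO j T) = {0}" using Hom_shift_zero_diff[of U j 1 T] j by simp
      then show ?thesis using s Comp_zero_left[OF w0] by simp
    qed
  qed
  obtain T0 p Y' where T0: "T0 \<in> add_subcat C T" and p: "p \<in> Hom C T0 U" and Y': "silting_ge C T Y'"
    and lift: "\<And>Z j s. Hom C Z (shO (Suc j) Y') = {0} \<Longrightarrow> s \<in> Hom C Z (shO j U) \<Longrightarrow>
        \<exists>t\<in>Hom C Z (shO j T0). shM j p \<star> t = s"
    using silting_approximation_step[OF T TU] by meson
  have ZY: "Hom C Z (shO (Suc l) Y') = {0}" by (rule silting_vanishing[OF T ZT Y' order_refl])
  have "\<exists>r\<in>cat_radical C (N i) T0. p \<star> r = h" if h: "h \<in> Hom C (N i) U" for h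
  proof -
    note hl = ShM_funpow_in_Hom[OF h, of l] and pl = ShM_funpow_in_Hom[OF p, of l]
    have hp: "shM l h \<star> prj \<in> Hom C Q (shO l U)" by (rule Comp_in_Hom[OF prj hl])
    have "Hom C U (shO l U) = {0}" using U l0 by (simp add: silting_def)
    then have "(shM l h \<star> prj) \<star> G = 0" using Comp_in_Hom[OF G0 hp] by blast
    then obtain s where s: "s \<in> Hom C Z (shO l U)" "s \<star> v = shM l h \<star> prj"
      using Dist_extend[OF D hp] by blast
    obtain t where t: "t \<in> Hom C Z (shO l T0)" "shM l p \<star> t = s" using lift[OF ZY s(1)] by blast
    have tv: "t \<star> v \<in> Hom C Q (shO l T0)" by (rule Comp_in_Hom[OF v0 t(1)])
    obtain r where r: "r \<in> Hom C (N i) T0" "(t \<star> v) \<star> inj = shM l r"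
      using Comp_in_Hom[OF inj tv] by (rule ShM_funpow_full)
    have "shM l (p \<star> r) = ((shM l p \<star> t) \<star> v) \<star> inj"
      using ShM_funpow_Comp[OF r(1) p, of l] r(2) Comp_assoc[OF inj tv pl] Comp_assoc[OF v0 t(1) pl] by simp
    also have "\<dots> = shM l h"
      using t(2) s(2) Comp_assoc[OF inj prj hl] pi Ident_right[OF hl] by simp
    finally have pr: "p \<star> r = h" using ShM_funpow_eq_iff[OF Comp_in_Hom[OF r(1) p] h] by blast
    have "r \<in> cat_radical C (N i) T0"
    proof (rule ccontr)
      assume "r \<notin> cat_radical C (N i) T0"
      then obtain q where q: "q \<in> Hom C T0 (N i)" "q \<star> r = Ident C (N i)"
        using local_split_mono[OF N[OF i] r(1)] by blast
      note ql = ShM_funpow_in_Hom[OF q(1), of l]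
      have qtv: "shM l q \<star> (t \<star> v) \<in> Hom C Q ?X" by (rule Comp_in_Hom[OF tv ql])
      have one: "(shM l q \<star> (t \<star> v)) \<star> inj = Ident C ?X"
        using Comp_assoc[OF inj tv ql] r(2) ShM_funpow_Comp[OF r(1) q(1), of l] q(2)
        by (simp add: ShM_funpow_Ident)
      \<comment> \<open>an idempotent of \<open>Q\<close> with image \<open>N i[l]\<close> that kills \<open>G\<close>\<close>
      let ?d = "inj \<star> (shM l q \<star> (t \<star> v))"
      have d: "?d \<in> Hom C Q Q" by (rule Comp_in_Hom[OF qtv inj])
      have "?d \<star> G = inj \<star> (shM l q \<star> (t \<star> (v \<star> G)))"
        using Comp_assoc[OF G0 qtv inj] Comp_assoc[OF G0 tv ql] Comp_assoc[OF G0 v0 t(1)] by simp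
      also have "\<dots> = 0"
        using Dist_comp[OF D] Comp_zero_right[OF t(1)] Comp_zero_right[OF ql] Comp_zero_right[OF inj] by simp
      finally have dG: "?d \<star> G = 0" .
      have e: "Ident C Q - ?d \<in> Hom C Q Q" by (rule diff_in_Hom[OF Ident_in_Hom d])
      have "(Ident C Q - ?d) \<star> G = G" using Comp_diff_left[OF G0 Ident_in_Hom d] dG Ident_left[OF G0] by simp
      then have "iso_mor C Q Q (Ident C Q - ?d)" using Gmin e by (simp add: left_minimal_def)
      then obtain u where u: "u \<in> Hom C Q Q" "u \<star> (Ident C Q - ?d) = Ident C Q" by (rule iso_morE)
      have "(Ident C Q - ?d) \<star> inj = 0"
        using Comp_diff_left[OF inj Ident_in_Hom d] Comp_assoc[OF inj qtv inj] one
          Ident_left[OF inj] Ident_right[OF inj] by simp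
      then have "inj = 0" using Comp_assoc[OF inj e u(1)] u(2) Ident_left[OF inj] Comp_zero_right[OF u(1)] by simp
      then have "Ident C ?X = 0" using pi Comp_zero_right[OF prj] by simp
      then show False using local_obj_shift[OF N[OF i], of l] by (simp add: local_obj_iff)
    qed
    then show ?thesis using pr by blast
  qed
  then show ?thesis using i T0 p by blast
qed

lemma basic_pairwise_non_isomorphic:
  assumes bp: "biproduct C I N \<iota> \<pi> T" and N: "\<And>i. i \<in> I \<Longrightarrow> local_obj C (N i)" and T: "basic_obj C T"
    and i: "i \<in> I" and j: "j \<in> I" and iso: "iso_obj C (N i) (N j)"
  shows "i = j"
proof (rule ccontr)
  assume ij: "i \<noteq> j"
  obtain V \<iota>' \<pi>' where V: "biproduct C (I - {i}) N \<iota>' \<pi>' V" "direct_sum C (N i) V T"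
    using biproduct_direct_sum[OF bp i] by blast
  have jV: "j \<in> I - {i}" using j ij by blast
  obtain a b where ab: "a \<in> Hom C (N i) V" "b \<in> Hom C V (N i)" "b \<star> a = Ident C (N i)"
    using biproduct_iso_summand[OF V(1) jV iso] by blast
  have "Ident C (N i) \<noteq> 0" using N[OF i] by (simp add: local_obj_iff)
  then show False
    using basic_nonsplit[OF bp N T V(2) _ ab(1,2)] ab(3) iso_mor_Ident[of "N i"] by simp
qed

text \<open>
  The maps \<open>X \<rightarrow> U\<close> that factor through \<open>M'\<close> form the submodule \<open>?K\<close>, to which \<open>local_nakayama\<close> is applied.
  The summands of \<open>V\<close> are those of \<open>T\<close> with \<open>X\<close> replaced by \<open>Y\<close>.
\<close>
lemma left_mutation_step:
  assumes T: "basic_silting C T" and U: "silting C U" and TU: "silting_ge C T U"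
    and UT: "\<not> silting_ge C U T"
  shows "\<exists>V. irreducible_left_mutation C T V \<and> basic_silting C V \<and> silting_ge C T V \<and>
     silting_ge C V U \<and> \<not> silting_ge C V T"
proof -
  have sT: "silting C T" and bT: "basic_obj C T" using T by (auto simp: basic_silting_def)
  obtain n :: nat and N \<iota> \<pi> where bp: "biproduct C {..<n} N \<iota> \<pi> T" and N: "\<And>i. i < n \<Longrightarrow> local_obj C (N i)"
    using local_decomposition by blast
  obtain i where i: "i < n"
    and rad: "\<And>h. h \<in> Hom C (N i) U \<Longrightarrow>
      \<exists>T0\<in>add_subcat C T. \<exists>r\<in>cat_radical C (N i) T0. \<exists>p\<in>Hom C T0 U. p \<star> r = h"
    using mutable_summand_exists[OF sT U TU UT bp N] by blast
  have iI: "i \<in> {..<n}" using i by simp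
  note X = N[OF i]
  obtain M \<iota>' \<pi>' where bpM: "biproduct C ({..<n} - {i}) N \<iota>' \<pi>' M" and ds: "direct_sum C (N i) M T"
    using biproduct_direct_sum[OF bp iI] by blast
  obtain M' f where f: "left_add_approximation C M (N i) M' f" and fmin: "left_minimal C M' f"
    using minimal_left_approximation_exists by blast
  have f0: "f \<in> Hom C (N i) M'" and M': "M' \<in> add_subcat C M"
    and fac: "\<And>A h. \<lbrakk>A \<in> add_subcat C M; h \<in> Hom C (N i) A\<rbrakk> \<Longrightarrow> \<exists>h'\<in>Hom C M' A. h' \<star> f = h"
    using f by (auto simp: left_add_approximation_def)
  obtain Y g h where D: "Dist C (N i) M' Y f g h" using Dist_cone[OF f0] by blast
  obtain V where V: "direct_sum C Y M V" using direct_sum_exists by blast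
  have Nloc: "\<And>j. j \<in> {..<n} \<Longrightarrow> local_obj C (N j)" using N by simp
  have nonsplit: "\<not> iso_mor C (N i) (N i) (b \<star> a)" if "a \<in> Hom C (N i) M" "b \<in> Hom C M (N i)" for a b
    using X by (intro basic_nonsplit[OF bp Nloc bT ds _ that]) (auto simp: local_obj_iff)
  note mut = sT ds X nonsplit f fmin D
  let ?K = "{t \<star> f | t. t \<in> Hom C M' U}"
  have "?K = Hom C (N i) U"
  proof (rule local_nakayama[OF ds])
    show "subspace ?K"
    proof (rule subspaceI)
      show "0 \<in> ?K" using Comp_zero_left[OF f0] zero_in_Hom[of M' U] by force
    next
      fix a b assume "a \<in> ?K" "b \<in> ?K"
      then obtain s t where "a = s \<star> f" "b = t \<star> f" "s \<in> Hom C M' U" "t \<in> Hom C M' U" by blast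
      then show "a + b \<in> ?K" using Comp_add_left[OF f0, of s U t] add_in_Hom by force
    next
      fix c a assume "a \<in> ?K"
      then obtain s where s: "a = s \<star> f" "s \<in> Hom C M' U" by blast
      then have "Scale C c a = Scale C c s \<star> f" using Comp_scale_left[OF f0 s(2)] by simp
      then show "Scale C c a \<in> ?K" using scale_in_Hom[OF s(2)] by blast
    qed
    show "?K \<subseteq> Hom C (N i) U" using Comp_in_Hom[OF f0] by blast
  next
    fix k e assume "k \<in> ?K" and e: "e \<in> Hom C (N i) (N i)"
    then obtain t where t: "k = t \<star> f" "t \<in> Hom C M' U" by blast
    obtain b where b: "b \<in> Hom C M' M'" "b \<star> f = f \<star> e" using fac[OF M' Comp_in_Hom[OF e f0]] by blast
    have "k \<star> e = (t \<star> b) \<star> f"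
      using t(1) Comp_assoc[OF e f0 t(2)] Comp_assoc[OF f0 b(1) t(2)] b(2) by simp
    then show "k \<star> e \<in> ?K" using Comp_in_Hom[OF b(1) t(2)] by blast
  next
    fix a b assume a: "a \<in> Hom C (N i) M" and b: "b \<in> Hom C M U"
    obtain a' where a': "a' \<in> Hom C M' M" "a' \<star> f = a" using fac[OF add_subcat.self a] by blast
    have "b \<star> a = (b \<star> a') \<star> f" using Comp_assoc[OF f0 a'(1) b] a'(2) by simp
    then show "b \<star> a \<in> ?K" using Comp_in_Hom[OF a'(1) b] by blast
  qed (rule rad)
  then have ext: "\<exists>t\<in>Hom C M' U. t \<star> f = s" if "s \<in> Hom C (N i) U" for s
  proof -
    have "s \<in> ?K" using that \<open>?K = Hom C (N i) U\<close> by (simp only:)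
    then show ?thesis by blast
  qed
  have sV: "silting C V" by (rule mutation_silting[OF mut V])
  have TV: "silting_ge C T V" by (rule mutation_le[OF mut V])
  have VU: "silting_ge C V U" by (rule mutation_ge[OF mut V TU ext])
  have VT: "\<not> silting_ge C V T" by (rule mutation_not_ge[OF mut V])
  have Y: "local_obj C Y" by (rule cone_local[OF mut])
  have YM: "\<not> iso_obj C Y (N j)" if j: "j < n" "j \<noteq> i" for j
  proof
    assume "iso_obj C Y (N j)"
    moreover have "j \<in> {..<n} - {i}" using j by simp
    ultimately obtain a b where "a \<in> Hom C Y M" "b \<in> Hom C M Y" "b \<star> a = Ident C Y"
      using biproduct_iso_summand[OF bpM] by blast
    then show False using cone_not_summand[OF mut] by blast
  qed
  obtain m where m: "n = Suc m" using i by (cases n) auto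
  let ?N = "N(i := Y)"
  have "biproduct C ({..<n} - {i}) ?N \<iota>' \<pi>' M" by (rule biproduct_cong[OF bpM]) auto
  then have "\<exists>\<kappa> \<rho>. biproduct C (insert i ({..<n} - {i})) ?N \<kappa> \<rho> V"
    by (rule biproduct_insert) (use V in auto)
  then obtain \<kappa> \<rho> where bpV: "biproduct C {..<Suc m} ?N \<kappa> \<rho> V"
    using iI m by (simp only: insert_Diff) blast
  have "basic_obj C V"
  proof (rule basic_if_pairwise_non_isomorphic[OF bpV])
    show "local_obj C (?N j)" if "j < Suc m" for j using that N Y m by simp
    show "j = k" if jk: "j < Suc m" "k < Suc m" and iso: "iso_obj C (?N j) (?N k)" for j k
    proof -
      consider "j = i" "k = i" | "j = i" "k \<noteq> i" | "j \<noteq> i" "k = i" | "j \<noteq> i" "k \<noteq> i" by blast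
      then show ?thesis
      proof cases
        case 2 then show ?thesis using YM[of k] jk iso m by simp
      next
        case 3 then show ?thesis using YM[of j] jk iso_obj_sym[OF iso] m by simp
      next
        case 4 then show ?thesis
          using basic_pairwise_non_isomorphic[OF bp Nloc bT, of j k] jk iso m by simp
      qed simp
    qed
  qed
  then have "basic_silting C V" using sV by (simp add: basic_silting_def)
  moreover have "irreducible_left_mutation C T V"
    unfolding irreducible_left_mutation_def left_mutation_def
    using local_indecomposable[OF X] T ds f fmin D V by blast
  ultimately show ?thesis using TV VU VT by blast
qed

text \<open>
  If \<open>U \<ge> T\<close>, then \<open>silting_vanishing\<close> removes the obstruction to lifting the identity of \<open>U\<close> along the
  right \<open>add T\<close>-approximation \<open>T0 \<rightarrow> U\<close>. So \<open>U\<close> is a summand of \<open>T0\<close>, and its local summands are among those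
  of \<open>T\<close>.
\<close>
lemma silting_ge_antisym_summand:
  assumes T: "silting C T" and TU: "silting_ge C T U" and UT: "silting_ge C U T"
    and bp: "biproduct C I N \<iota> \<pi> T" and N: "\<And>i. i \<in> I \<Longrightarrow> local_obj C (N i)"
    and bpU: "biproduct C J L \<kappa> \<rho> U" and L: "\<And>j. j \<in> J \<Longrightarrow> local_obj C (L j)" and j: "j \<in> J"
  shows "\<exists>i\<in>I. iso_obj C (L j) (N i)"
proof -
  obtain T0 p Y' where T0: "T0 \<in> add_subcat C T" and p: "p \<in> Hom C T0 U" and Y': "silting_ge C T Y'"
    and lift: "\<And>Z j s. Hom C Z (shO (Suc j) Y') = {0} \<Longrightarrow> s \<in> Hom C Z (shO j U) \<Longrightarrow>
        \<exists>t\<in>Hom C Z (shO j T0). shM j p \<star> t = s"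
    using silting_approximation_step[OF T TU] by meson
  have "Hom C U (shO (Suc 0) Y') = {0}"
    using UT by (intro silting_vanishing[OF T _ Y' order_refl]) (simp add: silting_ge_def)
  then obtain s where s: "s \<in> Hom C U T0" "p \<star> s = Ident C U"
    using lift[of U 0 "Ident C U"] Ident_in_Hom by auto
  note i = biproduct_inj[OF bpU j] and q = biproduct_proj[OF bpU j]
  have "(\<rho> j \<star> p) \<star> (s \<star> \<kappa> j) = \<rho> j \<star> ((p \<star> s) \<star> \<kappa> j)"
    using Comp_assoc[OF Comp_in_Hom[OF i s(1)] p q] Comp_assoc[OF i s(1) p] by simp
  also have "\<dots> = Ident C (L j)" using s(2) Ident_left[OF i] biproduct_proj_inj[OF bpU j j] by simp
  finally have "iso_mor C (L j) (L j) ((\<rho> j \<star> p) \<star> (s \<star> \<kappa> j))" using iso_mor_Ident by simp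
  from add_subcat_local_split[OF L[OF j] T0 Comp_in_Hom[OF i s(1)] Comp_in_Hom[OF p q] this]
  obtain a b where "a \<in> Hom C (L j) T" "b \<in> Hom C T (L j)" "iso_mor C (L j) (L j) (b \<star> a)" by blast
  from biproduct_local_summand[OF bp N L[OF j] this] show ?thesis unfolding iso_obj_def by blast
qed

text \<open>
  Each local summand of \<open>U\<close> is isomorphic to one of \<open>T\<close> and conversely; without multiplicities this is a
  bijection.
\<close>
lemma silting_ge_antisym:
  assumes T: "basic_silting C T" and U: "basic_silting C U" and TU: "silting_ge C T U" and UT: "silting_ge C U T"
  shows "iso_obj C T U"
proof -
  have sT: "silting C T" "basic_obj C T" and sU: "silting C U" "basic_obj C U"
    using T U by (auto simp: basic_silting_def)
  obtain n :: nat and N \<iota> \<pi> where bp: "biproduct C {..<n} N \<iota> \<pi> T" and N: "\<forall>i<n. local_obj C (N i)"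
    using local_decomposition by blast
  obtain m :: nat and L \<kappa> \<rho> where bpU: "biproduct C {..<m} L \<kappa> \<rho> U" and L: "\<forall>i<m. local_obj C (L i)"
    using local_decomposition by blast
  have N: "\<And>i. i \<in> {..<n} \<Longrightarrow> local_obj C (N i)" and L: "\<And>i. i \<in> {..<m} \<Longrightarrow> local_obj C (L i)"
    using N L by auto
  have "\<forall>j\<in>{..<m}. \<exists>i. i \<in> {..<n} \<and> iso_obj C (L j) (N i)"
    using silting_ge_antisym_summand[OF sT(1) TU UT bp N bpU L] by blast
  then obtain \<sigma> where \<sigma>: "\<And>j. j \<in> {..<m} \<Longrightarrow> \<sigma> j \<in> {..<n}" "\<And>j. j \<in> {..<m} \<Longrightarrow> iso_obj C (L j) (N (\<sigma> j))"
    by metis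
  have "bij_betw \<sigma> {..<m} {..<n}"
    unfolding bij_betw_def
  proof
    show "inj_on \<sigma> {..<m}"
    proof (rule inj_onI)
      fix j k assume jk: "j \<in> {..<m}" "k \<in> {..<m}" "\<sigma> j = \<sigma> k"
      have iso: "iso_obj C (L j) (L k)"
        using iso_obj_trans[OF \<sigma>(2)[OF jk(1)]] iso_obj_sym[OF \<sigma>(2)[OF jk(2)]] jk(3) by simp
      show "j = k" by (rule basic_pairwise_non_isomorphic[OF bpU L sU(2) jk(1,2) iso])
    qed
    have "i \<in> \<sigma> ` {..<m}" if i: "i \<in> {..<n}" for i
    proof -
      obtain j where j: "j \<in> {..<m}" "iso_obj C (N i) (L j)"
        using silting_ge_antisym_summand[OF sU(1) UT TU bpU L bp N i] by blast
      have "i = \<sigma> j"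
        by (rule basic_pairwise_non_isomorphic[OF bp N sT(2) i \<sigma>(1)[OF j(1)]
              iso_obj_trans[OF j(2) \<sigma>(2)[OF j(1)]]])
      then show ?thesis using j by blast
    qed
    then show "\<sigma> ` {..<m} = {..<n}" using \<sigma>(1) by blast
  qed
  from biproduct_reindex[OF this bp]
  have bp': "biproduct C {..<m} (\<lambda>j. N (\<sigma> j)) (\<lambda>j. \<iota> (\<sigma> j)) (\<lambda>j. \<pi> (\<sigma> j)) T" .
  obtain \<kappa>' \<rho>' where "biproduct C {..<m} (\<lambda>j. N (\<sigma> j)) \<kappa>' \<rho>' U"
    using biproduct_transport[OF bpU, of "\<lambda>j. N (\<sigma> j)"] \<sigma>(2) by blast
  then show ?thesis by (rule biproduct_iso_obj[OF bp'])
qed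

lemma silting_ge_iso: "\<lbrakk>silting_ge C V P; iso_obj C P T\<rbrakk> \<Longrightarrow> silting_ge C V T"
  unfolding silting_ge_def using Hom_zero_iso[OF iso_obj_refl ShO_funpow_iso] by blast

end

section \<open>Iterated mutation\<close>

theorem theorem3p5:
  fixes C :: "('k::field, 'o, 'm::ab_group_add) shift_category" and T U :: 'o
  assumes "krull_schmidt_triangulated_category C"
    and "basic_silting C T" and "basic_silting C U"
    and "silting_ge C T U"
    and "finite ({P. basic_silting C P \<and> silting_ge C T P \<and> silting_ge C P U} // iso_rel C)"
  shows "left_connected C U T"
proof -
  interpret krull_schmidt_triangulated_category C by fact
  have sU: "silting C U" using assms(3) by (simp add: basic_silting_def)
  let ?S = "\<lambda>T. {P. basic_silting C P \<and> silting_ge C T P \<and> silting_ge C P U}"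
  from assms(2,4,5) show ?thesis
  proof (induction "card (?S T // iso_rel C)" arbitrary: T rule: less_induct)
    case less
    show ?case
    proof (cases "silting_ge C U T")
      case True
      then have "iso_obj C T U" using silting_ge_antisym less.prems assms(3) by blast
      then show ?thesis unfolding left_connected_def by blast
    next
      case False
      obtain V where V: "irreducible_left_mutation C T V" "basic_silting C V" "silting_ge C T V"
        "silting_ge C V U" "\<not> silting_ge C V T"
        using left_mutation_step[OF less.prems(1) sU less.prems(2) False] by blast
      have sV: "silting C V" using V by (simp add: basic_silting_def)
      have sub: "?S V // iso_rel C \<subseteq> ?S T // iso_rel C"
        using silting_ge_trans[OF sV V(3)] by (auto simp: quotient_def)
      \<comment> \<open>The class of \<open>T\<close> itself disappears from the interval, since \<open>V \<ge> T\<close> fails.\<close>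
      have "T \<in> ?S T" using less.prems by (auto simp: basic_silting_def silting_def silting_ge_def)
      then have "iso_rel C `` {T} \<in> ?S T // iso_rel C" by (rule quotientI)
      moreover have "iso_rel C `` {T} \<notin> ?S V // iso_rel C"
      proof
        assume "iso_rel C `` {T} \<in> ?S V // iso_rel C"
        then obtain P where P: "silting_ge C V P" "iso_rel C `` {T} = iso_rel C `` {P}"
          by (auto elim!: quotientE)
        have "T \<in> iso_rel C `` {P}" unfolding P(2)[symmetric] using iso_obj_refl by (simp add: iso_rel_def)
        then have "iso_obj C P T" by (simp add: iso_rel_def)
        then show False using silting_ge_iso[OF P(1)] V(5) by blast
      qed
      ultimately have "?S V // iso_rel C \<subset> ?S T // iso_rel C" using sub by blast
      then have "card (?S V // iso_rel C) < card (?S T // iso_rel C)"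
        by (rule psubset_card_mono[OF less.prems(3)])
      then have "left_connected C U V"
        using less.hyps V(2,4) finite_subset[OF sub less.prems(3)] by blast
      then show ?thesis
        using V(1) unfolding left_connected_def by (meson converse_rtranclp_into_rtranclp)
    qed
  qed
qed

end
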